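(* Let $\sigma$ be an $m$-primitive aperiodic substitution over a finite alphabet $A$ (with $X_\sigma$ uncountable), with fixed points $w_i\in Z_i$, $\sigma(w_i)=w_i$, $i=1,\dots,m$, with set of return words $\mathcal R$ and derivative substitution $\tau:\mathcal R\to\mathcal R^+$. Let $B=(V,E,\le)$ be the stationary ordered Bratteli diagram built by the matrix of the substitution $\tau$, where $\tau$ is the substitution read on $B$. Suppose also that $B$ has $|w|$ edges between the top vertex $v_0$ and the vertex of the first level defined by the return word $w\in\mathcal R$, for every $w\in\mathcal R$. Then $B$ admits a continuous dynamics $(X_B,T_B)$ (i.e. a Vershik homeomorphism $T_B$ of $X_B$) which is homeomorphic to $(X_\sigma,T_\sigma)$.
   Context: Substitutions. $A^+$ is the set of nonempty words over $A$; a substitution $\sigma:A\to A^+$ is extended to $A^+$ and $A^{\mathbb Z}$ by concatenation (in $\sigma(y)$ the word $\sigma(y[0])$ starts at coordinate $0$). $L(\sigma)$ is the set of all factors of $\sigma^n(a)$, $a\in A$, $n\ge1$. $X_\sigma=\{x\in A^{\mathbb Z}:x[-n,n]\in L(\sigma)\text{ for all }n\}$, $T_\sigma$ is the left shift, and $L(X_\sigma)$ is the set of words occurring in elements of $X_\sigma$. $\sigma$ is aperiodic if $(X_\sigma,T_\sigma)$ has no periodic points. Standing assumption: $X_\sigma$ is uncountable. Write $v\prec w$ if $v$ is a factor of $w$. For $m>0$, $\sigma$ is $m$-primitive if $A=A_1\sqcup\dots\sqcup A_m\sqcup A_0$ with $|A_i|\ge2$ for $i=1,\dots,m$ and: (a)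 $\sigma(A_i)\subset A_i^+$ and $\sigma|_{A_i}$ is primitive for $i=1,\dots,m$ (some power of $\sigma|_{A_i}$ maps each letter of $A_i$ to a word containing all letters of $A_i$); (b) for all $a\in A$ there are $b\in A_1\cup\dots\cup A_m$ and $i>0$ with $b\prec\sigma^i(a)$; (c) $L(\sigma)=L(\sigma^k)$ for all $k\ge1$; (d) $A\subset L(X_\sigma)$. Let $Z_i=\{x\in X_\sigma: \text{for every } n,\ x_{[-n,n]}\text{ is a factor of some }\sigma^k(a),\ a\in A_i\}$ be the minimal components. It is assumed (after replacing $\sigma$ by a power if necessary) that there are $w_i\in Z_i$ with $\sigma(w_i)=w_i$, $i=1,\dots,m$; these are fixed. Put $r_i=w_i[-1]$, $l_i=w_i[0]$. A return word is a word $w\in L(X_\sigma)$ for which there are $1\le i,j\le m$ such that (i) $r_iwl_j\in L(X_\sigma)$; (ii) the first and last letters of $w$ are $l_i$ and $r_j$; (iii) none of the words $r_1l_1,\dots,r_ml_m$ appears in $w$. The set $\mathcal R$ of return words is finite. For $w\in\mathcal R$, $\sigma(w)$ has a unique decomposition $\sigma(w)=d_1\cdots d_q$ into return words (cutting between $r_k$ and $l_k$ at each occurrence of a word $r_kl_k$); the derivative substitution $\tau:\mathcal R\to\mathcal R^+$ is $\tau(w)=d_1\cdots d_q$, viewed as a word over the alphabet $\mathcal R$. $|w|$ is the length of $w$ as a word over $A$. Bratteli diagrams. A Bratteli diagram is an infinite graph $B=(V,E)$, $V=\bigcup_{i\ge 0}V_i$, $E=\bigcup_{i\ge 1}E_i$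 (disjoint finite sets, $V_0=\{v_0\}$), with range and source maps $r,s:E\to V$ such that $r(E_i)=V_i$, $s(E_i)=V_{i-1}$, $s^{-1}(v)\ne\emptyset$ for $v\in V$, $r^{-1}(v')\neq\emptyset$ for $v'\in V\setminus V_0$. $X_B$ is the space of infinite paths $x=(x_1,x_2,\dots)$, $x_i\in E_i$, $r(x_i)=s(x_{i+1})$, with the topology generated by cylinder sets. An ordered Bratteli diagram $B=(V,E,\le)$ carries a partial order on each $E_i$ with $e,e'$ comparable iff $r(e)=r(e')$. A path is maximal (minimal) if each of its edges $e$ is maximal (minimal) in $r^{-1}(r(e))$; $X_{\max},X_{\min}$ are the sets of maximal and minimal infinite paths. A Vershik homeomorphism is a homeomorphism $\varphi:X_B\to X_B$ with $\varphi(X_{\max})=X_{\min}$ and, for $x\notin X_{\max}$, $\varphi(x)=(x_1^0,\dots,x_{k-1}^0,\overline{x_k},x_{k+1},\dots)$, where $k=\min\{n\ge1:x_n\text{ not maximal}\}$, $\overline{x_k}$ is the successor of $x_k$ in $r^{-1}(r(x_k))$ and $(x_1^0,\dots,x_{k-1}^0)$ is the minimal path from $v_0$ to $s(\overline{x_k})$. $B$ is stationary ordered if its vertices can be labeled $V_n=\{V_n(c):c\in C\}$, $n\ge1$, by an alphabet $C$ so that the incidence matrix between levels $n$ and $n+1$ and the ordering of the edges with range $V_{n+1}(c)$, $c\in C$, do not depend on $n\ge1$. The substitution read on $B$ is the map $C\to C^+$, $c\mapsto c_1\cdots c_k$, where $(c_1,\dots,c_k)$ are the labels of the sources of the edges with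 range $V_n(c)$ ($n\ge2$), listed in increasing order. Here $C=\mathcal R$ and the substitution read on $B$ is $\tau$ (so the number of edges from $V_{n}(d)$ to $V_{n+1}(w)$, $n\ge1$, is the number of occurrences of $d$ in $\tau(w)$). Two systems are homeomorphic if there is a homeomorphism between the spaces intertwining the two maps. *)

theory Defs
  imports "HOL-Analysis.Analysis" "HOL-Library.Sublist"
begin

section \<open>Substitutions\<close>

type_synonym 'a bseq = "int \<Rightarrow> 'a"

definition substitution :: "('a \<Rightarrow> 'a list) \<Rightarrow> bool" where
  "substitution \<sigma> \<longleftrightarrow> (\<forall>a. \<sigma> a \<noteq> [])"

definition subst_word :: "('a \<Rightarrow> 'a list) \<Rightarrow> 'a list \<Rightarrow> 'a list" where
  "subst_word \<sigma> u = concat (map \<sigma> u)"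

definition subst_power :: "('a \<Rightarrow> 'a list) \<Rightarrow> nat \<Rightarrow> 'a \<Rightarrow> 'a list" where
  "subst_power \<sigma> n a = (subst_word \<sigma> ^^ n) [a]"

text \<open>\<open>subst_pos \<sigma> y k\<close> is the coordinate at which the block \<open>\<sigma> (y k)\<close> starts in \<open>\<sigma>(y)\<close>;
  the block \<open>\<sigma> (y 0)\<close> starts at \<open>0\<close>.\<close>

definition subst_pos :: "('a \<Rightarrow> 'a list) \<Rightarrow> 'a bseq \<Rightarrow> int \<Rightarrow> int" where
  "subst_pos \<sigma> y k =
     (if 0 \<le> k then (\<Sum>i\<in>{0..<k}. int (length (\<sigma> (y i))))
      else - (\<Sum>i\<in>{k..<0}. int (length (\<sigma> (y i)))))"

definition subst_bseq :: "('a \<Rightarrow> 'a list) \<Rightarrow> 'a bseq \<Rightarrow> 'a bseq" where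
  "subst_bseq \<sigma> y = (\<lambda>n.
     let k = (THE k. subst_pos \<sigma> y k \<le> n \<and> n < subst_pos \<sigma> y (k + 1))
     in \<sigma> (y k) ! nat (n - subst_pos \<sigma> y k))"

definition lang :: "('a \<Rightarrow> 'a list) \<Rightarrow> 'a list set" where
  "lang \<sigma> = {u. \<exists>a. \<exists>n\<ge>1. sublist u (subst_power \<sigma> n a)}"

definition window :: "'a bseq \<Rightarrow> int \<Rightarrow> int \<Rightarrow> 'a list" where
  "window x i j = map x [i..j]"

definition subst_space :: "('a \<Rightarrow> 'a list) \<Rightarrow> 'a bseq set" where
  "subst_space \<sigma> = {x. \<forall>n::nat. window x (- int n) (int n) \<in> lang \<sigma>}"

definition shift :: "'a bseq \<Rightarrow> 'a bseq" where
  "shift x = (\<lambda>n. x (n + 1))"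

definition subst_topology :: "('a \<Rightarrow> 'a list) \<Rightarrow> 'a bseq topology" where
  "subst_topology \<sigma> =
     subtopology (product_topology (\<lambda>_. discrete_topology UNIV) UNIV) (subst_space \<sigma>)"

definition space_lang :: "('a \<Rightarrow> 'a list) \<Rightarrow> 'a list set" where
  "space_lang \<sigma> = {u. \<exists>x\<in>subst_space \<sigma>. \<exists>i j. u = window x i j}"

definition aperiodic :: "('a \<Rightarrow> 'a list) \<Rightarrow> bool" where
  "aperiodic \<sigma> \<longleftrightarrow> \<not> (\<exists>x\<in>subst_space \<sigma>. \<exists>p\<ge>1. (shift ^^ p) x = x)"

definition primitive_on :: "('a \<Rightarrow> 'a list) \<Rightarrow> 'a set \<Rightarrow> bool" where
  "primitive_on \<sigma> S \<longleftrightarrow> (\<exists>k\<ge>1. \<forall>a\<in>S. S \<subseteq> set (subst_power \<sigma> k a))"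

text \<open>\<open>P 1, \<dots>, P m, P 0\<close> is the partition of the alphabet (the whole type \<open>'a\<close>) witnessing
  \<open>m\<close>-primitivity; \<open>P 0\<close> may be empty.\<close>

definition m_primitive ::
    "('a::finite \<Rightarrow> 'a list) \<Rightarrow> nat \<Rightarrow> (nat \<Rightarrow> 'a set) \<Rightarrow> bool" where
  "m_primitive \<sigma> m P \<longleftrightarrow>
     substitution \<sigma> \<and> m > 0 \<and>
     (\<Union>i\<in>{0..m}. P i) = UNIV \<and> disjoint_family_on P {0..m} \<and>
     (\<forall>i\<in>{1..m}. card (P i) \<ge> 2) \<and>
     (\<forall>i\<in>{1..m}. (\<forall>a\<in>P i. set (\<sigma> a) \<subseteq> P i) \<and> primitive_on \<sigma> (P i)) \<and>
     (\<forall>a. \<exists>b\<in>(\<Union>i\<in>{1..m}. P i). \<exists>n>0. b \<in> set (subst_power \<sigma> n a)) \<and>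
     (\<forall>k\<ge>1. lang \<sigma> = lang (subst_power \<sigma> k)) \<and>
     (\<forall>a. [a] \<in> space_lang \<sigma>)"

definition min_component :: "('a \<Rightarrow> 'a list) \<Rightarrow> 'a set \<Rightarrow> 'a bseq set" where
  "min_component \<sigma> S =
     {x \<in> subst_space \<sigma>. \<forall>n::nat. \<exists>k. \<exists>a\<in>S.
        sublist (window x (- int n) (int n)) (subst_power \<sigma> k a)}"

definition fixed_points ::
    "('a \<Rightarrow> 'a list) \<Rightarrow> nat \<Rightarrow> (nat \<Rightarrow> 'a set) \<Rightarrow> (nat \<Rightarrow> 'a bseq) \<Rightarrow> bool" where
  "fixed_points \<sigma> m P w \<longleftrightarrow>
     (\<forall>i\<in>{1..m}. w i \<in> min_component \<sigma> (P i) \<and> subst_bseq \<sigma> (w i) = w i)"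


section \<open>Return words and the derivative substitution\<close>

text \<open>With \<open>r\<^sub>i = w i (-1)\<close> and \<open>l\<^sub>i = w i 0\<close>.\<close>

definition return_words ::
    "('a \<Rightarrow> 'a list) \<Rightarrow> nat \<Rightarrow> (nat \<Rightarrow> 'a bseq) \<Rightarrow> 'a list set" where
  "return_words \<sigma> m w =
     {u \<in> space_lang \<sigma>. u \<noteq> [] \<and>
        (\<exists>i\<in>{1..m}. \<exists>j\<in>{1..m}.
           w i (-1) # u @ [w j 0] \<in> space_lang \<sigma> \<and>
           hd u = w i 0 \<and> last u = w j (-1) \<and>
           (\<forall>k\<in>{1..m}. \<not> sublist [w k (-1), w k 0] u))}"

text \<open>\<open>cut_word Q u\<close> cuts \<open>u\<close> between any two consecutive letters \<open>a, b\<close> with \<open>Q a b\<close>,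
  and nowhere else.\<close>

fun cut_word :: "('a \<Rightarrow> 'a \<Rightarrow> bool) \<Rightarrow> 'a list \<Rightarrow> 'a list list" where
  "cut_word Q [] = []"
| "cut_word Q [a] = [[a]]"
| "cut_word Q (a # b # u) =
     (if Q a b then [a] # cut_word Q (b # u)
      else (a # hd (cut_word Q (b # u))) # tl (cut_word Q (b # u)))"

definition derivative_subst ::
    "('a \<Rightarrow> 'a list) \<Rightarrow> nat \<Rightarrow> (nat \<Rightarrow> 'a bseq) \<Rightarrow> 'a list \<Rightarrow> 'a list list" where
  "derivative_subst \<sigma> m w u =
     cut_word (\<lambda>a b. \<exists>k\<in>{1..m}. a = w k (-1) \<and> b = w k 0) (subst_word \<sigma> u)"


section \<open>Ordered Bratteli diagrams\<close>

text \<open>\<open>edges B n\<close> is the set of edges from level \<open>n\<close> to level \<open>n + 1\<close>, usually written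
  \<open>E\<^bsub>n+1\<^esub>\<close>. Accordingly the edge \<open>x n\<close> of an infinite path \<open>x\<close> is usually written
  \<open>x\<^bsub>n+1\<^esub>\<close>.\<close>

record ('v, 'e) bratteli =
  verts :: "nat \<Rightarrow> 'v set"
  edges :: "nat \<Rightarrow> 'e set"
  src :: "'e \<Rightarrow> 'v"
  rng :: "'e \<Rightarrow> 'v"
  edge_le :: "('e \<times> 'e) set"

definition all_edges :: "('v, 'e) bratteli \<Rightarrow> 'e set" where
  "all_edges B = (\<Union>n. edges B n)"

definition bratteli_diagram :: "('v, 'e) bratteli \<Rightarrow> bool" where
  "bratteli_diagram B \<longleftrightarrow>
     (\<forall>n. finite (verts B n)) \<and> (\<forall>n. finite (edges B n)) \<and>
     disjoint_family (verts B) \<and> disjoint_family (edges B) \<and>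
     (\<exists>v0. verts B 0 = {v0}) \<and>
     (\<forall>n. rng B ` edges B n = verts B (Suc n)) \<and>
     (\<forall>n. src B ` edges B n = verts B n) \<and>
     (\<forall>v\<in>(\<Union>n. verts B n). \<exists>e\<in>all_edges B. src B e = v) \<and>
     (\<forall>v\<in>(\<Union>n. verts B n) - verts B 0. \<exists>e\<in>all_edges B. rng B e = v)"

definition ordered_bratteli_diagram :: "('v, 'e) bratteli \<Rightarrow> bool" where
  "ordered_bratteli_diagram B \<longleftrightarrow>
     bratteli_diagram B \<and>
     partial_order_on (all_edges B) (edge_le B) \<and>
     (\<forall>e\<in>all_edges B. \<forall>f\<in>all_edges B.
        (e, f) \<in> edge_le B \<or> (f, e) \<in> edge_le B \<longleftrightarrow> rng B e = rng B f)"

definition paths :: "('v, 'e) bratteli \<Rightarrow> (nat \<Rightarrow> 'e) set" where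
  "paths B = {x. \<forall>n. x n \<in> edges B n \<and> rng B (x n) = src B (x (Suc n))}"

definition cylinder :: "('v, 'e) bratteli \<Rightarrow> nat \<Rightarrow> (nat \<Rightarrow> 'e) \<Rightarrow> (nat \<Rightarrow> 'e) set" where
  "cylinder B n x = {y \<in> paths B. \<forall>i<n. y i = x i}"

definition path_topology :: "('v, 'e) bratteli \<Rightarrow> (nat \<Rightarrow> 'e) topology" where
  "path_topology B = topology_generated_by {cylinder B n x | n x. x \<in> paths B}"

definition max_edge :: "('v, 'e) bratteli \<Rightarrow> 'e \<Rightarrow> bool" where
  "max_edge B e \<longleftrightarrow>
     (\<forall>f\<in>all_edges B. rng B f = rng B e \<and> (e, f) \<in> edge_le B \<longrightarrow> f = e)"

definition min_edge :: "('v, 'e) bratteli \<Rightarrow> 'e \<Rightarrow> bool" where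
  "min_edge B e \<longleftrightarrow>
     (\<forall>f\<in>all_edges B. rng B f = rng B e \<and> (f, e) \<in> edge_le B \<longrightarrow> f = e)"

definition max_paths :: "('v, 'e) bratteli \<Rightarrow> (nat \<Rightarrow> 'e) set" where
  "max_paths B = {x \<in> paths B. \<forall>n. max_edge B (x n)}"

definition min_paths :: "('v, 'e) bratteli \<Rightarrow> (nat \<Rightarrow> 'e) set" where
  "min_paths B = {x \<in> paths B. \<forall>n. min_edge B (x n)}"

definition successor_edge :: "('v, 'e) bratteli \<Rightarrow> 'e \<Rightarrow> 'e \<Rightarrow> bool" where
  "successor_edge B e f \<longleftrightarrow>
     f \<in> all_edges B \<and> rng B f = rng B e \<and> f \<noteq> e \<and> (e, f) \<in> edge_le B \<and>
     (\<forall>g\<in>all_edges B. rng B g = rng B e \<and> (e, g) \<in> edge_le B \<and> (g, f) \<in> edge_le B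
        \<longrightarrow> g = e \<or> g = f)"

definition vershik_homeomorphism ::
    "('v, 'e) bratteli \<Rightarrow> ((nat \<Rightarrow> 'e) \<Rightarrow> (nat \<Rightarrow> 'e)) \<Rightarrow> bool" where
  "vershik_homeomorphism B \<phi> \<longleftrightarrow>
     homeomorphic_map (path_topology B) (path_topology B) \<phi> \<and>
     \<phi> ` max_paths B = min_paths B \<and>
     (\<forall>x\<in>paths B - max_paths B.
        let k = (LEAST n. \<not> max_edge B (x n)) in
          (\<forall>i<k. min_edge B (\<phi> x i)) \<and>
          successor_edge B (x k) (\<phi> x k) \<and>
          (\<forall>i>k. \<phi> x i = x i))"

text \<open>In a stationary diagram \<open>L n c\<close>, for \<open>n \<ge> 1\<close>, is the vertex of level \<open>n\<close> labeled by the
  letter \<open>c \<in> C\<close>. \<open>source_word B C L n c\<close> lists the labels (at level \<open>n\<close>) of the sources of the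
  edges with range \<open>L (n + 1) c\<close>, in increasing order of the edges.\<close>

definition in_edges :: "('v, 'e) bratteli \<Rightarrow> 'v \<Rightarrow> 'e list" where
  "in_edges B v =
     (THE es. distinct es \<and> set es = {e \<in> all_edges B. rng B e = v} \<and>
        sorted_wrt (\<lambda>e f. (e, f) \<in> edge_le B) es)"

definition source_word ::
    "('v, 'e) bratteli \<Rightarrow> 'c set \<Rightarrow> (nat \<Rightarrow> 'c \<Rightarrow> 'v) \<Rightarrow> nat \<Rightarrow> 'c \<Rightarrow> 'c list" where
  "source_word B C L n c =
     map (\<lambda>e. inv_into C (L n) (src B e)) (in_edges B (L (Suc n) c))"

definition num_edges :: "('v, 'e) bratteli \<Rightarrow> 'v \<Rightarrow> 'v \<Rightarrow> nat" where
  "num_edges B u v = card {e \<in> all_edges B. src B e = u \<and> rng B e = v}"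

definition stationary_ordered ::
    "('v, 'e) bratteli \<Rightarrow> 'c set \<Rightarrow> (nat \<Rightarrow> 'c \<Rightarrow> 'v) \<Rightarrow> bool" where
  "stationary_ordered B C L \<longleftrightarrow>
     (\<forall>n\<ge>1. bij_betw (L n) C (verts B n)) \<and>
     (\<forall>n\<ge>1. \<forall>c\<in>C. \<forall>d\<in>C.
        num_edges B (L n d) (L (Suc n) c) = num_edges B (L 1 d) (L 2 c)) \<and>
     (\<forall>n\<ge>1. \<forall>c\<in>C. source_word B C L n c = source_word B C L 1 c)"

text \<open>Only meaningful for stationary diagrams, where every level \<open>n \<ge> 1\<close> in place of \<open>1\<close>
  gives the same word.\<close>

definition substitution_read ::
    "('v, 'e) bratteli \<Rightarrow> 'c set \<Rightarrow> (nat \<Rightarrow> 'c \<Rightarrow> 'v) \<Rightarrow> 'c \<Rightarrow> 'c list" where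
  "substitution_read B C L c = source_word B C L 1 c"

definition homeomorphic_systems ::
    "'x topology \<Rightarrow> ('x \<Rightarrow> 'x) \<Rightarrow> 'y topology \<Rightarrow> ('y \<Rightarrow> 'y) \<Rightarrow> bool" where
  "homeomorphic_systems X S Y T \<longleftrightarrow>
     (\<exists>h. homeomorphic_map X Y h \<and> (\<forall>x\<in>topspace X. h (S x) = T (h x)))"

end

theory Submission
  imports Defs
begin

text \<open>
  The conjugacy reads off, from a point \<open>x\<close> of the subshift, its addresses at all levels. For every
  \<open>n\<close> the point is a bi-infinite concatenation of words \<open>\<sigma>\<^sup>n(u)\<close> with \<open>u\<close> a return word. Let \<open>u\<^sub>n\<close> be
  the return word whose block covers coordinate \<open>0\<close>, and \<open>j\<^sub>n\<close> the position of coordinate \<open>0\<close> in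
  this block. As \<open>\<sigma>(u)\<close> is the concatenation of the entries of \<open>\<tau>(u)\<close>, the pair at level \<open>n + 1\<close>
  says which entry of \<open>\<tau>(u\<^bsub>n+1\<^esub>)\<close> the word \<open>u\<^sub>n\<close> is, and this entry is an edge of the diagram; the
  number \<open>j\<^sub>0 < |u\<^sub>0|\<close> selects an edge from the top vertex. The point thus becomes an infinite path.
  The shift adds one to \<open>j\<^sub>n\<close> as long as the block is not left, which is the successor rule of
  Vershik. A path is maximal iff \<open>j\<^sub>n\<close> is the last position at every level, and then the shifted
  point starts a new block at every level, so that its path is minimal (\<open>shift_not_max\<close>,
  \<open>J_shift_max\<close>, \<open>J_unshift_min\<close>).

  The path determines the point, because a return word determines the letters \<open>r\<^sub>i\<close> before it and
  \<open>l\<^sub>j\<close> after it, so that an address at level \<open>n\<close> fixes the point on \<open>\<sigma>\<^sup>n(r\<^sub>i) \<sigma>\<^sup>n(u) \<sigma>\<^sup>n(l\<^sub>j)\<close>, and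
  the outer words grow without bound by primitivity (\<open>in_tower_agree\<close>). Every path occurs by
  compactness (\<open>path_surj\<close>). The path depends continuously on the point, because the finitely many
  addresses of level \<open>n\<close> partition the subshift into closed sets (\<open>openin_address\<close>). A continuous
  bijection from a compact space to a Hausdorff space is a homeomorphism.

  The deep point is that the address is well defined: a point of the subshift can be cut into
  blocks \<open>\<sigma>\<^sup>n(a)\<close> in one way only (\<open>recognizable_power\<close>). This rests on a defect theorem for
  bi-infinite sequences (\<open>two_parsings_fewer_letters\<close>): if a nonperiodic sequence is a concatenation
  of words \<open>\<phi>(a)\<close>, \<open>a \<in> A\<close>, in two ways, then \<open>\<phi> = \<beta> \<circ> \<alpha>\<close> through an alphabet with fewer letters
  than \<open>A\<close>. A substitution \<open>\<sigma>\<close> that is not recognizable therefore has the form \<open>\<beta> \<circ> \<alpha>\<close>, the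
  substitution \<open>\<alpha> \<circ> \<beta>\<close> on the smaller alphabet is recognizable by induction, and this carries over
  to \<open>\<sigma>\<close> (\<open>recognizable_on\<close>). For the defect theorem, the overlap of the two concatenations is
  added to \<open>A\<close> as a new letter. Eliminating common prefixes turns the resulting relation into a
  factorization in which the images of the letters of \<open>A\<close> start with different letters
  (\<open>left_marked_factorization\<close>). For such a morphism, two concatenations without a common cut are
  generated by a deterministic finite automaton that runs over all of the integers, so that the
  sequence is periodic (\<open>left_marked_periodic\<close>).
\<close>


section \<open>Morphisms that factor through fewer letters\<close>

abbreviation ext :: "('a \<Rightarrow> 'b list) \<Rightarrow> 'a list \<Rightarrow> 'b list" where
  "ext \<phi> u \<equiv> concat (map \<phi> u)"

text \<open>The smaller alphabet \<open>C\<close> lives in the same type as \<open>A\<close>; it could be renamed into any type with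
  enough elements, and this choice keeps an induction on \<open>card A\<close> within one type.\<close>

definition fewer_letters :: "('a \<Rightarrow> 'b list) \<Rightarrow> 'a set \<Rightarrow> bool" where
  "fewer_letters \<phi> A \<longleftrightarrow>
     (\<exists>(C::'a set) \<alpha> \<beta>. finite C \<and> card C < card A \<and>
        (\<forall>a\<in>A. \<alpha> a \<noteq> [] \<and> set (\<alpha> a) \<subseteq> C \<and> \<phi> a = ext \<beta> (\<alpha> a)) \<and>
        (\<forall>c\<in>C. \<beta> c \<noteq> []))"

lemma ext_ext: "ext \<beta> (ext \<alpha> u) = ext (\<lambda>a. ext \<beta> (\<alpha> a)) u"
  by (induction u) auto

lemma ext_cong: "(\<And>a. a \<in> set u \<Longrightarrow> \<phi> a = \<psi> a) \<Longrightarrow> ext \<phi> u = ext \<psi> u"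
  by (induction u) auto

lemma ext_rev: "ext (\<lambda>a. rev (\<phi> a)) (rev u) = rev (ext \<phi> u)"
  by (induction u) auto

lemma length_ext_ge: "(\<And>a. a \<in> set u \<Longrightarrow> \<phi> a \<noteq> []) \<Longrightarrow> length u \<le> length (ext \<phi> u)"
proof (induction u)
  case (Cons a u)
  then have "length u \<le> length (ext \<phi> u)" "length (\<phi> a) \<ge> 1"
    by (auto simp: Suc_le_eq)
  then show ?case by simp
qed simp

lemma fewer_letters_comp:
  fixes A A' :: "'a set" and \<phi> :: "'a \<Rightarrow> 'b list"
  assumes "fewer_letters \<beta> A'" "card A' \<le> card A"
    and "\<And>a. a \<in> A \<Longrightarrow> \<gamma> a \<noteq> [] \<and> set (\<gamma> a) \<subseteq> A' \<and> \<phi> a = ext \<beta> (\<gamma> a)"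
  shows "fewer_letters \<phi> A"
proof -
  obtain C \<alpha> \<delta> where C: "finite (C::'a set)" "card C < card A'"
      "\<forall>a\<in>A'. \<alpha> a \<noteq> [] \<and> set (\<alpha> a) \<subseteq> C \<and> \<beta> a = ext \<delta> (\<alpha> a)" "\<forall>c\<in>C. \<delta> c \<noteq> []"
    using assms(1) unfolding fewer_letters_def by blast
  have "ext \<alpha> (\<gamma> a) \<noteq> [] \<and> set (ext \<alpha> (\<gamma> a)) \<subseteq> C \<and> \<phi> a = ext \<delta> (ext \<alpha> (\<gamma> a))" if "a \<in> A" for a
  proof -
    note g = assms(3)[OF that]
    have "ext \<beta> (\<gamma> a) = ext (\<lambda>a. ext \<delta> (\<alpha> a)) (\<gamma> a)"
      by (rule ext_cong) (use g C in blast)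
    moreover have "ext \<alpha> (\<gamma> a) \<noteq> []"
      using g C(3) by (cases "\<gamma> a") auto
    ultimately show ?thesis using g C(3) by (force simp: ext_ext)
  qed
  with C assms(2) show ?thesis
    unfolding fewer_letters_def
    by (intro exI[of _ C] exI[of _ "\<lambda>a. ext \<alpha> (\<gamma> a)"] exI[of _ \<delta>]) auto
qed

lemma fewer_letters_rev:
  assumes "fewer_letters (\<lambda>a. rev (\<phi> a)) A"
  shows "fewer_letters \<phi> A"
proof -
  obtain C \<alpha> \<delta> where C: "finite (C::'a set)" "card C < card A"
      "\<forall>a\<in>A. \<alpha> a \<noteq> [] \<and> set (\<alpha> a) \<subseteq> C \<and> rev (\<phi> a) = ext \<delta> (\<alpha> a)" "\<forall>c\<in>C. \<delta> c \<noteq> []"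
    using assms(1) unfolding fewer_letters_def by blast
  have "\<phi> a = ext (\<lambda>c. rev (\<delta> c)) (rev (\<alpha> a))" if "a \<in> A" for a
    using C(3) that by (metis ext_rev rev_rev_ident)
  with C show ?thesis
    unfolding fewer_letters_def
    by (intro exI[of _ C] exI[of _ "\<lambda>a. rev (\<alpha> a)"] exI[of _ "\<lambda>c. rev (\<delta> c)"]) auto
qed

lemma fewer_letters_eq_images:
  assumes "finite A" "c \<in> A" "d \<in> A" "c \<noteq> d" "\<phi> c = \<phi> d" "\<forall>a\<in>A. \<phi> a \<noteq> []"
  shows "fewer_letters \<phi> A"
  unfolding fewer_letters_def
  using assms card_Diff1_less[of A d]
  by (intro exI[of _ "A - {d}"] exI[of _ "\<lambda>a. if a = d then [c] else [a]"] exI[of _ \<phi>]) auto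

abbreviation comparable :: "'a list \<Rightarrow> 'a list \<Rightarrow> bool" where
  "comparable u v \<equiv> prefix u v \<or> prefix v u"

lemma comparable_appendD: "comparable (a @ s) (b @ t) \<Longrightarrow> comparable a b"
  by (meson append_prefixD prefix_append prefix_same_cases prefixI)

lemma sum_update_less:
  fixes f g :: "'a \<Rightarrow> nat"
  assumes "finite A" "d \<in> A" "\<And>a. a \<in> A - {d} \<Longrightarrow> g a = f a" "g d + k = f d"
  shows "sum g A + k = sum f A"
proof -
  have "sum g (A - {d}) = sum f (A - {d})" using assms(3) by (rule sum.cong[OF refl])
  then show ?thesis using assms by (simp add: sum.remove[of A d])
qed

text \<open>The quadratic length bound of the two elimination lemmas below survives one elimination step:
  \<open>k\<close> letters are removed from the words, and the total length \<open>L\<close> of the images drops by \<open>k\<close>.\<close>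

lemma square_drop: "(L::nat) * L \<le> k + n \<Longrightarrow> L' + k \<le> L \<Longrightarrow> k \<ge> 1 \<Longrightarrow> L' * L' \<le> n"
proof -
  assume a: "L * L \<le> k + n" "L' + k \<le> L" "k \<ge> 1"
  have "(L' + k) * (L' + k) \<le> L * L" using a(2) by (intro mult_mono) auto
  moreover have "k * k \<ge> k" using a by simp
  moreover have "(L' + k) * (L' + k) = L' * L' + (2 * L' * k + k * k)" by (simp add: algebra_simps)
  ultimately have "L' * L' + k \<le> k + n" using a(1) by linarith
  then show ?thesis by simp
qed

text \<open>Let \<open>c\<close> and \<open>d\<close> be the first letters. Of their images one is a prefix of the other. If they are
  equal, one of the letters is superfluous. If \<open>\<beta> d = \<beta> c @ v\<close>, then \<open>\<beta>\<close> factors through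
  \<open>d \<mapsto> cd\<close> with \<open>v\<close> as the new image of \<open>d\<close>. After this rewriting and removal of the leading \<open>c\<close>,
  the two words again have different first letters, because no rewritten word starts with \<open>d\<close>, and
  the total length of the images is smaller. The length assumption guarantees that the words are
  not used up before the induction ends.\<close>

lemma distinct_decodings_fewer_letters:
  fixes \<beta> :: "'a \<Rightarrow> 'b list"
  assumes "finite A" "\<forall>a\<in>A. \<beta> a \<noteq> []"
    and "set s \<subseteq> A" "set t \<subseteq> A" "s \<noteq> []" "t \<noteq> []" "hd s \<noteq> hd t"
    and "L = (\<Sum>a\<in>A. length (\<beta> a))"
    and "L * L \<le> length (ext \<beta> s)" "L * L \<le> length (ext \<beta> t)"
    and "comparable (ext \<beta> s) (ext \<beta> t)"
  shows "fewer_letters \<beta> A"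
  using assms(2-)
proof (induction L arbitrary: \<beta> s t rule: less_induct)
  case (less L)
  have wlog: "fewer_letters \<beta> A"
    if st: "set s \<subseteq> A" "set t \<subseteq> A" "s = c # s1" "t = d # t1" "c \<noteq> d"
      and len: "L * L \<le> length (ext \<beta> s)" "L * L \<le> length (ext \<beta> t)"
      and cmp: "comparable (ext \<beta> s) (ext \<beta> t)"
      and pre: "prefix (\<beta> c) (\<beta> d)"
    for s t c d s1 t1
  proof (cases "\<beta> c = \<beta> d")
    case True
    then show ?thesis
      using fewer_letters_eq_images[OF assms(1), of c d \<beta>] st less.prems(1) by auto
  next
    case False
    then obtain v where v: "\<beta> d = \<beta> c @ v" "v \<noteq> []"
      using pre by (auto simp: prefix_def)
    have cd: "c \<in> A" "d \<in> A" using st by auto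
    define \<beta>' where "\<beta>' = \<beta>(d := v)"
    define \<gamma> where "\<gamma> = (\<lambda>a. if a = d then [c, d] else [a])"
    define L' where "L' = (\<Sum>a\<in>A. length (\<beta>' a))"
    have g: "ext \<beta>' (\<gamma> a) = \<beta> a" for a
      using v st by (auto simp: \<beta>'_def \<gamma>_def)
    have ge: "ext \<beta>' (ext \<gamma> u) = ext \<beta> u" for u
      by (simp only: ext_ext g)
    have ne: "\<forall>a\<in>A. \<beta>' a \<noteq> []" using less.prems(1) v by (auto simp: \<beta>'_def)
    have kc: "length (\<beta> c) \<ge> 1" using less.prems(1) cd by (auto simp: Suc_le_eq)
    have L': "L' + length (\<beta> c) = L"
      unfolding L'_def less.prems(7)
      by (rule sum_update_less[OF assms(1) cd(2)]) (auto simp: \<beta>'_def v)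
    have "length (\<beta> c) + length (\<beta> d) \<le> L"
    proof -
      have "(\<Sum>a\<in>{c,d}. length (\<beta> a)) \<le> L"
        unfolding less.prems(7) by (rule sum_mono2) (use assms(1) cd in auto)
      then show ?thesis using st by simp
    qed
    then have big: "length (\<beta> c) < L * L" using v kc
      by (smt (verit) add_is_0 add_le_cancel_right le_neq_implies_less le_square le_trans length_greater_0_conv
          less_add_same_cancel1 less_eq_nat.simps(1) linorder_not_less list.size(3) length_append)
    have s1: "s1 \<noteq> []"
      using big len(1) st(3) by auto
    have rem: "comparable (ext \<beta>' (ext \<gamma> s1)) (ext \<beta>' (d # ext \<gamma> t1))"
    proof -
      have "ext \<beta> s = \<beta> c @ ext \<beta>' (ext \<gamma> s1)" using st by (simp add: ge)
      moreover have "ext \<beta> t = \<beta> c @ ext \<beta>' (d # ext \<gamma> t1)" using st v by (simp add: ge) (simp add: \<beta>'_def)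
      ultimately show ?thesis using cmp by simp
    qed
    have "fewer_letters \<beta>' A"
    proof (rule less.IH[of L' \<beta>' "ext \<gamma> s1" "d # ext \<gamma> t1"])
      show "L' < L" using L' kc by simp
      show "set (ext \<gamma> s1) \<subseteq> A" "set (d # ext \<gamma> t1) \<subseteq> A"
        using st cd by (auto simp: \<gamma>_def)
      show "ext \<gamma> s1 \<noteq> []" "hd (ext \<gamma> s1) \<noteq> hd (d # ext \<gamma> t1)"
        using s1 st(5) by (cases s1; simp add: \<gamma>_def)+
      show "L' * L' \<le> length (ext \<beta>' (ext \<gamma> s1))"
        using square_drop[of L "length (\<beta> c)" _ L'] len(1) L' kc st by (simp add: ge)
      show "L' * L' \<le> length (ext \<beta>' (d # ext \<gamma> t1))"
        using square_drop[of L "length (\<beta> c)" _ L'] len(2) L' kc st v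
        by (simp add: ge) (simp add: \<beta>'_def)
    qed (use ne rem L'_def in auto)
    then show ?thesis
      by (rule fewer_letters_comp[where \<gamma> = \<gamma>]) (use g cd in \<open>auto simp: \<gamma>_def\<close>)
  qed
  obtain c s1 d t1 where st: "s = c # s1" "t = d # t1" "c \<noteq> d"
    using less.prems by (metis list.collapse)
  have "comparable (\<beta> c) (\<beta> d)"
    using less.prems(10) st comparable_appendD[of "\<beta> c" "ext \<beta> s1" "\<beta> d" "ext \<beta> t1"] by simp
  then show ?case
    using wlog[of s t c s1 d t1] wlog[of t s d t1 c s1] less.prems st by metis
qed

text \<open>The morphism \<open>\<beta>\<close> on \<open>A\<close> and one more letter \<open>None\<close> factors through \<open>A\<close> alone, and distinct letters of \<open>A\<close>
  have intermediate words with distinct first letters. Up to renaming the intermediate alphabet, the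
  first letter is the letter itself.\<close>

definition left_marked :: "'a set \<Rightarrow> ('a option \<Rightarrow> 'b list) \<Rightarrow> bool" where
  "left_marked A \<beta> \<longleftrightarrow>
     (\<exists>\<alpha> \<omega> \<beta>'. (\<forall>a\<in>A. \<beta>' a \<noteq> []) \<and>
           (\<forall>a\<in>A. \<alpha> a \<noteq> [] \<and> hd (\<alpha> a) = a \<and> set (\<alpha> a) \<subseteq> A \<and> \<beta> (Some a) = ext \<beta>' (\<alpha> a)) \<and>
           \<omega> \<noteq> [] \<and> set \<omega> \<subseteq> A \<and> \<beta> None = ext \<beta>' \<omega>)"

text \<open>The letter \<open>None\<close> stands for the overlap of two concatenations, and its image starts like that of
  another letter. Common prefixes are eliminated as in the preceding lemma, but the letters are
  named in each step so that the word for \<open>a \<in> A\<close> keeps \<open>a\<close> as its first letter. As \<open>None\<close> never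
  becomes a first letter, the elimination continues until the image of \<open>None\<close> coincides with the
  image of a letter of \<open>A\<close>. In the end no letter besides those of \<open>A\<close> is left.\<close>

lemma left_marked_factorization:
  fixes \<beta> :: "'a option \<Rightarrow> 'b list"
  assumes "finite A" "\<forall>a\<in>A. \<beta> (Some a) \<noteq> []" "\<beta> None \<noteq> []"
    and "set s \<subseteq> insert None (Some ` A)" "set t \<subseteq> insert None (Some ` A)"
    and "t \<noteq> []" "hd t \<noteq> None"
    and "L = (\<Sum>a\<in>A. length (\<beta> (Some a))) + length (\<beta> None)"
    and "L * L \<le> length (ext \<beta> (None # s))" "L * L \<le> length (ext \<beta> t)"
    and "comparable (ext \<beta> (None # s)) (ext \<beta> t)"
  shows "left_marked A \<beta>"
  using assms(2-)
proof (induction L arbitrary: \<beta> s t rule: less_induct)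
  case (less L)
  obtain e t1 where t: "t = Some e # t1"
    using less.prems(5,6) by (cases t) auto
  have e: "e \<in> A" using less.prems(4) t by auto
  have eL: "length (\<beta> (Some e)) \<le> (\<Sum>a\<in>A. length (\<beta> (Some a)))"
    by (rule member_le_sum[OF e]) (use assms(1) in auto)
  have k1: "length (\<beta> (Some e)) \<ge> 1" "length (\<beta> None) \<ge> 1"
    using less.prems(1,2) e by (auto simp: Suc_le_eq)
  have big: "length (\<beta> (Some e)) < L * L" "length (\<beta> None) < L * L"
  proof -
    have "length (\<beta> (Some e)) < L" "length (\<beta> None) < L" using eL k1 less.prems(7) by auto
    then show "length (\<beta> (Some e)) < L * L" "length (\<beta> None) < L * L"
      by (meson le_square less_le_trans)+
  qed
  have ne: "s \<noteq> []" "t1 \<noteq> []"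
    using big less.prems(8,9) t by auto
  have "comparable (\<beta> None) (\<beta> (Some e))"
    using less.prems(10) t comparable_appendD[of "\<beta> None" "ext \<beta> s" "\<beta> (Some e)" "ext \<beta> t1"]
    by simp
  then consider "\<beta> None = \<beta> (Some e)" | u where "\<beta> None = \<beta> (Some e) @ u" "u \<noteq> []"
    | u where "\<beta> (Some e) = \<beta> None @ u" "u \<noteq> []"
    unfolding prefix_def by (metis append_Nil2)
  then show ?case
  proof cases
    case 1
    then show ?thesis
      unfolding left_marked_def using less.prems e
      by (intro exI[of _ "\<lambda>a. [a]"] exI[of _ "[e]"] exI[of _ "\<lambda>a. \<beta> (Some a)"]) auto
  next
    case 2
    define \<delta> where "\<delta> = \<beta>(None := u)"
    define \<gamma> where "\<gamma> = (\<lambda>a. if a = None then [Some e, None] else [a])"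
    define L' where "L' = (\<Sum>a\<in>A. length (\<delta> (Some a))) + length (\<delta> None)"
    have g: "ext \<delta> (\<gamma> a) = \<beta> a" for a
      using 2 by (auto simp: \<delta>_def \<gamma>_def)
    have ge: "ext \<delta> (ext \<gamma> v) = ext \<beta> v" for v
      by (simp only: ext_ext g)
    have L': "L' + length (\<beta> (Some e)) = L"
      using 2 by (simp add: L'_def less.prems(7) \<delta>_def)
    have ext1: "ext \<beta> (None # s) = \<beta> (Some e) @ ext \<delta> (None # ext \<gamma> s)"
      using 2 by (simp add: ge) (simp add: \<delta>_def)
    have ext2: "ext \<beta> t = \<beta> (Some e) @ ext \<delta> (ext \<gamma> t1)"
      using t by (simp add: ge)
    have "left_marked A \<delta>"
    proof (rule less.IH[of L' \<delta> "ext \<gamma> s" "ext \<gamma> t1"])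
      show "L' < L" using L' k1 by simp
      show "set (ext \<gamma> s) \<subseteq> insert None (Some ` A)" "set (ext \<gamma> t1) \<subseteq> insert None (Some ` A)"
        using less.prems(3,4) t e by (auto simp: \<gamma>_def)
      show "ext \<gamma> t1 \<noteq> []" "hd (ext \<gamma> t1) \<noteq> None"
        using ne by (cases t1; simp add: \<gamma>_def)+
      show "L' * L' \<le> length (ext \<delta> (None # ext \<gamma> s))" "L' * L' \<le> length (ext \<delta> (ext \<gamma> t1))"
        using square_drop[of L "length (\<beta> (Some e))" _ L'] less.prems(8,9) L' k1
        unfolding ext1 ext2 by simp_all
      show "comparable (ext \<delta> (None # ext \<gamma> s)) (ext \<delta> (ext \<gamma> t1))"
        using less.prems(10) unfolding ext1 ext2 by simp
    qed (use less.prems(1) 2 L'_def in \<open>auto simp: \<delta>_def\<close>)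
    then obtain \<alpha> \<omega> \<beta>' where *: "\<forall>a\<in>A. \<beta>' a \<noteq> []"
        "\<forall>a\<in>A. \<alpha> a \<noteq> [] \<and> hd (\<alpha> a) = a \<and> set (\<alpha> a) \<subseteq> A \<and> \<delta> (Some a) = ext \<beta>' (\<alpha> a)"
        "\<omega> \<noteq> []" "set \<omega> \<subseteq> A" "\<delta> None = ext \<beta>' \<omega>"
      unfolding left_marked_def by blast
    then show ?thesis
      unfolding left_marked_def using 2 e by (intro exI[of _ \<alpha>] exI[of _ "\<alpha> e @ \<omega>"] exI[of _ \<beta>']) (auto simp: \<delta>_def)
  next
    case 3
    define \<delta> where "\<delta> = \<beta>(None := u, Some e := \<beta> None)"
    define \<gamma> where "\<gamma> = (\<lambda>a. if a = None then [Some e] else if a = Some e then [Some e, None] else [a])"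
    define L' where "L' = (\<Sum>a\<in>A. length (\<delta> (Some a))) + length (\<delta> None)"
    have g: "ext \<delta> (\<gamma> a) = \<beta> a" for a
      using 3 by (auto simp: \<delta>_def \<gamma>_def)
    have ge: "ext \<delta> (ext \<gamma> v) = ext \<beta> v" for v
      by (simp only: ext_ext g)
    have "(\<Sum>a\<in>A. length (\<delta> (Some a))) + length u = (\<Sum>a\<in>A. length (\<beta> (Some a)))"
      by (rule sum_update_less[OF assms(1) e]) (auto simp: \<delta>_def 3)
    then have L': "L' + length (\<beta> None) = L"
      by (simp add: L'_def less.prems(7) \<delta>_def)
    have ext1: "ext \<beta> (None # s) = \<beta> None @ ext \<delta> (ext \<gamma> s)"
      by (simp add: ge)
    have ext2: "ext \<beta> t = \<beta> None @ ext \<delta> (None # ext \<gamma> t1)"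
      using t 3 by (simp add: ge) (simp add: \<delta>_def)
    have "left_marked A \<delta>"
    proof (rule less.IH[of L' \<delta> "ext \<gamma> t1" "ext \<gamma> s"])
      show "L' < L" using L' k1 by simp
      show "set (ext \<gamma> s) \<subseteq> insert None (Some ` A)" "set (ext \<gamma> t1) \<subseteq> insert None (Some ` A)"
        using less.prems(3,4) t e by (auto simp: \<gamma>_def split: if_splits)
      show "ext \<gamma> s \<noteq> []" "hd (ext \<gamma> s) \<noteq> None"
        using ne by (cases s; simp add: \<gamma>_def)+
      show "L' * L' \<le> length (ext \<delta> (None # ext \<gamma> t1))" "L' * L' \<le> length (ext \<delta> (ext \<gamma> s))"
        using square_drop[of L "length (\<beta> None)" _ L'] less.prems(8,9) L' k1
        unfolding ext1 ext2 by simp_all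
      show "comparable (ext \<delta> (None # ext \<gamma> t1)) (ext \<delta> (ext \<gamma> s))"
        using less.prems(10) unfolding ext1 ext2 by auto
    qed (use less.prems(1,2) 3 L'_def in \<open>auto simp: \<delta>_def\<close>)
    then obtain \<alpha> \<omega> \<beta>' where *: "\<forall>a\<in>A. \<beta>' a \<noteq> []"
        "\<forall>a\<in>A. \<alpha> a \<noteq> [] \<and> hd (\<alpha> a) = a \<and> set (\<alpha> a) \<subseteq> A \<and> \<delta> (Some a) = ext \<beta>' (\<alpha> a)"
        "\<omega> \<noteq> []" "set \<omega> \<subseteq> A" "\<delta> None = ext \<beta>' \<omega>"
      unfolding left_marked_def by blast
    then show ?thesis
      unfolding left_marked_def using 3 e by (intro exI[of _ "\<alpha>(e := \<alpha> e @ \<omega>)"] exI[of _ "\<alpha> e"] exI[of _ \<beta>']) (auto simp: \<delta>_def)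
  qed
qed

section \<open>Parsings of bi-infinite sequences\<close>

definition seg :: "(int \<Rightarrow> 'a) \<Rightarrow> int \<Rightarrow> nat \<Rightarrow> 'a list" where
  "seg y p n = map (\<lambda>i. y (p + int i)) [0..<n]"

lemma length_seg [simp]: "length (seg y p n) = n"
  by (simp add: seg_def)

lemma nth_seg [simp]: "i < n \<Longrightarrow> seg y p n ! i = y (p + int i)"
  by (simp add: seg_def)

lemma seg_0 [simp]: "seg y p 0 = []"
  by (simp add: seg_def)

lemma seg_add: "seg y p (m + n) = seg y p m @ seg y (p + int m) n"
  by (rule nth_equalityI) (auto simp: nth_append add.assoc[symmetric] of_nat_diff)

lemma set_seg_subset: "range y \<subseteq> A \<Longrightarrow> set (seg y p n) \<subseteq> A"
  by (auto simp: seg_def)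

lemma seg_comparable: "comparable (seg y p m) (seg y p n)"
proof -
  have "prefix (seg y p m) (seg y p n)" if "m \<le> n" for m n
    using seg_add[of y p m "n - m"] that by auto
  then show ?thesis by (meson linear)
qed

lemma seg_middle:
  assumes "seg y p (length (u @ v @ t)) = u @ v @ t"
  shows "seg y (p + int (length u)) (length v) = v"
proof -
  have "seg y p (length (u @ v @ t)) =
      seg y p (length u) @ seg y (p + int (length u)) (length v) @
      seg y (p + int (length u) + int (length v)) (length t)"
    using seg_add[of y p "length u"] seg_add[of y "p + int (length u)" "length v"] by simp
  with assms show ?thesis by simp
qed

text \<open>The sequence \<open>y\<close> is the concatenation of the words \<open>\<phi> (x k)\<close>, and \<open>c k\<close> is the coordinate at which
  the word with index \<open>k\<close> starts. With the cut positions as part of the data, composing morphisms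
  amounts to composing the functions \<open>c\<close>, and no position has to be normalized.\<close>

definition parse :: "('a \<Rightarrow> 'b list) \<Rightarrow> (int \<Rightarrow> 'a) \<Rightarrow> (int \<Rightarrow> int) \<Rightarrow> (int \<Rightarrow> 'b) \<Rightarrow> bool" where
  "parse \<phi> x c y \<longleftrightarrow>
     (\<forall>k. \<phi> (x k) \<noteq> [] \<and> c (k + 1) = c k + int (length (\<phi> (x k))) \<and>
          seg y (c k) (length (\<phi> (x k))) = \<phi> (x k))"

lemma parseD:
  assumes "parse \<phi> x c y"
  shows "\<phi> (x k) \<noteq> []" "c (k + 1) = c k + int (length (\<phi> (x k)))"
    "seg y (c k) (length (\<phi> (x k))) = \<phi> (x k)"
  using assms by (auto simp: parse_def)

lemma parse_nth:
  assumes "parse \<phi> x c y" "j < length (\<phi> (x k))"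
  shows "y (c k + int j) = \<phi> (x k) ! j"
  using parseD(3)[OF assms(1), of k] assms(2) nth_seg by metis

lemma parse_seg:
  assumes "parse \<phi> x c y"
  shows "c (k + int n) = c k + int (length (ext \<phi> (seg x k n)))"
    and "seg y (c k) (length (ext \<phi> (seg x k n))) = ext \<phi> (seg x k n)"
proof (induction n)
  case (Suc n)
  have s: "seg x k (Suc n) = seg x k n @ [x (k + int n)]"
    using seg_add[of x k n 1] by (simp add: seg_def)
  { case 1
    show ?case using Suc(1) parseD(2)[OF assms, of "k + int n"] by (simp add: s algebra_simps) }
  { case 2
    show ?case
      using Suc parseD(3)[OF assms, of "k + int n"] by (simp add: s seg_add) }
qed simp_all

lemma parse_growth:
  assumes "parse \<phi> x c y" "k \<le> l"
  shows "c k + (l - k) \<le> c l"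
proof -
  have "c k + int n \<le> c (k + int n)" for n
  proof (induction n)
    case (Suc n)
    have "length (\<phi> (x (k + int n))) \<ge> 1" using parseD(1)[OF assms(1)] by (simp add: Suc_le_eq)
    then show ?case using Suc parseD(2)[OF assms(1), of "k + int n"] by (simp add: algebra_simps)
  qed simp
  from this[of "nat (l - k)"] show ?thesis using assms(2) by simp
qed

lemma parse_less_iff:
  assumes "parse \<phi> x c y"
  shows "c k < c l \<longleftrightarrow> k < l" "c k \<le> c l \<longleftrightarrow> k \<le> l" "c k = c l \<longleftrightarrow> k = l"
  using parse_growth[OF assms, of k l] parse_growth[OF assms, of l k]
  by (smt (verit))+

lemma increasing_locate:
  fixes c :: "int \<Rightarrow> int"
  assumes "\<And>k. c k < c (k + 1)"
  shows "\<exists>k. c k \<le> p \<and> p < c (k + 1)"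
proof -
  have g: "c k + int n \<le> c (k + int n)" for k n
  proof (induction n)
    case (Suc n) then show ?case using assms[of "k + int n"] by (simp add: algebra_simps)
  qed simp
  define k0 where "k0 = - int (nat \<bar>c 0 - p\<bar>)"
  have k0: "c k0 \<le> p" using g[of k0 "nat \<bar>c 0 - p\<bar>"] by (simp add: k0_def)
  have "\<exists>n. p < c (k0 + int n + 1)"
    using g[of k0 "nat \<bar>p - c k0\<bar> + 1"] by (intro exI[of _ "nat \<bar>p - c k0\<bar>"]) (auto simp: algebra_simps)
  then have n: "p < c (k0 + int (LEAST n. p < c (k0 + int n + 1)) + 1)" (is "p < c (k0 + int ?n + 1)")
    by (rule LeastI_ex)
  moreover have "c (k0 + int ?n) \<le> p"
  proof (cases ?n)
    case (Suc m)
    then have "\<not> p < c (k0 + int m + 1)"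
      using not_less_Least[of m "\<lambda>n. p < c (k0 + int n + 1)"] by simp
    moreover have "k0 + int ?n = k0 + int m + 1" unfolding Suc by simp
    ultimately show ?thesis by (simp only: not_less)
  qed (use k0 in simp)
  ultimately show ?thesis by blast
qed

lemma parse_locate:
  assumes "parse \<phi> x c y"
  obtains k where "c k \<le> p" "p < c (k + 1)"
  using increasing_locate[of c p] parse_less_iff(1)[OF assms] by auto

lemma parse_locate_unique:
  assumes "parse \<phi> x c y" "c k \<le> p" "p < c (k + 1)" "c l \<le> p" "p < c (l + 1)"
  shows "k = l"
  using assms parse_less_iff(1)[OF assms(1), of k "l + 1"] parse_less_iff(1)[OF assms(1), of l "k + 1"]
  by linarith

lemma parse_letter:
  assumes "parse \<phi> x c y" "c k \<le> p" "p < c (k + 1)"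
  shows "nat (p - c k) < length (\<phi> (x k))" "y p = \<phi> (x k) ! nat (p - c k)"
proof -
  show *: "nat (p - c k) < length (\<phi> (x k))"
    using assms parseD(1,2)[OF assms(1), of k] by (simp add: nat_less_iff)
  show "y p = \<phi> (x k) ! nat (p - c k)"
    using parse_nth[OF assms(1) *] assms(2) by simp
qed

lemma parse_range:
  assumes "parse \<phi> x c y" "\<And>k. set (\<phi> (x k)) \<subseteq> A"
  shows "range y \<subseteq> A"
proof safe
  fix p
  obtain k where "c k \<le> p" "p < c (k + 1)" using parse_locate[OF assms(1)] .
  from parse_letter[OF assms(1) this] assms(2)[of k] show "y p \<in> A"
    by (metis nth_mem subsetD)
qed

lemma parse_cong:
  assumes "parse \<phi> x c y" "\<And>k. \<phi> (x k) = \<psi> (x k)"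
  shows "parse \<psi> x c y"
  using assms unfolding parse_def by simp

lemma parse_unique:
  assumes "parse \<phi> x c y" "parse \<phi> x c' y'" "c i = c' i"
  shows "c = c'" "y = y'"
proof -
  have "c k = c' k" for k
  proof (induction k rule: int_induct[of _ i])
    case (step2 k)
    then show ?case using parseD(2)[OF assms(1), of "k - 1"] parseD(2)[OF assms(2), of "k - 1"] by simp
  qed (use assms parseD(2)[OF assms(1)] parseD(2)[OF assms(2)] in auto)
  then show c: "c = c'" by auto
  show "y = y'"
  proof
    fix p
    obtain k where "c k \<le> p" "p < c (k + 1)" using parse_locate[OF assms(1)] .
    then show "y p = y' p"
      using parse_letter(2)[OF assms(1)] parse_letter(2)[OF assms(2)] c by metis
  qed
qed

lemma parse_reindex: "parse \<phi> x c y \<Longrightarrow> parse \<phi> (\<lambda>k. x (k + s)) (\<lambda>k. c (k + s)) y"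
proof -
  assume r: "parse \<phi> x c y"
  have "c (k + 1 + s) = c (k + s) + int (length (\<phi> (x (k + s))))" for k
    using parseD(2)[OF r, of "k + s"] by (simp add: ac_simps)
  then show ?thesis using r by (simp add: parse_def)
qed

lemma parse_translate: "parse \<phi> x c y \<Longrightarrow> parse \<phi> x (\<lambda>k. c k - s) (\<lambda>p. y (p + s))"
  by (auto simp: parse_def seg_def algebra_simps)

lemma block_position_Suc:
  fixes f :: "int \<Rightarrow> int"
  defines "c \<equiv> \<lambda>k. if 0 \<le> k then \<Sum>i\<in>{0..<k}. f i else - (\<Sum>i\<in>{k..<0}. f i)"
  shows "c (k + 1) = c k + f k"
proof (cases "0 \<le> k")
  case True
  then have "{0..<k + 1} = insert k {0..<k}" by auto
  then show ?thesis using True by (simp add: c_def)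
next
  case False
  then have "{k..<0} = insert k {k + 1..<0}" by auto
  then show ?thesis using False by (auto simp: c_def)
qed

lemma parse_exists:
  assumes "\<And>k. \<phi> (x k) \<noteq> []"
  obtains c y where "parse \<phi> x c y" "c i = p"
proof -
  define c0 where "c0 = (\<lambda>k. if 0 \<le> k then (\<Sum>i\<in>{0..<k}. int (length (\<phi> (x i))))
      else - (\<Sum>i\<in>{k..<0}. int (length (\<phi> (x i)))))"
  have c0: "c0 (k + 1) = c0 k + int (length (\<phi> (x k)))" for k
    unfolding c0_def by (rule block_position_Suc)
  define c where "c = (\<lambda>k. c0 k - c0 i + p)"
  have c: "c (k + 1) = c k + int (length (\<phi> (x k)))" for k using c0 by (simp add: c_def)
  have less: "c k < c (k + 1)" for k using c[of k] assms[of k] by simp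
  have mono: "k \<le> l \<Longrightarrow> c k \<le> c l" for k l
  proof (induction l rule: int_ge_induct)
    case (step l) then show ?case using less[of l] by simp
  qed simp
  define loc where "loc = (\<lambda>q. SOME k. c k \<le> q \<and> q < c (k + 1))"
  have loc: "c (loc q) \<le> q" "q < c (loc q + 1)" for q
    using someI_ex[OF increasing_locate[of c q, OF less]] by (auto simp: loc_def)
  have loc_eq: "loc q = k" if "c k \<le> q" "q < c (k + 1)" for q k
  proof (rule antisym)
    show "loc q \<le> k" using mono[of "k + 1" "loc q"] loc(1)[of q] that by linarith
    show "k \<le> loc q" using mono[of "loc q + 1" k] loc(2)[of q] that by linarith
  qed
  define y where "y = (\<lambda>q. \<phi> (x (loc q)) ! nat (q - c (loc q)))"
  have "parse \<phi> x c y"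
    unfolding parse_def
  proof (intro allI conjI)
    fix k
    show "seg y (c k) (length (\<phi> (x k))) = \<phi> (x k)"
    proof (rule nth_equalityI)
      fix j assume "j < length (seg y (c k) (length (\<phi> (x k))))"
      then have j: "j < length (\<phi> (x k))" by simp
      then have "loc (c k + int j) = k" by (intro loc_eq) (auto simp: c)
      then show "seg y (c k) (length (\<phi> (x k))) ! j = \<phi> (x k) ! j" using j by (simp add: y_def)
    qed simp
  qed (use assms c in auto)
  moreover have "c i = p" by (simp add: c_def)
  ultimately show thesis by (rule that)
qed

lemma parse_comp:
  assumes "parse \<alpha> x d z" "parse \<beta> z e y"
  shows "parse (\<lambda>a. ext \<beta> (\<alpha> a)) x (e \<circ> d) y"
  unfolding parse_def
proof (intro allI conjI)
  fix k
  have s: "seg z (d k) (length (\<alpha> (x k))) = \<alpha> (x k)" by (rule parseD(3)[OF assms(1)])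
  have "length (ext \<beta> (\<alpha> (x k))) \<ge> length (\<alpha> (x k))"
    by (subst (2) s[symmetric], subst s[symmetric], rule length_ext_ge)
       (use parseD(1)[OF assms(2)] in \<open>auto simp: seg_def\<close>)
  moreover have "length (\<alpha> (x k)) > 0" using parseD(1)[OF assms(1), of k] by simp
  ultimately show "ext \<beta> (\<alpha> (x k)) \<noteq> []" by (metis length_greater_0_conv less_le_trans)
  show "(e \<circ> d) (k + 1) = (e \<circ> d) k + int (length (ext \<beta> (\<alpha> (x k))))"
    using parse_seg(1)[OF assms(2), of "d k" "length (\<alpha> (x k))"] parseD(2)[OF assms(1), of k] s by simp
  show "seg y ((e \<circ> d) k) (length (ext \<beta> (\<alpha> (x k)))) = ext \<beta> (\<alpha> (x k))"
    using parse_seg(2)[OF assms(2), of "d k" "length (\<alpha> (x k))"] s by simp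
qed

lemma parse_factor:
  assumes "parse (\<lambda>a. ext \<beta> (\<alpha> a)) x c y"
    and "\<And>k. \<alpha> (x k) \<noteq> []" "\<forall>k. \<forall>b\<in>set (\<alpha> (x k)). \<beta> b \<noteq> []"
  obtains d z e where "parse \<alpha> x d z" "parse \<beta> z e y" "c = e \<circ> d" "d i = p"
proof -
  obtain d z where dz: "parse \<alpha> x d z" "d i = p"
    by (rule parse_exists[of \<alpha> x i p, OF assms(2)])
  have "range z \<subseteq> {b. \<beta> b \<noteq> []}" by (rule parse_range[OF dz(1)]) (use assms(3) in auto)
  then have nz: "\<beta> (z k) \<noteq> []" for k by auto
  obtain e y' where ey: "parse \<beta> z e y'" "e p = c i"
    by (rule parse_exists[of \<beta> z p "c i", OF nz])
  have "c i = (e \<circ> d) i" using dz ey by simp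
  from parse_unique[OF assms(1) parse_comp[OF dz(1) ey(1)] this] have "c = e \<circ> d" "y = y'" .
  then show thesis using that[OF dz(1) _ _ dz(2)] ey(1) by blast
qed

lemma parse_reverse:
  assumes "parse \<phi> x c y"
  shows "parse (\<lambda>a. rev (\<phi> a)) (\<lambda>k. x (- 1 - k)) (\<lambda>k. - c (- k)) (\<lambda>p. y (- 1 - p))"
  unfolding parse_def
proof (intro allI conjI)
  fix k :: int
  let ?l = "length (\<phi> (x (- 1 - k)))"
  have c: "c (- k) = c (- 1 - k) + int ?l" using parseD(2)[OF assms, of "- 1 - k"] by simp
  then show "- c (- (k + 1)) = - c (- k) + int (length (rev (\<phi> (x (- 1 - k)))))"
    by (simp add: algebra_simps)
  show "seg (\<lambda>p. y (- 1 - p)) (- c (- k)) (length (rev (\<phi> (x (- 1 - k))))) = rev (\<phi> (x (- 1 - k)))"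
  proof (rule nth_equalityI)
    fix j assume "j < length (seg (\<lambda>p. y (- 1 - p)) (- c (- k)) (length (rev (\<phi> (x (- 1 - k))))))"
    then have j: "j < ?l" by simp
    have "y (c (- 1 - k) + int (?l - Suc j)) = \<phi> (x (- 1 - k)) ! (?l - Suc j)"
      by (rule parse_nth[OF assms]) (use j in simp)
    moreover have "c (- 1 - k) + int (?l - Suc j) = - 1 - (- c (- k) + int j)" using j c by simp
    ultimately have "y (- 1 - (- c (- k) + int j)) = \<phi> (x (- 1 - k)) ! (?l - Suc j)"
      by (simp only:)
    then show "seg (\<lambda>p. y (- 1 - p)) (- c (- k)) (length (rev (\<phi> (x (- 1 - k))))) ! j
        = rev (\<phi> (x (- 1 - k))) ! j"
      using j by (simp add: rev_nth)
  qed simp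
qed (use parseD(1)[OF assms] in auto)

section \<open>The defect theorem for bi-infinite sequences\<close>

text \<open>Both concatenations spell the same letters to the right of the common cut, so that different
  letters at the cut would yield two words with comparable images.\<close>

lemma common_cut_next_letter:
  assumes "finite A" "\<forall>a\<in>A. \<beta> a \<noteq> []" "\<not> fewer_letters \<beta> A"
    and "parse \<beta> z e y" "parse \<beta> z' e' y" "range z \<subseteq> A" "range z' \<subseteq> A" "e k = e' k'"
  shows "z k = z' k'"
proof (rule ccontr)
  assume ne: "z k \<noteq> z' k'"
  define L where "L = (\<Sum>a\<in>A. length (\<beta> a))"
  let ?s = "seg z k (Suc (L * L))" and ?t = "seg z' k' (Suc (L * L))"
  have st: "set ?s \<subseteq> A" "set ?t \<subseteq> A" using set_seg_subset assms(6,7) by metis+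
  have hd: "hd (seg z k (Suc n)) = z k" for z :: "int \<Rightarrow> 'a" and k n
    by (simp add: seg_def hd_map del: upt_Suc)
  have nonempty: "seg z k (Suc n) \<noteq> []" for z :: "int \<Rightarrow> 'a" and k n
    by (simp add: seg_def)
  have "length ?s \<le> length (ext \<beta> ?s)" "length ?t \<le> length (ext \<beta> ?t)"
    by (rule length_ext_ge; use st assms(2) in blast)+
  then have len: "L * L \<le> length (ext \<beta> ?s)" "L * L \<le> length (ext \<beta> ?t)" by simp_all
  have "ext \<beta> ?s = seg y (e k) (length (ext \<beta> ?s))" "ext \<beta> ?t = seg y (e k) (length (ext \<beta> ?t))"
    using parse_seg(2)[OF assms(4), of k] parse_seg(2)[OF assms(5), of k'] assms(8) by simp_all
  then have "comparable (ext \<beta> ?s) (ext \<beta> ?t)"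
    using seg_comparable[of y "e k"] by metis
  then have "fewer_letters \<beta> A"
    using distinct_decodings_fewer_letters[OF assms(1,2) st nonempty nonempty _ L_def len] ne
    unfolding hd by blast
  with assms(3) show False by blast
qed

text \<open>To the right of the common cut this is the preceding lemma, to the left it is the same lemma for
  the reversed words.\<close>

lemma common_cut_imp_equal:
  assumes "finite A" "\<forall>a\<in>A. \<beta> a \<noteq> []" "\<not> fewer_letters \<beta> A"
    and "parse \<beta> z e y" "parse \<beta> z' e' y" "range z \<subseteq> A" "range z' \<subseteq> A" "e k = e' k"
  shows "z = z'" "e = e'"
proof -
  have prev: "z (i - 1) = z' (i - 1)" if "e i = e' i" for i
  proof -
    have *: "(\<lambda>k. z (- 1 - k)) (- i) = (\<lambda>k. z' (- 1 - k)) (- i)"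
      by (rule common_cut_next_letter[OF assms(1) _ _ parse_reverse[OF assms(4)] parse_reverse[OF assms(5)]])
         (use assms that in \<open>auto dest: fewer_letters_rev\<close>)
    then show ?thesis by (simp add: algebra_simps)
  qed
  have e: "e i = e' i" for i
  proof (induction i rule: int_induct[of _ k])
    case (step1 i)
    then show ?case
      using parseD(2)[OF assms(4), of i] parseD(2)[OF assms(5), of i] common_cut_next_letter[OF assms(1-7), of i i]
      by simp
  next
    case (step2 i)
    then show ?case
      using parseD(2)[OF assms(4), of "i - 1"] parseD(2)[OF assms(5), of "i - 1"] prev[of i] by simp
  qed (rule assms(8))
  then show "e = e'" by auto
  show "z = z'" using common_cut_next_letter[OF assms(1-7)] e by auto
qed

definition periodic :: "(int \<Rightarrow> 'a) \<Rightarrow> bool" where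
  "periodic y \<longleftrightarrow> (\<exists>q\<ge>1. \<forall>p. y (p + int q) = y p)"

text \<open>To the left of every coordinate \<open>p\<close>, at distance at most the number \<open>N\<close> of states, a state repeats
  with some period \<open>t \<le> N\<close>, and determinism propagates this period to the right. The period \<open>N!\<close> is
  a multiple of all these \<open>t\<close>.\<close>

lemma finite_deterministic_periodic:
  fixes S :: "int \<Rightarrow> 's"
  assumes fin: "finite (range S)" and step: "\<And>p. S (p + 1) = F (S p)"
  shows "periodic S"
proof -
  define N where "N = card (range S)"
  have iter: "S (p + int n) = (F ^^ n) (S p)" for p n
  proof (induction n)
    case (Suc n) then show ?case using step[of "p + int n"] by (simp add: algebra_simps)
  qed simp
  have "S (p + int (fact N)) = S p" for p
  proof -
    have "\<not> inj_on (\<lambda>i. S (p - int i)) {0..N}"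
    proof
      assume "inj_on (\<lambda>i. S (p - int i)) {0..N}"
      then have "card {0..N} \<le> card (range S)"
        by (rule card_inj_on_le) (use fin in auto)
      then show False by (simp add: N_def)
    qed
    then obtain i j where ij: "i < j" "j \<le> N" "S (p - int i) = S (p - int j)"
      unfolding inj_on_def by (metis atLeastAtMost_iff linorder_neqE_nat)
    define t where "t = j - i"
    have per: "S (u + int t) = S u" if "p - int j \<le> u" for u
    proof -
      define n where "n = nat (u - (p - int j))"
      have "u + int t = p - int i + int n" "u = p - int j + int n"
        using that ij by (auto simp: n_def t_def)
      then show ?thesis using iter ij(3) by metis
    qed
    have mult: "S (p + int (r * t)) = S p" for r
    proof (induction r)
      case (Suc r) then show ?case using per[of "p + int (r * t)"] by (simp add: algebra_simps)
    qed simp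
    have "t dvd fact N" by (rule dvd_fact) (use ij in \<open>auto simp: t_def\<close>)
    then show ?thesis using mult by (metis dvd_div_mult_self)
  qed
  then show ?thesis unfolding periodic_def by (intro exI[of _ "fact N"]) auto
qed

text \<open>The state at a coordinate consists of the letter and the offset in the first and in the second
  concatenation. If a word of one concatenation ends, a word of the other one continues, because
  there is no common cut. It shows the next letter of \<open>z\<close>, which is the first letter of the new word
  and hence the new word's own name. So each state determines the next one.\<close>

lemma left_marked_periodic:
  assumes "finite A" "\<forall>a\<in>A. \<alpha> a \<noteq> [] \<and> hd (\<alpha> a) = a"
    and "parse \<alpha> x d z" "parse \<alpha> x' d' z" "range x \<subseteq> A" "range x' \<subseteq> A"
    and disj: "range d \<inter> range d' = {}"
  shows "periodic z"
proof -
  define loc where "loc = (\<lambda>(c::int \<Rightarrow> int) p. SOME k. c k \<le> p \<and> p < c (k + 1))"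
  define T where "T = (\<lambda>x d p. (x (loc d p) :: 'a, nat (p - d (loc d p))))"
  define G where "G = (\<lambda>((a, i), (b, j)). if Suc i < length (\<alpha> a) then (a, Suc i) else (\<alpha> b ! Suc j, 0))"
  have T_eq: "T x d p = (x k, nat (p - d k))" if "parse \<alpha> x d z" "d k \<le> p" "p < d (k + 1)" for x d p k
  proof -
    have "d (loc d p) \<le> p \<and> p < d (loc d p + 1)"
      unfolding loc_def by (rule someI[of _ k]) (use that in auto)
    then have "loc d p = k" using parse_locate_unique[OF that(1)] that by metis
    then show ?thesis by (simp add: T_def)
  qed
  have step: "T x d (p + 1) = G (T x d p, T x' d' p)"
    if r: "parse \<alpha> x d z" "parse \<alpha> x' d' z" and A: "range x \<subseteq> A" and disj: "range d \<inter> range d' = {}"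
    for x d x' d' p
  proof -
    obtain k where k: "d k \<le> p" "p < d (k + 1)" using parse_locate[OF r(1)] .
    obtain k' where k': "d' k' \<le> p" "p < d' (k' + 1)" using parse_locate[OF r(2)] .
    note Teq = T_eq[OF r(1) k] T_eq[OF r(2) k']
    note len = parseD(2)[OF r(1), of k]
    show ?thesis
    proof (cases "p + 1 < d (k + 1)")
      case True
      then have "T x d (p + 1) = (x k, nat (p + 1 - d k))" using T_eq[OF r(1)] k by simp
      then show ?thesis using True k len by (simp add: G_def Teq Suc_nat_eq_nat_zadd1 nat_less_iff add.commute)
    next
      case False
      then have p: "p + 1 = d (k + 1)" using k by simp
      have "p + 1 \<noteq> d' (k' + 1)" using disj p by auto
      then have "p + 1 < d' (k' + 1)" using k' by simp
      then have "z (p + 1) = \<alpha> (x' k') ! nat (p + 1 - d' k')"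
        using parse_letter(2)[OF r(2)] k' by simp
      also have "nat (p + 1 - d' k') = Suc (nat (p - d' k'))" using k' by simp
      finally have z: "z (p + 1) = \<alpha> (x' k') ! Suc (nat (p - d' k'))" .
      have "\<alpha> (x (k + 1)) ! 0 = x (k + 1)"
        using A assms(2) by (metis hd_conv_nth rangeI subsetD)
      then have "z (p + 1) = x (k + 1)"
        using parse_nth[OF r(1), of 0 "k + 1"] parseD(1)[OF r(1), of "k + 1"] p by simp
      moreover have "T x d (p + 1) = (x (k + 1), 0)"
        using T_eq[OF r(1), of "k + 1" "p + 1"] p parse_less_iff(1)[OF r(1), of "k+1" "k+1+1"] by simp
      moreover have "\<not> Suc (nat (p - d k)) < length (\<alpha> (x k))"
        using p len k by linarith
      ultimately show ?thesis using z by (simp add: G_def Teq)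
    qed
  qed
  define S where "S = (\<lambda>p. (T x d p, T x' d' p))"
  define M where "M = (\<Sum>a\<in>A. length (\<alpha> a))"
  have T_in: "T x d p \<in> A \<times> {..<M}" if rA: "parse \<alpha> x d z" "range x \<subseteq> A" for x d p
  proof -
    obtain k where k: "d k \<le> p" "p < d (k + 1)" using parse_locate[OF rA(1)] .
    have "x k \<in> A" using rA by auto
    then have "length (\<alpha> (x k)) \<le> M" unfolding M_def by (rule member_le_sum) (use assms in auto)
    then show ?thesis using T_eq[OF rA(1) k] parse_letter(1)[OF rA(1) k] \<open>x k \<in> A\<close> by auto
  qed
  have "periodic S"
  proof (rule finite_deterministic_periodic)
    have "range S \<subseteq> (A \<times> {..<M}) \<times> (A \<times> {..<M})"
      unfolding S_def by (intro image_subsetI SigmaI T_in[OF assms(3,5)] T_in[OF assms(4,6)])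
    then show "finite (range S)" by (rule finite_subset) (use assms(1) in auto)
    show "S (p + 1) = (\<lambda>(s, t). (G (s, t), G (t, s))) (S p)" for p
      unfolding S_def using step[OF assms(3,4,5) disj, of p] step[OF assms(4,3,6), of p] disj
      by (simp add: Int_commute)
  qed
  then obtain q where q: "q \<ge> 1" "\<And>p. S (p + int q) = S p" by (auto simp: periodic_def)
  have zS: "z p = \<alpha> (fst (T x d p)) ! snd (T x d p)" for p
  proof -
    obtain k where k: "d k \<le> p" "p < d (k + 1)" using parse_locate[OF assms(3)] .
    show ?thesis using T_eq[OF assms(3) k] parse_letter(2)[OF assms(3) k] by simp
  qed
  have "z (p + int q) = z p" for p
    using q(2)[of p] by (simp add: zS S_def)
  with q(1) show ?thesis by (auto simp: periodic_def)
qed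

lemma periodic_image:
  assumes "parse \<beta> z e y" "periodic z"
  shows "periodic y"
proof -
  obtain q where q: "q \<ge> 1" "\<And>p. z (p + int q) = z p" using assms(2) by (auto simp: periodic_def)
  have "parse \<beta> z (\<lambda>k. e (k + int q)) y" using parse_reindex[OF assms(1), of "int q"] q by simp
  moreover define s where "s = e (int q) - e 0"
  ultimately have "parse \<beta> z (\<lambda>k. e (k + int q) - s) (\<lambda>p. y (p + s))" using parse_translate by blast
  moreover have "e 0 = e (0 + int q) - s" by (simp add: s_def)
  ultimately have "y = (\<lambda>p. y (p + s))" by (rule parse_unique(2)[OF assms(1)])
  then have "y (p + s) = y p" for p by metis
  moreover have "s \<ge> 1" using parse_less_iff(1)[OF assms(1), of 0 "int q"] q(1) by (simp add: s_def)
  ultimately show ?thesis unfolding periodic_def by (intro exI[of _ "nat s"]) simp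
qed

text \<open>A concatenation may be followed up to a cut, continued by an explicit word, and completed by
  another concatenation.\<close>

lemma parse_splice:
  assumes r: "parse \<beta> z e y" "parse \<beta> z' e' y"
    and w: "\<omega> \<noteq> []" "\<And>a. a \<in> set \<omega> \<Longrightarrow> \<beta> a \<noteq> []"
    and mid: "seg y (e 0) (length (ext \<beta> \<omega>)) = ext \<beta> \<omega>"
    and e': "e' (int (length \<omega>)) = e 0 + int (length (ext \<beta> \<omega>))"
  obtains e'' where
    "parse \<beta> (\<lambda>i. if i < 0 then z i else if i < int (length \<omega>) then \<omega> ! nat i else z' i) e'' y"
    "e'' 0 = e 0" "e'' (int (length \<omega>)) = e' (int (length \<omega>))"
proof -
  let ?n = "int (length \<omega>)"
  define x where "x = (\<lambda>i. if i < 0 then z i else if i < ?n then \<omega> ! nat i else z' i)"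
  define f where "f = (\<lambda>i. if i < 0 then e i else if i < ?n
      then e 0 + int (length (ext \<beta> (take (nat i) \<omega>))) else e' i)"
  have f0: "f 0 = e 0" and fn: "f ?n = e' ?n" using w(1) by (auto simp: f_def)
  have "\<beta> (x k) \<noteq> [] \<and> f (k + 1) = f k + int (length (\<beta> (x k))) \<and>
          seg y (f k) (length (\<beta> (x k))) = \<beta> (x k)" for k
  proof -
    consider "k < 0" | "0 \<le> k" "k < ?n" | "k \<ge> ?n" by linarith
    then show ?thesis
    proof cases
      case 1
      have "f (k + 1) = e (k + 1)" using 1 f0 by (cases "k = -1") (auto simp: f_def)
      then show ?thesis using 1 parseD[OF r(1), of k] by (simp add: x_def f_def)
    next
      case 2
      define j where "j = nat k"
      have j: "k = int j" "j < length \<omega>" using 2 by (auto simp: j_def)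
      have take: "take (Suc j) \<omega> = take j \<omega> @ [\<omega> ! j]" using j by (simp add: take_Suc_conv_app_nth)
      have f1: "f (k + 1) = e 0 + int (length (ext \<beta> (take (Suc j) \<omega>)))"
      proof (cases "Suc j = length \<omega>")
        case True
        then have "f (k + 1) = e' ?n" using j by (simp add: f_def algebra_simps flip: True)
        then show ?thesis using e' True by simp
      next
        case False
        then show ?thesis using j by (auto simp: f_def nat_add_distrib)
      qed
      have "ext \<beta> (take j \<omega> @ \<omega> ! j # drop (Suc j) \<omega>)
          = ext \<beta> (take j \<omega>) @ \<beta> (\<omega> ! j) @ ext \<beta> (drop (Suc j) \<omega>)" by simp
      then have "ext \<beta> \<omega> = ext \<beta> (take j \<omega>) @ \<beta> (\<omega> ! j) @ ext \<beta> (drop (Suc j) \<omega>)"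
        unfolding id_take_nth_drop[OF j(2), symmetric] .
      with mid have "seg y (e 0 + int (length (ext \<beta> (take j \<omega>)))) (length (\<beta> (\<omega> ! j))) = \<beta> (\<omega> ! j)"
        by (intro seg_middle[where t = "ext \<beta> (drop (Suc j) \<omega>)"]) metis
      then show ?thesis using f1 take j w(2)[of "\<omega> ! j"] by (simp add: x_def f_def)
    next
      case 3
      then show ?thesis using parseD[OF r(2), of k] by (simp add: x_def f_def)
    qed
  qed
  then have "parse \<beta> x f y" by (simp add: parse_def)
  from that[OF this[unfolded x_def] f0 fn] show thesis .
qed

text \<open>Assume that \<open>\<phi>\<close> does not factor. Then the parsings have no common cut at all, and \<open>c 0\<close> lies inside
  a word of the second one; let \<open>v\<close> be the rest of this word. To the right of \<open>c 0\<close> the sequence is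
  spelled by \<open>x\<close> as well as by \<open>v\<close> and \<open>x'\<close>, which is a relation as in \<open>left_marked_factorization\<close>. It
  gives \<open>\<phi> = \<beta>' \<circ> \<alpha>\<close> and \<open>v = \<beta>'(\<omega>)\<close>, and \<open>\<beta>'\<close> does not factor either. The parsings lift to sequences
  \<open>z = \<alpha>(x)\<close> and \<open>z' = \<alpha>(x')\<close> that are parsed by \<open>\<beta>'\<close>. The mixture of \<open>z\<close>, \<open>\<omega>\<close> and \<open>z'\<close> has a cut in common
  with each of them, so that \<open>z = z'\<close>. This sequence has two \<open>\<alpha>\<close>-parsings without a common cut and is
  periodic, and so is its image \<open>y\<close>.\<close>

theorem two_parsings_fewer_letters:
  fixes A :: "'a set" and \<phi> :: "'a \<Rightarrow> 'b list"
  assumes A: "finite A" and \<phi>: "\<forall>a\<in>A. \<phi> a \<noteq> []"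
    and r: "parse \<phi> x c y" "parse \<phi> x' c' y" and x: "range x \<subseteq> A" "range x' \<subseteq> A"
    and nper: "\<not> periodic y"
    and neq: "\<not> (\<exists>s. \<forall>k. x' k = x (k + s) \<and> c' k = c (k + s))"
  shows "fewer_letters \<phi> A"
proof (rule ccontr)
  assume nf: "\<not> fewer_letters \<phi> A"
  have no_common: "c k \<noteq> c' k'" for k k'
  proof
    assume eq: "c k = c' k'"
    define s where "s = k - k'"
    have "(\<lambda>k. x (k + s)) = x'" "(\<lambda>k. c (k + s)) = c'"
      by (rule common_cut_imp_equal[OF A \<phi> nf parse_reindex[OF r(1)] r(2), of s k'];
          use x eq in \<open>force simp: s_def\<close>)+
    then have "\<forall>k. x' k = x (k + s) \<and> c' k = c (k + s)" by auto
    with neq show False by blast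
  qed
  obtain k' where k': "c' k' \<le> c 0" "c 0 < c' (k' + 1)" using parse_locate[OF r(2)] .
  define v where "v = seg y (c 0) (nat (c' (k' + 1) - c 0))"
  have v: "v \<noteq> []" "int (length v) = c' (k' + 1) - c 0"
    using k' by (auto simp: v_def seg_def)
  \<comment> \<open>the letter \<open>None\<close> is added with the overlap \<open>v\<close> as its image\<close>
  define \<beta> where "\<beta> = case_option v \<phi>"
  have ext_Some: "ext \<beta> (map Some u) = ext \<phi> u" for u by (simp add: \<beta>_def o_def)
  define L where "L = (\<Sum>a\<in>A. length (\<beta> (Some a))) + length (\<beta> None)"
  let ?s = "seg x' (k' + 1) (Suc (L * L))" and ?t = "seg x 0 (Suc (L * L))"
  have st: "set ?s \<subseteq> A" "set ?t \<subseteq> A" using set_seg_subset x by metis+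
  have len: "length ?s \<le> length (ext \<phi> ?s)" "length ?t \<le> length (ext \<phi> ?t)"
    by (rule length_ext_ge; use st \<phi> in blast)+
  have "ext \<beta> (None # map Some ?s) = v @ seg y (c' (k' + 1)) (length (ext \<phi> ?s))"
    using parse_seg(2)[OF r(2), of "k' + 1" "Suc (L * L)"] by (simp only: list.map concat.simps ext_Some) (simp add: \<beta>_def)
  also have "\<dots> = seg y (c 0) (length v + length (ext \<phi> ?s))"
    using v by (simp add: seg_add v_def)
  finally have 1: "ext \<beta> (None # map Some ?s) = seg y (c 0) (length v + length (ext \<phi> ?s))" .
  have 2: "ext \<beta> (map Some ?t) = seg y (c 0) (length (ext \<phi> ?t))"
    using parse_seg(2)[OF r(1), of 0 "Suc (L * L)"] by (simp only: ext_Some)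
  have "left_marked A \<beta>"
  proof (rule left_marked_factorization[OF A, of \<beta> "map Some ?s" "map Some ?t" L])
    show "comparable (ext \<beta> (None # map Some ?s)) (ext \<beta> (map Some ?t))"
      unfolding 1 2 by (rule seg_comparable)
    show "L * L \<le> length (ext \<beta> (None # map Some ?s))" "L * L \<le> length (ext \<beta> (map Some ?t))"
      unfolding 1 2 using len by simp_all
    show "map Some ?t \<noteq> []" using length_seg by (metis length_0_conv length_map Zero_not_Suc)
    show "hd (map Some ?t) \<noteq> None" using length_seg[of x 0 "Suc (L * L)"]
      by (cases ?t) auto
  qed (use st \<phi> v(1) L_def in \<open>auto simp: \<beta>_def\<close>)
  then obtain \<alpha> \<omega> \<beta>' where
      \<beta>': "\<forall>a\<in>A. \<beta>' a \<noteq> []" and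
      \<alpha>: "\<forall>a\<in>A. \<alpha> a \<noteq> [] \<and> hd (\<alpha> a) = a \<and> set (\<alpha> a) \<subseteq> A \<and> \<phi> a = ext \<beta>' (\<alpha> a)" and
      \<omega>: "\<omega> \<noteq> []" "set \<omega> \<subseteq> A" "v = ext \<beta>' \<omega>"
    unfolding \<beta>_def left_marked_def by auto
  have nf': "\<not> fewer_letters \<beta>' A"
    using fewer_letters_comp[of \<beta>' A A \<alpha> \<phi>] \<alpha> nf by blast
  have xA: "x k \<in> A" "x' k \<in> A" for k using x by auto
  have ne: "\<alpha> a \<noteq> []" "b \<in> set (\<alpha> a) \<Longrightarrow> \<beta>' b \<noteq> []" "set (\<alpha> a) \<subseteq> A" if "a \<in> A" for a b
    using \<alpha> \<beta>' that by auto
  have "parse (\<lambda>a. ext \<beta>' (\<alpha> a)) x c y" "parse (\<lambda>a. ext \<beta>' (\<alpha> a)) x' c' y"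
    by (rule parse_cong[OF r(1)] parse_cong[OF r(2)]; use \<alpha> xA in blast)+
  note r' = this
  obtain d z e where f: "parse \<alpha> x d z" "parse \<beta>' z e y" "c = e \<circ> d" "d 0 = 0"
    using parse_factor[OF r'(1)] ne xA by metis
  obtain d' z' e' where f': "parse \<alpha> x' d' z'" "parse \<beta>' z' e' y" "c' = e' \<circ> d'" "d' (k' + 1) = int (length \<omega>)"
    using parse_factor[OF r'(2)] ne xA by metis
  have zA: "range z \<subseteq> A" "range z' \<subseteq> A"
    using parse_range[OF f(1), of A] parse_range[OF f'(1), of A] ne(3) xA by auto
  have e0: "e 0 = c 0" "e' (int (length \<omega>)) = c' (k' + 1)" using f f' by auto
  \<comment> \<open>up to index \<open>0\<close> from the first parsing, then the overlap \<open>v\<close>, then from the second parsing\<close>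
  define z'' where "z'' = (\<lambda>i. if i < 0 then z i else if i < int (length \<omega>) then \<omega> ! nat i else z' i)"
  have m: "seg y (e 0) (length (ext \<beta>' \<omega>)) = ext \<beta>' \<omega>" "e' (int (length \<omega>)) = e 0 + int (length (ext \<beta>' \<omega>))"
  proof -
    have "seg y (c 0) (length v) = v" using v_def length_seg by metis
    then show "seg y (e 0) (length (ext \<beta>' \<omega>)) = ext \<beta>' \<omega>" by (simp only: e0 \<omega>(3))
    show "e' (int (length \<omega>)) = e 0 + int (length (ext \<beta>' \<omega>))"
      using v(2) by (simp only: e0 \<omega>(3)[symmetric])
  qed
  obtain e'' where s: "parse \<beta>' z'' e'' y" "e'' 0 = e 0" "e'' (int (length \<omega>)) = e' (int (length \<omega>))"
    using parse_splice[OF f(2) f'(2) \<omega>(1) _ m] \<beta>' \<omega>(2) unfolding z''_def by blast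
  have z''A: "range z'' \<subseteq> A"
  proof -
    have "\<omega> ! nat i \<in> A" if "0 \<le> i" "i < int (length \<omega>)" for i
      using \<omega>(2) that by (metis nat_less_iff nth_mem subsetD)
    then show ?thesis using zA by (auto simp: z''_def)
  qed
  have "z'' = z" "e'' = e" using common_cut_imp_equal[OF A \<beta>' nf' s(1) f(2) z''A zA(1) s(2)] .
  moreover have "z'' = z'" "e'' = e'" using common_cut_imp_equal[OF A \<beta>' nf' s(1) f'(2) z''A zA(2) s(3)] .
  ultimately have zz: "z' = z" "e' = e" by auto
  have "d k \<noteq> d' l" for k l using no_common[of k l] f(3) f'(3) zz by auto
  then have "range d \<inter> range d' = {}" by auto
  then have "periodic z"
    using left_marked_periodic[OF A _ f(1) f'(1)[unfolded zz] x] \<alpha> by blast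
  then show False using periodic_image[OF f(2)] nper by blast
qed

section \<open>Recognizability\<close>

lemma periodic_translate:
  assumes "periodic z" shows "periodic (\<lambda>p. z (p + s))"
proof -
  obtain q where q: "q \<ge> 1" "\<And>p. z (p + int q) = z p" using assms by (auto simp: periodic_def)
  have "z (p + int q + s) = z (p + s)" for p using q(2)[of "p + s"] by (simp add: ac_simps)
  with q(1) show ?thesis by (auto simp: periodic_def)
qed

text \<open>Suppose that the parsings differ. By the defect theorem \<open>\<sigma> = \<beta> \<circ> \<alpha>\<close> with a smaller alphabet \<open>D\<close>
  in between, and the hypotheses pass from \<open>\<sigma>\<close> and \<open>S\<close> to \<open>\<tau> = \<alpha> \<circ> \<beta>\<close> and \<open>S' = \<alpha>(S)\<close>. The two parsings
  of \<open>y\<close> give two \<open>\<tau>\<close>-parsings of \<open>\<alpha>(y)\<close>, by \<open>\<alpha>(x)\<close> and \<open>\<alpha>(x')\<close>. They agree by induction, so that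
  \<open>\<alpha>(x) = \<alpha>(x') = z\<close> up to the index. Desubstituting \<open>x\<close> and \<open>x'\<close> once more gives two \<open>\<tau>\<close>-parsings
  of \<open>z\<close>. They agree as well, and this identifies \<open>x\<close> with \<open>x'\<close> and the two \<open>\<alpha>\<close>-parsings of \<open>z\<close>.\<close>

theorem recognizable_on:
  fixes A :: "'a set" and \<sigma> :: "'a \<Rightarrow> 'a list"
  assumes "finite A" "\<And>a. a \<in> A \<Longrightarrow> \<sigma> a \<noteq> [] \<and> set (\<sigma> a) \<subseteq> A"
    and "\<And>x. x \<in> S \<Longrightarrow> range x \<subseteq> A" "\<And>x. x \<in> S \<Longrightarrow> \<not> periodic x"
    and "\<And>x. x \<in> S \<Longrightarrow> \<exists>x1\<in>S. \<exists>c. parse \<sigma> x1 c x"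
    and "\<And>x c y. x \<in> S \<Longrightarrow> parse \<sigma> x c y \<Longrightarrow> y \<in> S"
    and "x \<in> S" "x' \<in> S" "parse \<sigma> x c y" "parse \<sigma> x' c' y"
  shows "\<exists>s. \<forall>k. x' k = x (k + s) \<and> c' k = c (k + s)"
  using assms
proof (induction "card A" arbitrary: A \<sigma> S x x' c c' y rule: less_induct)
  case less
  note fin = less.prems(1) and \<sigma> = less.prems(2) and SA = less.prems(3) and nper = less.prems(4)
    and desub = less.prems(5) and closed = less.prems(6) and xS = less.prems(7,8) and r = less.prems(9,10)
  show ?case
  proof (rule ccontr)
    assume neq: "\<not> ?case"
    have yS: "y \<in> S" using closed[OF xS(1) r(1)] .
    have "fewer_letters \<sigma> A"
      using two_parsings_fewer_letters[OF fin _ r SA[OF xS(1)] SA[OF xS(2)] nper[OF yS] neq] \<sigma> by blast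
    then obtain C \<alpha> \<beta> where C: "finite (C::'a set)" "card C < card A"
        and \<alpha>: "\<And>a. a \<in> A \<Longrightarrow> \<alpha> a \<noteq> [] \<and> set (\<alpha> a) \<subseteq> C \<and> \<sigma> a = ext \<beta> (\<alpha> a)"
        and \<beta>_ne: "\<And>b. b \<in> C \<Longrightarrow> \<beta> b \<noteq> []"
      unfolding fewer_letters_def by blast
    \<comment> \<open>only the letters that occur in the words \<open>\<alpha> a\<close> are kept, so that \<open>\<beta>\<close> takes values in \<open>A\<close>\<close>
    define D where "D = (\<Union>a\<in>A. set (\<alpha> a))"
    have DC: "D \<subseteq> C" using \<alpha> by (auto simp: D_def)
    have D: "finite D" "card D < card A"
      using DC C finite_subset card_mono[OF C(1) DC] by auto
    have \<alpha>D: "\<alpha> a \<noteq> []" "set (\<alpha> a) \<subseteq> D" "\<sigma> a = ext \<beta> (\<alpha> a)" if "a \<in> A" for a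
      using \<alpha>[OF that] that by (auto simp: D_def)
    have \<beta>D: "\<beta> b \<noteq> []" "set (\<beta> b) \<subseteq> A" if "b \<in> D" for b
    proof -
      obtain a where a: "a \<in> A" "b \<in> set (\<alpha> a)" using \<open>b \<in> D\<close> by (auto simp: D_def)
      then have "set (\<beta> b) \<subseteq> set (\<sigma> a)" using \<alpha>D(3) by auto
      then show "set (\<beta> b) \<subseteq> A" using \<sigma>[OF a(1)] by auto
      show "\<beta> b \<noteq> []" using \<beta>_ne DC that by auto
    qed
    define \<tau> where "\<tau> = (\<lambda>b. ext \<alpha> (\<beta> b))"
    define S' where "S' = {z. \<exists>x\<in>S. \<exists>d. parse \<alpha> x d z}"
    have xA: "x k \<in> A" if "x \<in> S" for x k using SA[OF that] by auto
    have S'D: "range z \<subseteq> D" if "z \<in> S'" for z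
      using that parse_range[of \<alpha> _ _ z D] \<alpha>D(2) xA unfolding S'_def by blast
    have factor: "\<exists>d z e. parse \<alpha> x d z \<and> parse \<beta> z e y \<and> c = e \<circ> d"
      if xS: "x \<in> S" and rx: "parse \<sigma> x c y" for x c y
    proof -
      have rx': "parse (\<lambda>a. ext \<beta> (\<alpha> a)) x c y" by (rule parse_cong[OF rx]) (use \<alpha>D xA[OF xS] in auto)
      have n1: "\<alpha> (x k) \<noteq> []" for k using \<alpha>D xA[OF xS] by blast
      have n2: "\<forall>k. \<forall>b\<in>set (\<alpha> (x k)). \<beta> b \<noteq> []" using \<alpha>D xA[OF xS] \<beta>D by blast
      from parse_factor[OF rx' n1 n2] show ?thesis by metis
    qed
    have image: "\<exists>d z. parse \<alpha> x d z" if "x \<in> S" for x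
      using parse_exists[of \<alpha> x] \<alpha>D(1) xA[OF that] by metis
    have IH: "\<exists>s. \<forall>k. z' k = z (k + s) \<and> c' k = c (k + s)"
      if z: "z \<in> S'" "z' \<in> S'" and rz: "parse \<tau> z c y" "parse \<tau> z' c' y" for z z' c c' y
    proof (rule less.hyps[OF D(2) D(1) _ S'D _ _ _ z rz])
      fix b assume b: "b \<in> D"
      show "\<tau> b \<noteq> [] \<and> set (\<tau> b) \<subseteq> D"
        using \<beta>D[OF b] \<alpha>D by (cases "\<beta> b") (auto simp: \<tau>_def)
    next
      fix z assume "z \<in> S'"
      then obtain x d where x: "x \<in> S" "parse \<alpha> x d z" by (auto simp: S'_def)
      obtain y c where y: "parse \<sigma> x c y" using parse_exists[of \<sigma> x] \<sigma> xA[OF x(1)] by metis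
      obtain d' z' e' where f: "parse \<alpha> x d' z'" "parse \<beta> z' e' y" "c = e' \<circ> d'" using factor[OF x(1) y] by blast
      show "\<not> periodic z"
      proof
        assume "periodic z"
        have "parse \<alpha> x (\<lambda>k. d k - (d 0 - d' 0)) (\<lambda>p. z (p + (d 0 - d' 0)))" by (rule parse_translate[OF x(2)])
        from parse_unique(2)[OF f(1) this, of 0] have "z' = (\<lambda>p. z (p + (d 0 - d' 0)))" by simp
        with \<open>periodic z\<close> have "periodic z'"
          using periodic_translate by blast
        then have "periodic y" by (rule periodic_image[OF f(2)])
        with nper closed[OF x(1) y] show False by blast
      qed
    next
      fix z assume "z \<in> S'"
      then obtain x d where x: "x \<in> S" "parse \<alpha> x d z" by (auto simp: S'_def)
      obtain x1 c where x1: "x1 \<in> S" "parse \<sigma> x1 c x" using desub[OF x(1)] by blast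
      obtain d1 z1 e1 where f: "parse \<alpha> x1 d1 z1" "parse \<beta> z1 e1 x" using factor[OF x1] by blast
      have "parse \<tau> z1 (d \<circ> e1) z" unfolding \<tau>_def by (rule parse_comp[OF f(2) x(2)])
      moreover have "z1 \<in> S'" using f x1 by (auto simp: S'_def)
      ultimately show "\<exists>x1\<in>S'. \<exists>c. parse \<tau> x1 c z" by blast
    next
      fix z c y assume "z \<in> S'" and rz: "parse \<tau> z c y"
      then obtain x d where x: "x \<in> S" "parse \<alpha> x d z" by (auto simp: S'_def)
      have "z k \<in> D" for k using S'D[OF \<open>z \<in> S'\<close>] by auto
      then have n1: "\<beta> (z k) \<noteq> []" and n2: "\<forall>k. \<forall>b\<in>set (\<beta> (z k)). \<alpha> b \<noteq> []" for k
        using \<beta>D \<alpha>D by blast+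
      from parse_factor[OF rz[unfolded \<tau>_def] n1 n2]
      obtain e u f where f: "parse \<beta> z e u" "parse \<alpha> u f y" by metis
      have "parse (\<lambda>a. ext \<beta> (\<alpha> a)) x (e \<circ> d) u" by (rule parse_comp[OF x(2) f(1)])
      then have "parse \<sigma> x (e \<circ> d) u" by (rule parse_cong) (use \<alpha>D xA[OF x(1)] in auto)
      then have "u \<in> S" by (rule closed[OF x(1)])
      with f show "y \<in> S'" by (auto simp: S'_def)
    qed
    obtain d z e where f: "parse \<alpha> x d z" "parse \<beta> z e y" "c = e \<circ> d" using factor[OF xS(1) r(1)] by blast
    obtain d0 z0 e0 where f0: "parse \<alpha> x' d0 z0" "parse \<beta> z0 e0 y" "c' = e0 \<circ> d0" using factor[OF xS(2) r(2)] by blast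
    obtain g u where u: "parse \<alpha> y g u" using image[OF yS] by blast
    have "z \<in> S'" "z0 \<in> S'" using f f0 xS by (auto simp: S'_def)
    moreover have "parse \<tau> z (g \<circ> e) u" "parse \<tau> z0 (g \<circ> e0) u"
      unfolding \<tau>_def by (rule parse_comp[OF f(2) u] parse_comp[OF f0(2) u])+
    ultimately obtain s where s: "\<forall>k. z0 k = z (k + s) \<and> (g \<circ> e0) k = (g \<circ> e) (k + s)"
      using IH by blast
    then have e0: "e0 k = e (k + s)" for k using parse_less_iff(3)[OF u] by auto
    define d' where "d' = (\<lambda>k. d0 k + s)"
    have "parse \<alpha> x' (\<lambda>k. d0 k - (- s)) (\<lambda>p. z0 (p + (- s)))" by (rule parse_translate[OF f0(1)])
    then have f': "parse \<alpha> x' d' z" "c' = e \<circ> d'"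
      using s e0 f0(3) by (auto simp: d'_def)
    \<comment> \<open>one more desubstitution provides \<open>\<tau>\<close>-parsings of \<open>z\<close> itself\<close>
    obtain x1 h where x1: "x1 \<in> S" "parse \<sigma> x1 h x" using desub[OF xS(1)] by blast
    obtain x1' h' where x1': "x1' \<in> S" "parse \<sigma> x1' h' x'" using desub[OF xS(2)] by blast
    obtain d1 z1 e1 where f1: "parse \<alpha> x1 d1 z1" "parse \<beta> z1 e1 x" using factor[OF x1] by blast
    obtain d1' z1' e1' where f1': "parse \<alpha> x1' d1' z1'" "parse \<beta> z1' e1' x'" using factor[OF x1'] by blast
    have "z1 \<in> S'" "z1' \<in> S'" using f1 f1' x1 x1' by (auto simp: S'_def)
    moreover have "parse \<tau> z1 (d \<circ> e1) z" "parse \<tau> z1' (d' \<circ> e1') z"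
      unfolding \<tau>_def by (rule parse_comp[OF f1(2) f(1)] parse_comp[OF f1'(2) f'(1)])+
    ultimately obtain t where t: "\<forall>k. z1' k = z1 (k + t) \<and> (d' \<circ> e1') k = (d \<circ> e1) (k + t)"
      using IH by blast
    define q where "q = e1 t - e1' 0"
    have "z1' = (\<lambda>k. z1 (k + t))" using t by auto
    then have r1: "parse \<beta> z1' (\<lambda>k. e1 (k + t)) x" using parse_reindex[OF f1(2), of t] by simp
    have r2: "parse \<beta> z1' (\<lambda>k. e1' k - (- q)) (\<lambda>p. x' (p + (- q)))" by (rule parse_translate[OF f1'(2)])
    have "x = (\<lambda>p. x' (p + (- q)))" by (rule parse_unique(2)[OF r1 r2, of 0]) (simp add: q_def)
    then have "x (k + q) = x' (k + q + (- q))" for k by metis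
    then have x'x: "x' k = x (k + q)" for k by simp
    then have "x' = (\<lambda>k. x (k + q))" by auto
    then have r3: "parse \<alpha> x' (\<lambda>k. d (k + q)) z" using parse_reindex[OF f(1), of q] by simp
    have "d' (e1' 0) = d (e1' 0 + q)" using t[rule_format, of 0] by (simp add: q_def)
    then have "d' = (\<lambda>k. d (k + q))" by (rule parse_unique(1)[OF f'(1) r3])
    then have "x' k = x (k + q) \<and> c' k = c (k + q)" for k using x'x f'(2) f(3) by simp
    with neq show False by blast
  qed
qed

section \<open>Powers of a substitution\<close>

lemma subst_word_ext: "subst_word \<sigma> = ext \<sigma>"
  by (auto simp: subst_word_def)

lemma subst_power_0 [simp]: "subst_power \<sigma> 0 a = [a]"
  by (simp add: subst_power_def)

lemma subst_power_Suc: "subst_power \<sigma> (Suc n) = (\<lambda>a. ext \<sigma> (subst_power \<sigma> n a))"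
  by (auto simp: subst_power_def subst_word_def)

lemma subst_power_Suc': "subst_power \<sigma> (Suc n) = (\<lambda>a. ext (subst_power \<sigma> n) (\<sigma> a))"
proof (induction n)
  case (Suc n)
  have "subst_power \<sigma> (Suc (Suc n)) = (\<lambda>a. ext \<sigma> (ext (subst_power \<sigma> n) (\<sigma> a)))"
    by (simp only: subst_power_Suc[of \<sigma> "Suc n"] Suc)
  also have "\<dots> = (\<lambda>a. ext (subst_power \<sigma> (Suc n)) (\<sigma> a))"
    by (simp only: ext_ext subst_power_Suc)
  finally show ?case .
qed (simp add: subst_power_def subst_word_def)

lemma subst_power_add: "subst_power \<sigma> (m + n) a = ext (subst_power \<sigma> m) (subst_power \<sigma> n a)"
proof (induction m)
  case (Suc m) then show ?case by (simp add: subst_power_Suc ext_ext)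
qed simp

lemma ext_nonempty: "u \<noteq> [] \<Longrightarrow> (\<And>a. a \<in> set u \<Longrightarrow> \<phi> a \<noteq> []) \<Longrightarrow> ext \<phi> u \<noteq> []"
  by (cases u) auto

lemma subst_power_nonempty: "substitution \<sigma> \<Longrightarrow> subst_power \<sigma> n a \<noteq> []"
  by (induction n) (auto simp: subst_power_Suc substitution_def ext_nonempty simp del: concat_eq_Nil_conv)

lemma sublist_ext: "sublist u v \<Longrightarrow> sublist (ext \<phi> u) (ext \<phi> v)"
proof -
  assume "sublist u v"
  then obtain s t where "v = s @ u @ t" by (auto simp: sublist_def)
  then have "ext \<phi> v = ext \<phi> s @ ext \<phi> u @ ext \<phi> t" by simp
  then show ?thesis by (metis sublist_appendI)
qed

lemma sublist_seg: "p \<le> q \<Longrightarrow> q + int k \<le> p + int n \<Longrightarrow> sublist (seg y q k) (seg y p n)"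
proof -
  assume a: "p \<le> q" "q + int k \<le> p + int n"
  define i where "i = nat (q - p)"
  have "n = i + (k + (n - i - k))" "q = p + int i" using a by (auto simp: i_def)
  then have "seg y p n = seg y p i @ seg y q k @ seg y (q + int k) (n - i - k)"
    using seg_add[of y p i] seg_add[of y q k] by metis
  then show ?thesis by (metis sublist_appendI)
qed

lemma sublist_seg_obtain:
  assumes "sublist u (seg y p n)"
  obtains q where "p \<le> q" "q + int (length u) \<le> p + int n" "seg y q (length u) = u"
proof -
  obtain s t where st: "seg y p n = s @ u @ t" using assms by (auto simp: sublist_def)
  then have n: "n = length (s @ u @ t)" using length_seg by metis
  then have "seg y (p + int (length s)) (length u) = u"
    using st seg_middle by metis
  then show thesis using that[of "p + int (length s)"] n by simp
qed

lemma window_seg: "window x i j = seg x i (nat (j - i + 1))"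
  unfolding window_def by (rule nth_equalityI) (auto simp: nth_upto)

section \<open>The topology of the full shift\<close>

abbreviation full_shift :: "(int \<Rightarrow> 'a) topology" where
  "full_shift \<equiv> product_topology (\<lambda>_. discrete_topology UNIV) UNIV"

definition agree :: "int \<Rightarrow> (int \<Rightarrow> 'a) \<Rightarrow> (int \<Rightarrow> 'a) \<Rightarrow> bool" where
  "agree N x z \<longleftrightarrow> (\<forall>p. \<bar>p\<bar> \<le> N \<longrightarrow> x p = z p)"

lemma topspace_full_shift [simp]: "topspace full_shift = UNIV"
  by (simp add: PiE_UNIV_domain)

lemma full_shift_openI:
  assumes "\<And>x. x \<in> U \<Longrightarrow> \<exists>N. \<forall>z. agree N x z \<longrightarrow> z \<in> U"
  shows "openin full_shift U"
proof (subst openin_subopen, safe)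
  fix x assume "x \<in> U"
  then obtain N where N: "\<And>z. agree N x z \<Longrightarrow> z \<in> U" using assms by blast
  define V where "V = PiE UNIV (\<lambda>p::int. if \<bar>p\<bar> \<le> N then {x p} else UNIV)"
  have "openin full_shift V"
    unfolding V_def
  proof (rule product_topology_basis)
    have "{i. (if \<bar>i\<bar> \<le> N then {x i} else UNIV) \<noteq> topspace (discrete_topology UNIV)} \<subseteq> {- N..N}"
      by auto
    then show "finite {i. (if \<bar>i\<bar> \<le> N then {x i} else UNIV) \<noteq> topspace (discrete_topology UNIV)}"
      by (rule finite_subset) simp
  qed auto
  moreover have "x \<in> V" by (auto simp: V_def)
  moreover have "V \<subseteq> U"
  proof
    fix z assume "z \<in> V"
    then have "agree N x z" unfolding agree_def V_def by (auto simp: PiE_iff split: if_splits)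
    then show "z \<in> U" by (rule N)
  qed
  ultimately show "\<exists>T. openin full_shift T \<and> x \<in> T \<and> T \<subseteq> U" by blast
qed

lemma full_shift_openD:
  assumes "openin full_shift U" "x \<in> U"
  shows "\<exists>N. \<forall>z. agree (int N) x z \<longrightarrow> z \<in> U"
proof -
  obtain W where W: "finite {i. W i \<noteq> (UNIV :: 'a set)}" "x \<in> PiE UNIV W" "PiE UNIV W \<subseteq> U"
    using assms unfolding openin_product_topology_alt by auto
  define N where "N = (\<Sum>i\<in>{i. W i \<noteq> UNIV}. nat \<bar>i\<bar>)"
  have N: "\<bar>i\<bar> \<le> int N" if "W i \<noteq> UNIV" for i
  proof -
    have "nat \<bar>i\<bar> \<le> N" unfolding N_def by (rule member_le_sum) (use W(1) that in auto)
    then show ?thesis by linarith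
  qed
  have "z \<in> PiE UNIV W" if "agree (int N) x z" for z
    using that W(2) N unfolding PiE_UNIV_domain Pi_iff agree_def by (metis UNIV_I)
  with W(3) show ?thesis by blast
qed

lemma full_shift_closedI:
  assumes "\<And>x. (\<And>N. \<exists>s\<in>S. agree N s x) \<Longrightarrow> x \<in> S"
  shows "closedin full_shift S"
proof -
  have "openin full_shift (UNIV - S)"
  proof (rule full_shift_openI)
    fix x assume "x \<in> UNIV - S"
    then obtain N where "\<not> (\<exists>s\<in>S. agree N s x)" using assms by blast
    then have "\<forall>z. agree N x z \<longrightarrow> z \<in> UNIV - S" by (auto simp: agree_def)
    then show "\<exists>N. \<forall>z. agree N x z \<longrightarrow> z \<in> UNIV - S" ..
  qed
  then show ?thesis by (simp add: closedin_def)
qed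

lemma compact_full_shift: "compact_space (full_shift :: (int \<Rightarrow> 'a::finite) topology)"
  by (simp add: compact_space_product_topology compact_space_discrete_topology)

lemma Hausdorff_full_shift: "Hausdorff_space full_shift"
  by (simp add: Hausdorff_space_product_topology)

lemma continuous_map_full_shiftI:
  assumes "\<And>x p. \<exists>N. \<forall>z. agree N x z \<longrightarrow> f z p = f x p"
  shows "continuous_map full_shift full_shift f"
proof -
  have "continuous_map full_shift (discrete_topology UNIV) (\<lambda>x. f x p)" for p
  proof -
    have "openin full_shift {x \<in> topspace full_shift. f x p \<in> U}" for U
    proof (rule full_shift_openI)
      fix x assume x: "x \<in> {x \<in> topspace full_shift. f x p \<in> U}"
      obtain N where "\<forall>z. agree N x z \<longrightarrow> f z p = f x p" using assms by blast
      with x have "\<forall>z. agree N x z \<longrightarrow> z \<in> {x \<in> topspace full_shift. f x p \<in> U}" by auto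
      then show "\<exists>N. \<forall>z. agree N x z \<longrightarrow> z \<in> {x \<in> topspace full_shift. f x p \<in> U}" ..
    qed
    then show ?thesis by (auto simp: continuous_map_def)
  qed
  then show ?thesis by (simp add: continuous_map_componentwise_UNIV)
qed

text \<open>The coordinates of \<open>y\<close> depend on finitely many coordinates of \<open>x\<close>, so that the set is a continuous
  image of a compact set.\<close>

lemma closedin_image_full_shift:
  fixes K :: "(int \<Rightarrow> 'a::finite) set" and \<phi> :: "'a \<Rightarrow> 'a list"
  assumes ne: "\<And>a. \<phi> a \<noteq> []" and K: "closedin full_shift K"
  shows "closedin full_shift {y. \<exists>x\<in>K. \<exists>c. parse \<phi> x c y \<and> c 0 = p}"
proof -
  define f where "f = (\<lambda>x. SOME y. \<exists>c. parse \<phi> x c y \<and> c 0 = p)"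
  have f: "\<exists>c. parse \<phi> x c (f x) \<and> c 0 = p" for x
    unfolding f_def
  proof (rule someI_ex[of "\<lambda>y. \<exists>c. parse \<phi> x c y \<and> c 0 = p"])
    obtain c y where "parse \<phi> x c y" "c 0 = p" by (rule parse_exists[of \<phi> x 0 p, OF ne])
    then show "\<exists>y c. parse \<phi> x c y \<and> c 0 = p" by blast
  qed
  have "continuous_map full_shift full_shift f"
  proof (rule continuous_map_full_shiftI)
    fix x q
    obtain c where c: "parse \<phi> x c (f x)" "c 0 = p" using f by blast
    obtain k where k: "c k \<le> q" "q < c (k + 1)" using parse_locate[OF c(1)] .
    have "f z q = f x q" if ag: "agree (\<bar>k\<bar> + 1) x z" for z
    proof -
      obtain c' where c': "parse \<phi> z c' (f z)" "c' 0 = p" using f by blast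
      have eq: "x i = z i" if "\<bar>i\<bar> \<le> \<bar>k\<bar> + 1" for i using ag that by (auto simp: agree_def)
      have cc: "\<bar>i\<bar> \<le> \<bar>k\<bar> + 1 \<Longrightarrow> c i = c' i" for i
      proof (induction i rule: int_induct[of _ 0])
        case base then show ?case using c c' by simp
      next
        case (step1 i)
        then show ?case using parseD(2)[OF c(1), of i] parseD(2)[OF c'(1), of i] eq[of i] by simp
      next
        case (step2 i)
        then show ?case using parseD(2)[OF c(1), of "i - 1"] parseD(2)[OF c'(1), of "i - 1"] eq[of "i - 1"] by simp
      qed
      show ?thesis
        using parse_letter(2)[OF c(1) k] parse_letter(2)[OF c'(1), of k q] k cc[of k] cc[of "k + 1"] eq[of k]
        by simp
    qed
    then show "\<exists>N. \<forall>z. agree N x z \<longrightarrow> f z q = f x q" by blast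
  qed
  moreover have "compactin full_shift K"
    using K compact_full_shift closedin_compact_space by blast
  ultimately have "compactin full_shift (f ` K)" by (rule image_compactin[rotated])
  moreover have "f ` K = {y. \<exists>x\<in>K. \<exists>c. parse \<phi> x c y \<and> c 0 = p}"
  proof safe
    fix x assume "x \<in> K" then show "\<exists>u\<in>K. \<exists>c. parse \<phi> u c (f x) \<and> c 0 = p" using f by blast
  next
    fix y x c assume x: "x \<in> K" "parse \<phi> x c y" "p = c 0"
    obtain c' where "parse \<phi> x c' (f x)" "c' 0 = c 0" using f x(3) by blast
    then have "y = f x" using parse_unique(2)[OF x(2), of c' "f x" 0] by simp
    then show "y \<in> f ` K" using x by blast
  qed
  ultimately show ?thesis
    using compactin_imp_closedin[OF Hausdorff_full_shift] by metis
qed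

lemma shift_power: "(shift ^^ n) x = (\<lambda>p. x (p + int n))"
  by (induction n) (auto simp: shift_def algebra_simps)

lemma parse_singletons:
  assumes "parse (subst_power \<sigma> 0) x c y"
  shows "c k = c 0 + k" "x k = y (c 0 + k)"
proof -
  have step: "c (k + 1) = c k + 1" for k using parseD(2)[OF assms, of k] by simp
  show c: "c k = c 0 + k"
  proof (induction k rule: int_induct[of _ 0])
    case (step2 k) then show ?case using step[of "k - 1"] by simp
  qed (use step in auto)
  show "x k = y (c 0 + k)" using parse_nth[OF assms, of 0 k] c by simp
qed

section \<open>The subshift of an aperiodic substitution\<close>

locale aperiodic_substitution =
  fixes \<sigma> :: "'a::finite \<Rightarrow> 'a list"
  assumes substitution: "substitution \<sigma>"
    and aperiodic: "aperiodic \<sigma>"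
    and letters: "\<And>a. [a] \<in> space_lang \<sigma>"
begin

abbreviation X where "X \<equiv> subst_space \<sigma>"
abbreviation \<sigma>p where "\<sigma>p \<equiv> subst_power \<sigma>"

lemma \<sigma>_ne: "\<sigma> a \<noteq> []" using substitution by (simp add: substitution_def)
lemma \<sigma>p_ne: "\<sigma>p n a \<noteq> []" by (rule subst_power_nonempty[OF substitution])

lemma lang_sublist: "u \<in> lang \<sigma> \<Longrightarrow> sublist v u \<Longrightarrow> v \<in> lang \<sigma>"
  unfolding lang_def using sublist_order.order_trans by blast

lemma lang_ext: "u \<in> lang \<sigma> \<Longrightarrow> ext \<sigma> u \<in> lang \<sigma>"
proof -
  assume "u \<in> lang \<sigma>"
  then obtain a n where "sublist u (\<sigma>p n a)" by (auto simp: lang_def)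
  then have "sublist (ext \<sigma> u) (\<sigma>p (Suc n) a)" by (auto simp: subst_power_Suc intro: sublist_ext)
  then show ?thesis unfolding lang_def by (auto intro!: exI[of _ a] exI[of _ "Suc n"])
qed

lemma X_iff: "x \<in> X \<longleftrightarrow> (\<forall>p n. seg x p n \<in> lang \<sigma>)"
proof
  assume "x \<in> X"
  have n: "nat (int N - (- int N) + 1) = 2 * N + 1" for N by simp
  then have w: "seg x (- int N) (2 * N + 1) \<in> lang \<sigma>" for N
  proof -
    have "window x (- int N) (int N) \<in> lang \<sigma>" using \<open>x \<in> X\<close> by (simp add: subst_space_def)
    then show ?thesis unfolding window_seg n .
  qed
  show "\<forall>p n. seg x p n \<in> lang \<sigma>"
  proof (intro allI)
    fix p n
    define N where "N = nat \<bar>p\<bar> + n"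
    have "sublist (seg x p n) (seg x (- int N) (2 * N + 1))"
      by (rule sublist_seg) (auto simp: N_def)
    then show "seg x p n \<in> lang \<sigma>" by (rule lang_sublist[OF w])
  qed
qed (auto simp: subst_space_def window_seg)

lemma X_translate: "x \<in> X \<Longrightarrow> (\<lambda>p. x (p + s)) \<in> X"
proof -
  assume "x \<in> X"
  moreover have "seg (\<lambda>p. x (p + s)) p n = seg x (p + s) n" for p n by (simp add: seg_def ac_simps)
  ultimately show ?thesis by (simp add: X_iff)
qed

lemma X_image:
  assumes "x \<in> X" "parse \<sigma> x c y"
  shows "y \<in> X"
  unfolding X_iff
proof (intro allI)
  fix p n
  obtain k where k: "c k \<le> p" "p < c (k + 1)" using parse_locate[OF assms(2)] .
  obtain l where l: "c l \<le> p + int n" "p + int n < c (l + 1)" using parse_locate[OF assms(2)] .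
  define N where "N = nat (l + 1 - k)"
  have "k < l + 1" using parse_less_iff(1)[OF assms(2), of k "l + 1"] k l by simp
  then have N: "l + 1 = k + int N" by (simp add: N_def)
  have "sublist (seg y p n) (seg y (c k) (length (ext \<sigma> (seg x k N))))"
    by (rule sublist_seg) (use k l N parse_seg(1)[OF assms(2), of k N] in auto)
  then show "seg y p n \<in> lang \<sigma>"
    using parse_seg(2)[OF assms(2), of k N] lang_ext[of "seg x k N"] assms(1) lang_sublist
    by (auto simp: X_iff)
qed

lemma X_image_power: "x \<in> X \<Longrightarrow> parse (\<sigma>p n) x c y \<Longrightarrow> y \<in> X"
proof (induction n arbitrary: y c)
  case 0
  have "y = (\<lambda>p. x (p + (- c 0)))"
    using parse_singletons(2)[OF 0(2)] by (simp add: fun_eq_iff)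
  then show ?case using X_translate[OF 0(1), of "- c 0"] by simp
next
  case (Suc n)
  obtain d z e where "parse (\<sigma>p n) x d z" "parse \<sigma> z e y"
    using parse_factor[OF Suc(3)[unfolded subst_power_Suc]] \<sigma>p_ne \<sigma>_ne by metis
  then show ?case using Suc.IH[OF Suc(2)] X_image by blast
qed

lemma X_not_periodic: "x \<in> X \<Longrightarrow> \<not> periodic x"
proof
  assume "x \<in> X" "periodic x"
  then obtain q where "q \<ge> 1" "(shift ^^ q) x = x" by (auto simp: periodic_def shift_power)
  with \<open>x \<in> X\<close> aperiodic show False by (auto simp: aperiodic_def)
qed

lemma space_lang_iff: "u \<in> space_lang \<sigma> \<longleftrightarrow> (\<exists>x\<in>X. seg x 0 (length u) = u)"
proof
  assume "u \<in> space_lang \<sigma>"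
  then obtain x i j where x: "x \<in> X" "u = seg x i (nat (j - i + 1))"
    by (auto simp: space_lang_def window_seg)
  have "seg (\<lambda>p. x (p + i)) 0 (length u) = u" using x(2) by (auto simp: seg_def ac_simps)
  with X_translate[OF x(1)] show "\<exists>x\<in>X. seg x 0 (length u) = u" by blast
next
  assume "\<exists>x\<in>X. seg x 0 (length u) = u"
  then obtain x where "x \<in> X" "u = window x 0 (int (length u) - 1)" by (auto simp: window_seg)
  then show "u \<in> space_lang \<sigma>" unfolding space_lang_def by blast
qed

lemma X_letter: "\<exists>x\<in>X. x 0 = a"
  using letters[of a] by (auto simp: space_lang_iff seg_def)

lemma X_closed: "closedin full_shift X"
proof (rule full_shift_closedI)
  fix x assume a: "\<And>N. \<exists>s\<in>X. agree N s x"
  show "x \<in> X"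
    unfolding X_iff
  proof (intro allI)
    fix p n
    obtain s where s: "s \<in> X" "agree (\<bar>p\<bar> + int n) s x" using a by blast
    have "seg x p n = seg s p n" using s(2) by (auto simp: seg_def agree_def)
    then show "seg x p n \<in> lang \<sigma>" using s(1) by (simp add: X_iff)
  qed
qed

text \<open>Since every letter occurs in \<open>X\<close>, each window of \<open>x\<close> occurs in \<open>\<sigma>\<close> of a point of \<open>X\<close>. So \<open>x\<close> is
  approximated by points that start within a block \<open>\<sigma> a\<close>, at an offset bounded by \<open>M\<close>. These points
  form a closed set.\<close>

lemma X_desubstitute:
  assumes "x \<in> X" shows "\<exists>y\<in>X. \<exists>c. parse \<sigma> y c x"
proof -
  define M where "M = Max (range (\<lambda>a. length (\<sigma> a)))"
  have M: "length (\<sigma> a) \<le> M" for a unfolding M_def by (rule Max_ge) auto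
  define F where "F = (\<lambda>j. {x. \<exists>y\<in>X. \<exists>c. parse \<sigma> y c x \<and> c 0 = - int j})"
  have "closedin full_shift (F j)" for j
    unfolding F_def by (rule closedin_image_full_shift[OF \<sigma>_ne X_closed])
  then have "closedin full_shift (\<Union>j\<le>M. F j)" by (intro closedin_Union) auto
  then have op: "openin full_shift (UNIV - (\<Union>j\<le>M. F j))" by (simp add: closedin_def)
  have approx: "\<exists>s\<in>(\<Union>j\<le>M. F j). agree (int N) s x" for N
  proof -
    have "seg x (- int N) (2 * N + 1) \<in> lang \<sigma>" using assms by (simp add: X_iff)
    then obtain a n where n: "sublist (seg x (- int N) (2 * N + 1)) (\<sigma>p (Suc n) a)"
      unfolding lang_def by (auto simp: Suc_le_eq gr0_conv_Suc)
    obtain z where z: "z \<in> X" "z 0 = a" using X_letter by blast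
    obtain c z' where z': "parse (\<sigma>p n) z c z'" by (rule parse_exists[of "\<sigma>p n" z 0 0, OF \<sigma>p_ne])
    obtain e y where y: "parse \<sigma> z' e y" by (rule parse_exists[of \<sigma> z' 0 0, OF \<sigma>_ne])
    have "parse (\<sigma>p (Suc n)) z (e \<circ> c) y" unfolding subst_power_Suc by (rule parse_comp[OF z' y])
    from parseD(3)[OF this, of 0] n z(2)
    have "sublist (seg x (- int N) (2 * N + 1)) (seg y (e (c 0)) (length (\<sigma>p (Suc n) a)))" by simp
    then obtain q where q: "seg y q (2 * N + 1) = seg x (- int N) (2 * N + 1)"
      using sublist_seg_obtain by (metis length_seg)
    define t where "t = q + int N"
    define s where "s = (\<lambda>p. y (p + t))"
    have rs: "parse \<sigma> z' (\<lambda>k. e k - t) s" unfolding s_def by (rule parse_translate[OF y])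
    obtain k where k: "e k - t \<le> 0" "0 < e (k + 1) - t" using parse_locate[OF rs] .
    have rs': "parse \<sigma> (\<lambda>i. z' (i + k)) (\<lambda>i. e (i + k) - t) s" by (rule parse_reindex[OF rs])
    have "nat (t - e k) \<le> M" using parseD(2)[OF y, of k] k M[of "z' k"] by simp
    moreover have "s \<in> F (nat (t - e k))"
      unfolding F_def mem_Collect_eq
      by (intro bexI[OF _ X_translate[OF X_image_power[OF z(1) z'], of k]] exI[of _ "\<lambda>i. e (i + k) - t"])
         (use rs' k in auto)
    moreover have "agree (int N) s x"
      unfolding agree_def
    proof safe
      fix p :: int assume p: "\<bar>p\<bar> \<le> int N"
      then have i: "nat (p + int N) < 2 * N + 1" and pN: "int (nat (p + int N)) = p + int N" by auto
      have "y (q + int (nat (p + int N))) = x (- int N + int (nat (p + int N)))"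
        using arg_cong[OF q, of "\<lambda>l. l ! nat (p + int N)"] i by (simp del: int_nat_eq)
      then show "s p = x p" unfolding pN by (simp add: s_def t_def ac_simps)
    qed
    ultimately show ?thesis by blast
  qed
  have "x \<in> (\<Union>j\<le>M. F j)"
  proof (rule ccontr)
    assume "x \<notin> (\<Union>j\<le>M. F j)"
    then obtain N where N: "\<And>z. agree (int N) x z \<Longrightarrow> z \<in> UNIV - (\<Union>j\<le>M. F j)"
      using full_shift_openD[OF op, of x] by blast
    from approx[of N] obtain s where s: "s \<in> (\<Union>j\<le>M. F j)" "agree (int N) s x" by blast
    then have "agree (int N) x s" by (simp add: agree_def)
    from N[OF this] s(1) show False by blast
  qed
  then show ?thesis by (auto simp: F_def)
qed

lemma X_desubstitute_power: "x \<in> X \<Longrightarrow> \<exists>y\<in>X. \<exists>c. parse (\<sigma>p n) y c x"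
proof (induction n)
  case 0
  have "parse (\<sigma>p 0) x (\<lambda>k. k) x" by (auto simp: parse_def seg_def)
  then show ?case using 0 by blast
next
  case (Suc n)
  then obtain y c where y: "y \<in> X" "parse (\<sigma>p n) y c x" by blast
  obtain z d where z: "z \<in> X" "parse \<sigma> z d y" using X_desubstitute[OF y(1)] by blast
  have "parse (\<sigma>p (Suc n)) z (c \<circ> d) x" unfolding subst_power_Suc' by (rule parse_comp[OF z(2) y(2)])
  then show ?case using z(1) by blast
qed

theorem recognizable_power:
  assumes "x \<in> X" "x' \<in> X" "parse (\<sigma>p n) x c y" "parse (\<sigma>p n) x' c' y"
  shows "\<exists>s. \<forall>k. x' k = x (k + s) \<and> c' k = c (k + s)"
  using assms
proof (induction n arbitrary: x x' c c' y)
  case 0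
  show ?case
  proof (intro exI allI)
    fix k
    show "x' k = x (k + (c' 0 - c 0)) \<and> c' k = c (k + (c' 0 - c 0))"
      using parse_singletons[OF 0(3), of "k + (c' 0 - c 0)"] parse_singletons[OF 0(4), of k]
      by (simp add: ac_simps)
  qed
next
  case (Suc n)
  have ne: "\<forall>k. \<forall>b\<in>set (\<sigma> (x k)). \<sigma>p n b \<noteq> []" for x using \<sigma>p_ne by blast
  obtain d z e where f: "parse \<sigma> x d z" "parse (\<sigma>p n) z e y" "c = e \<circ> d"
    using parse_factor[OF Suc(4)[unfolded subst_power_Suc'] \<sigma>_ne ne] by metis
  obtain d' z' e' where f': "parse \<sigma> x' d' z'" "parse (\<sigma>p n) z' e' y" "c' = e' \<circ> d'"
    using parse_factor[OF Suc(5)[unfolded subst_power_Suc'] \<sigma>_ne ne] by metis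
  obtain s where s: "\<forall>k. z' k = z (k + s) \<and> e' k = e (k + s)"
    using Suc.IH[OF X_image[OF Suc(2) f(1)] X_image[OF Suc(3) f'(1)] f(2) f'(2)] by blast
  have "parse \<sigma> x' (\<lambda>k. d' k - (- s)) (\<lambda>p. z' (p + (- s)))" by (rule parse_translate[OF f'(1)])
  then have "parse \<sigma> x' (\<lambda>k. d' k + s) z" using s by simp
  then have "\<exists>t. \<forall>k. x' k = x (k + t) \<and> d' k + s = d (k + t)"
    by (rule recognizable_on[of UNIV \<sigma> X, rotated -1])
       (use \<sigma>_ne X_not_periodic X_desubstitute X_image Suc(2,3) f(1) in auto)
  then obtain t where t: "\<forall>k. x' k = x (k + t) \<and> d' k + s = d (k + t)" by blast
  show ?case
    by (intro exI[of _ t]) (use t s f(3) f'(3) in auto)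
qed

end

section \<open>Return words\<close>

lemma subst_bseq_parse:
  assumes "substitution \<sigma>"
  shows "\<exists>c. parse \<sigma> x c (subst_bseq \<sigma> x) \<and> c 0 = 0"
proof -
  have ne: "\<sigma> a \<noteq> []" for a using assms by (simp add: substitution_def)
  obtain c y where c: "parse \<sigma> x c y" "c 0 = 0" by (rule parse_exists[of \<sigma> x 0 0, OF ne])
  define e where "e = subst_pos \<sigma> x"
  have e: "e (k + 1) = e k + int (length (\<sigma> (x k)))" for k
    unfolding e_def subst_pos_def by (rule block_position_Suc)
  have ce: "e k = c k" for k
  proof (induction k rule: int_induct[of _ 0])
    case base then show ?case using c by (simp add: e_def subst_pos_def)
  next
    case (step1 k) then show ?case using e[of k] parseD(2)[OF c(1), of k] by simp
  next
    case (step2 k) then show ?case using e[of "k - 1"] parseD(2)[OF c(1), of "k - 1"] by simp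
  qed
  have "subst_bseq \<sigma> x p = y p" for p
  proof -
    obtain k where k: "c k \<le> p" "p < c (k + 1)" using parse_locate[OF c(1)] .
    have "(THE k. c k \<le> p \<and> p < c (k + 1)) = k"
      by (rule the_equality) (use k parse_locate_unique[OF c(1)] in auto)
    then show ?thesis
      using parse_letter(2)[OF c(1) k] unfolding subst_bseq_def Let_def ce[unfolded e_def] by simp
  qed
  then have "subst_bseq \<sigma> x = y" by auto
  with c show ?thesis by blast
qed

lemma length_ext_mult:
  "(\<And>a. a \<in> set u \<Longrightarrow> N \<le> length (\<phi> a)) \<Longrightarrow> N * length u \<le> length (ext \<phi> u)"
proof (induction u)
  case (Cons a u)
  then have "N * length u \<le> length (ext \<phi> u)" "N \<le> length (\<phi> a)" by auto
  then show ?case by simp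
qed simp

lemma concat_cut_word: "concat (cut_word Q u) = u"
  and cut_word_nonempty: "v \<in> set (cut_word Q u) \<Longrightarrow> v \<noteq> []"
  and cut_word_Nil_iff: "cut_word Q u = [] \<longleftrightarrow> u = []"
proof (induction Q u arbitrary: v rule: cut_word.induct)
  case (3 Q a b u)
  { case 1
    show ?case using 3(1,3,4,6) by (cases "cut_word Q (b # u)") auto
  next
    case 2
    then show ?case using 3(2,3,5,6) by (cases "cut_word Q (b # u)") (auto split: if_splits)
  next
    case 3
    show ?case by simp
  }
qed auto

text \<open>Together with \<open>cut_word_cut_between\<close> this says that the pieces of \<open>cut_word\<close> are the words between
  consecutive cuts.\<close>

lemma cut_word_no_cut_inside:
  "v \<in> set (cut_word Q u) \<Longrightarrow> Suc i < length v \<Longrightarrow> \<not> Q (v ! i) (v ! Suc i)"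
proof (induction Q u arbitrary: v i rule: cut_word.induct)
  case (3 Q a b u)
  obtain v0 vs where c: "cut_word Q (b # u) = v0 # vs"
    using cut_word_Nil_iff[of Q "b # u"] by (cases "cut_word Q (b # u)") auto
  have v0: "v0 \<noteq> []" using cut_word_nonempty[of v0 Q "b # u"] c by simp
  have "concat (v0 # vs) = b # u" using concat_cut_word[of Q "b # u"] c by simp
  then have hd: "v0 ! 0 = b" using v0 by (cases v0) auto
  show ?case
  proof (cases "Q a b")
    case True
    then consider "v = [a]" | "v \<in> set (cut_word Q (b # u))" using 3(4) by auto
    then show ?thesis using 3(1)[OF True, of v i] 3(5) by cases auto
  next
    case False
    then consider "v = a # v0" | "v \<in> set vs" using 3(4) c by auto
    then show ?thesis
    proof cases
      case 1
      then show ?thesis using 3(2)[OF False, of v0 "i - 1"] 3(5) c False hd by (cases i) auto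
    next
      case 2
      then show ?thesis using 3(2)[OF False, of v i] 3(5) c by auto
    qed
  qed
qed auto

lemma cut_word_cut_between:
  "Suc i < length (cut_word Q u) \<Longrightarrow> Q (last (cut_word Q u ! i)) (hd (cut_word Q u ! Suc i))"
proof (induction Q u arbitrary: i rule: cut_word.induct)
  case (3 Q a b u)
  obtain v0 vs where c: "cut_word Q (b # u) = v0 # vs"
    using cut_word_Nil_iff[of Q "b # u"] by (cases "cut_word Q (b # u)") auto
  have v0: "v0 \<noteq> []" using cut_word_nonempty[of v0 Q "b # u"] c by simp
  have "concat (v0 # vs) = b # u" using concat_cut_word[of Q "b # u"] c by simp
  then have hd: "hd v0 = b" using v0 by (cases v0) auto
  show ?case
  proof (cases "Q a b")
    case True
    then have *: "cut_word Q (a # b # u) = [a] # v0 # vs" using c by simp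
    show ?thesis
    proof (cases i)
      case 0
      then show ?thesis using True hd by (simp add: * c)
    next
      case (Suc k)
      then show ?thesis using 3(1)[OF True, of k] 3(4) unfolding * c by simp
    qed
  next
    case False
    then show ?thesis using 3(2)[OF False, of i] 3(4) c v0 by (cases i) auto
  qed
qed auto

locale return_word_system =
  fixes \<sigma> :: "'a::finite \<Rightarrow> 'a list" and m :: nat and P :: "nat \<Rightarrow> 'a set"
    and w :: "nat \<Rightarrow> int \<Rightarrow> 'a"
  assumes m_primitive: "m_primitive \<sigma> m P"
    and aperiodic': "aperiodic \<sigma>"
    and fixed_points: "fixed_points \<sigma> m P w"
begin

sublocale aperiodic_substitution \<sigma>
  by unfold_locales (use m_primitive aperiodic' in \<open>auto simp: m_primitive_def\<close>)

text \<open>The pairs \<open>r\<^sub>k l\<^sub>k\<close> between whose letters words are cut.\<close>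

definition Q :: "'a \<Rightarrow> 'a \<Rightarrow> bool" where
  "Q a b \<longleftrightarrow> (\<exists>k\<in>{1..m}. a = w k (-1) \<and> b = w k 0)"

abbreviation "R \<equiv> return_words \<sigma> m w"
abbreviation "\<tau> \<equiv> derivative_subst \<sigma> m w"

lemma \<tau>_cut_word: "\<tau> u = cut_word Q (ext \<sigma> u)"
proof -
  have "Q = (\<lambda>a b. \<exists>k\<in>{1..m}. a = w k (-1) \<and> b = w k 0)" by (intro ext) (simp add: Q_def)
  then show ?thesis by (simp add: derivative_subst_def subst_word_ext)
qed

lemma set_\<sigma>p: "k \<in> {1..m} \<Longrightarrow> a \<in> P k \<Longrightarrow> set (\<sigma>p n a) \<subseteq> P k"
proof (induction n)
  case (Suc n)
  have "\<forall>i\<in>{1..m}. \<forall>a\<in>P i. set (\<sigma> a) \<subseteq> P i" using m_primitive by (auto simp: m_primitive_def)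
  then have "set (\<sigma> b) \<subseteq> P k" if "b \<in> P k" for b using Suc(2) that by blast
  then show ?case using Suc by (auto simp: subst_power_Suc)
qed simp

lemma w_in: "k \<in> {1..m} \<Longrightarrow> w k p \<in> P k"
proof -
  assume k: "k \<in> {1..m}"
  then have "w k \<in> min_component \<sigma> (P k)" using fixed_points by (simp add: fixed_points_def)
  then obtain j a where a: "a \<in> P k" "sublist (window (w k) (- int (nat \<bar>p\<bar>)) (int (nat \<bar>p\<bar>))) (\<sigma>p j a)"
    unfolding min_component_def by blast
  have "w k p \<in> set (window (w k) (- int (nat \<bar>p\<bar>)) (int (nat \<bar>p\<bar>)))"
    unfolding window_def by (simp, rule imageI) auto
  then show ?thesis using set_mono_sublist[OF a(2)] set_\<sigma>p[OF k a(1), of j] by blast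
qed

lemma P_disjoint: "k \<in> {1..m} \<Longrightarrow> l \<in> {1..m} \<Longrightarrow> a \<in> P k \<Longrightarrow> a \<in> P l \<Longrightarrow> k = l"
  using m_primitive unfolding m_primitive_def disjoint_family_on_def by fastforce

text \<open>The letters \<open>r\<^sub>k\<close> and \<open>l\<^sub>k\<close> lie in the primitive part \<open>P k\<close>, and these parts are disjoint.\<close>

lemma Q_deterministic:
  shows "Q a b \<Longrightarrow> Q a b' \<Longrightarrow> b = b'" and "Q a b \<Longrightarrow> Q a' b \<Longrightarrow> a = a'"
proof -
  have *: "k = l" if "k \<in> {1..m}" "l \<in> {1..m}" "w k p = w l p" for k l p
    by (rule P_disjoint[OF that(1,2) w_in[OF that(1), of p]]) (use w_in[OF that(2), of p] that(3) in simp)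
  show "Q a b \<Longrightarrow> Q a b' \<Longrightarrow> b = b'" unfolding Q_def using *[of _ _ "-1"] by blast
  show "Q a b \<Longrightarrow> Q a' b \<Longrightarrow> a = a'" unfolding Q_def using *[of _ _ 0] by blast
qed

text \<open>The sequence \<open>w k\<close> is fixed by \<open>\<sigma>\<close>, and the image of its letter at \<open>0\<close> starts at \<open>0\<close>.\<close>

lemma Q_image: assumes "Q a b" shows "hd (\<sigma> b) = b" "last (\<sigma> a) = a"
proof -
  obtain k where k: "k \<in> {1..m}" "a = w k (-1)" "b = w k 0" using assms by (auto simp: Q_def)
  then have "subst_bseq \<sigma> (w k) = w k" using fixed_points by (simp add: fixed_points_def)
  then obtain c where c: "parse \<sigma> (w k) c (w k)" "c 0 = 0"
    using subst_bseq_parse[OF substitution, of "w k"] by auto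
  show "hd (\<sigma> b) = b"
    using parse_nth[OF c(1), of 0 0] c(2) k \<sigma>_ne by (simp add: hd_conv_nth)
  have "c (- 1) + int (length (\<sigma> a)) = 0" using parseD(2)[OF c(1), of "-1"] c(2) k by simp
  moreover have "length (\<sigma> a) > 0" using \<sigma>_ne by simp
  ultimately have e: "c (- 1) + int (length (\<sigma> a) - 1) = - 1" by linarith
  have "w k (c (- 1) + int (length (\<sigma> a) - 1)) = \<sigma> a ! (length (\<sigma> a) - 1)"
    by (rule parse_nth[OF c(1), of "length (\<sigma> a) - 1" "-1", folded k(2)]) (use \<sigma>_ne in simp)
  then show "last (\<sigma> a) = a" unfolding e using k(2) \<sigma>_ne by (simp add: last_conv_nth)
qed

lemma length_\<sigma>p_mono: "n \<le> n' \<Longrightarrow> length (\<sigma>p n a) \<le> length (\<sigma>p n' a)"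
proof (induction n' rule: dec_induct)
  case (step n')
  have "length (\<sigma>p n' a) \<le> length (\<sigma>p (Suc n') a)"
    unfolding subst_power_Suc by (rule length_ext_ge) (rule \<sigma>_ne)
  then show ?case using step by simp
qed simp

text \<open>A primitive part has at least two letters, so that the power of \<open>\<sigma>\<close> which maps each of its letters to
  a word with all of them at least doubles the length.\<close>

lemma growth: assumes "k \<in> {1..m}" "a \<in> P k" shows "\<exists>n0. \<forall>n\<ge>n0. N \<le> length (\<sigma>p n a)"
proof -
  have "primitive_on \<sigma> (P k)" "card (P k) \<ge> 2"
    using m_primitive assms(1) by (auto simp: m_primitive_def)
  then obtain j where j: "\<And>a. a \<in> P k \<Longrightarrow> P k \<subseteq> set (\<sigma>p j a)" by (auto simp: primitive_on_def)
  have two: "2 \<le> length (\<sigma>p j a)" if "a \<in> P k" for a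
    using card_mono[OF _ j[OF that]] \<open>card (P k) \<ge> 2\<close> card_length[of "\<sigma>p j a"] by simp
  have "i \<le> length (\<sigma>p (j * i) a)" for i
  proof -
    have "2 ^ i \<le> length (\<sigma>p (j * i) a)"
    proof (induction i)
      case (Suc i)
      have "2 * length (\<sigma>p (j * i) a) \<le> length (ext (\<sigma>p j) (\<sigma>p (j * i) a))"
        by (rule length_ext_mult) (use two set_\<sigma>p[OF assms] in blast)
      then show ?case using Suc by (simp add: subst_power_add)
    qed simp
    then show ?thesis using less_exp[of i] by linarith
  qed
  then show ?thesis using length_\<sigma>p_mono le_trans by blast
qed

lemma primitive_contains_cut:
  assumes k: "k \<in> {1..m}"
  shows "\<exists>n0. \<forall>n\<ge>n0. \<forall>a\<in>P k. sublist [w k (-1), w k 0] (\<sigma>p n a)"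
proof -
  have "primitive_on \<sigma> (P k)" using m_primitive k by (auto simp: m_primitive_def)
  then obtain j where j: "\<And>a. a \<in> P k \<Longrightarrow> P k \<subseteq> set (\<sigma>p j a)" by (auto simp: primitive_on_def)
  have "w k \<in> min_component \<sigma> (P k)" using fixed_points k by (simp add: fixed_points_def)
  then obtain i b where b: "b \<in> P k" "sublist (window (w k) (- int 1) (int 1)) (\<sigma>p i b)"
    unfolding min_component_def by blast
  have "[- 1..1::int] = [-1, 0, 1]" by (simp add: upto.simps)
  then have "window (w k) (- int 1) (int 1) = [] @ [w k (-1), w k 0] @ [w k 1]" by (simp add: window_def)
  then have "sublist [w k (-1), w k 0] (window (w k) (- int 1) (int 1))" by (metis sublist_appendI)
  then have sb: "sublist [w k (-1), w k 0] (\<sigma>p i b)" using b(2) by (rule sublist_order.order_trans)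
  have "sublist [w k (-1), w k 0] (\<sigma>p n a)" if n: "n \<ge> i + j" and a: "a \<in> P k" for n a
  proof -
    have n': "n = i + (j + (n - i - j))" using n by simp
    obtain c where c: "c \<in> set (\<sigma>p (n - i - j) a)" using hd_in_set[OF \<sigma>p_ne] by blast
    then have "b \<in> set (\<sigma>p j c)" using j set_\<sigma>p[OF k a] b(1) by blast
    then have "b \<in> set (\<sigma>p (j + (n - i - j)) a)" using c by (auto simp: subst_power_add)
    then obtain s t where "\<sigma>p (j + (n - i - j)) a = s @ b # t" by (auto simp: in_set_conv_decomp)
    then have "\<sigma>p n a = ext (\<sigma>p i) s @ \<sigma>p i b @ ext (\<sigma>p i) t"
      by (subst n', simp only: subst_power_add[of \<sigma> i]) simp
    then have "sublist (\<sigma>p i b) (\<sigma>p n a)" by (metis sublist_appendI)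
    with sb show ?thesis by (rule sublist_order.order_trans)
  qed
  then show ?thesis by blast
qed

text \<open>Iterating \<open>\<sigma>\<close> leads from every letter into some primitive part, and within this part the word
  \<open>r\<^sub>k l\<^sub>k\<close> occurs in all high iterates of every letter.\<close>

lemma uniform_cut:
  "\<exists>N. \<forall>a. \<exists>k\<in>{1..m}. sublist [w k (-1), w k 0] (\<sigma>p N a)"
proof -
  have "\<exists>n0. \<forall>n\<ge>n0. \<exists>k\<in>{1..m}. sublist [w k (-1), w k 0] (\<sigma>p n a)" for a
  proof -
    obtain k b i where k: "k \<in> {1..m}" "b \<in> P k" "b \<in> set (\<sigma>p i a)"
      using m_primitive unfolding m_primitive_def by blast
    obtain n0 where n0: "\<And>n a. n \<ge> n0 \<Longrightarrow> a \<in> P k \<Longrightarrow> sublist [w k (-1), w k 0] (\<sigma>p n a)"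
      using primitive_contains_cut[OF k(1)] by blast
    have "sublist [w k (-1), w k 0] (\<sigma>p n a)" if "n \<ge> n0 + i" for n
    proof -
      have n: "n = (n - i) + i" using that by simp
      obtain s t where "\<sigma>p i a = s @ b # t" using k(3) by (auto simp: in_set_conv_decomp)
      then have "\<sigma>p n a = ext (\<sigma>p (n - i)) s @ \<sigma>p (n - i) b @ ext (\<sigma>p (n - i)) t"
        by (subst n, simp only: subst_power_add[of \<sigma> "n - i"]) simp
      then have "sublist (\<sigma>p (n - i) b) (\<sigma>p n a)" by (metis sublist_appendI)
      moreover have "n - i \<ge> n0" using that by simp
      ultimately show ?thesis using n0 k(2) sublist_order.order_trans by blast
    qed
    with k(1) show ?thesis by blast
  qed
  then obtain f where f: "\<And>a n. n \<ge> f a \<Longrightarrow> \<exists>k\<in>{1..m}. sublist [w k (-1), w k 0] (\<sigma>p n a)"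
    by metis
  have "f a \<le> Max (range f)" for a by (rule Max_ge) auto
  with f show ?thesis by blast
qed

definition cut_at :: "(int \<Rightarrow> 'a) \<Rightarrow> int \<Rightarrow> bool" where
  "cut_at y p \<longleftrightarrow> Q (y (p - 1)) (y p)"

lemma seg_pair: "seg y p 2 = [y p, y (p + 1)]"
  by (simp add: seg_def numeral_2_eq_2)

text \<open>The function \<open>c\<close> gives the boundaries of blocks \<open>\<sigma>\<^sup>N(a)\<close> with \<open>N\<close> from \<open>uniform_cut\<close>; cuts therefore
  occur in both directions without end.\<close>

lemma block_contains_cut:
  assumes "y \<in> X"
  shows "\<exists>c::int \<Rightarrow> int. (\<forall>p. \<exists>k. c k \<le> p \<and> p < c (k + 1)) \<and> (\<forall>k. \<exists>q. c k < q \<and> q < c (k + 1) \<and> cut_at y q)"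
proof -
  obtain N where N: "\<And>a. \<exists>k\<in>{1..m}. sublist [w k (-1), w k 0] (\<sigma>p N a)" using uniform_cut by blast
  obtain z c where z: "parse (\<sigma>p N) z c y" using X_desubstitute_power[OF assms] by blast
  have "\<exists>q. c i < q \<and> q < c (i + 1) \<and> cut_at y q" for i
  proof -
    obtain k where k: "k \<in> {1..m}" "sublist [w k (-1), w k 0] (\<sigma>p N (z i))" using N by blast
    then have "sublist [w k (-1), w k 0] (seg y (c i) (length (\<sigma>p N (z i))))" using parseD(3)[OF z] by simp
    then obtain q where q: "c i \<le> q" "q + 2 \<le> c i + int (length (\<sigma>p N (z i)))"
        "seg y q 2 = [w k (-1), w k 0]"
      by (rule sublist_seg_obtain) (auto simp: numeral_2_eq_2)
    then have "cut_at y (q + 1)" using k(1) by (auto simp: cut_at_def Q_def seg_pair)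
    then show ?thesis using q parseD(2)[OF z, of i] by (intro exI[of _ "q + 1"]) auto
  qed
  moreover have "\<exists>k. c k \<le> p \<and> p < c (k + 1)" for p using parse_locate[OF z] by metis
  ultimately show ?thesis by blast
qed

lemma cut_after: "y \<in> X \<Longrightarrow> \<exists>q>p. cut_at y q"
  using block_contains_cut[of y] by (meson less_trans not_less order_le_less_trans)

lemma cut_before: "y \<in> X \<Longrightarrow> \<exists>q<p. cut_at y q"
proof -
  assume "y \<in> X"
  then obtain c :: "int \<Rightarrow> int" where c: "\<forall>p. \<exists>k. c k \<le> p \<and> p < c (k + 1)" "\<forall>k. \<exists>q. c k < q \<and> q < c (k + 1) \<and> cut_at y q"
    using block_contains_cut[of y] by blast
  obtain k where "c k \<le> p" using c(1) by blast
  moreover obtain q where "q < c (k - 1 + 1)" "cut_at y q" using c(2)[rule_format, of "k - 1"] by blast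
  ultimately show ?thesis by (intro exI[of _ q]) simp
qed

lemma next_cut:
  assumes "y \<in> X"
  obtains q where "p < q" "cut_at y q" "\<forall>r. p < r \<and> r < q \<longrightarrow> \<not> cut_at y r"
proof -
  define n where "n = (LEAST n. cut_at y (p + 1 + int n))"
  obtain q where q: "q > p" "cut_at y q" using cut_after[OF assms] by blast
  then have "cut_at y (p + 1 + int (nat (q - p - 1)))" by simp
  then have "cut_at y (p + 1 + int n)" unfolding n_def by (rule LeastI)
  moreover have "\<not> cut_at y r" if "p < r" "r < p + 1 + int n" for r
  proof -
    have "nat (r - p - 1) < n" using that by auto
    then have "\<not> cut_at y (p + 1 + int (nat (r - p - 1)))" unfolding n_def by (rule not_less_Least)
    then show ?thesis using that by simp
  qed
  ultimately show thesis using that[of "p + 1 + int n"] by simp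
qed

lemma prev_cut:
  assumes "y \<in> X"
  obtains q where "q \<le> p" "cut_at y q" "\<forall>r. q < r \<and> r \<le> p \<longrightarrow> \<not> cut_at y r"
proof -
  define n where "n = (LEAST n. cut_at y (p - int n))"
  obtain q where q: "q < p" "cut_at y q" using cut_before[OF assms] by blast
  then have "cut_at y (p - int (nat (p - q)))" by simp
  then have "cut_at y (p - int n)" unfolding n_def by (rule LeastI)
  moreover have "\<not> cut_at y r" if "p - int n < r" "r \<le> p" for r
  proof -
    have "nat (p - r) < n" using that by auto
    then have "\<not> cut_at y (p - int (nat (p - r)))" unfolding n_def by (rule not_less_Least)
    then show ?thesis using that by simp
  qed
  ultimately show thesis using that[of "p - int n"] by simp
qed

text \<open>The word \<open>u\<close> stands in \<open>y\<close> between the consecutive cuts \<open>p\<close> and \<open>p + |u|\<close>. For points of the subshift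
  the words with this property are the return words (\<open>occ_return_word\<close>, \<open>return_word_occ\<close>).\<close>

definition occ :: "(int \<Rightarrow> 'a) \<Rightarrow> int \<Rightarrow> 'a list \<Rightarrow> bool" where
  "occ y p u \<longleftrightarrow> u \<noteq> [] \<and> seg y p (length u) = u \<and> cut_at y p \<and> cut_at y (p + int (length u)) \<and>
     (\<forall>q. p < q \<and> q < p + int (length u) \<longrightarrow> \<not> cut_at y q)"

lemma occI:
  assumes "p < q" "cut_at y p" "cut_at y q" "\<forall>r. p < r \<and> r < q \<longrightarrow> \<not> cut_at y r"
  shows "occ y p (seg y p (nat (q - p)))"
  using assms by (auto simp: occ_def seg_def)

lemma cut_at_translate: "cut_at (\<lambda>i. y (i + s)) p \<longleftrightarrow> cut_at y (p + s)"
  by (simp add: cut_at_def algebra_simps)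

lemma occ_translate: "occ (\<lambda>i. y (i + s)) p u \<longleftrightarrow> occ y (p + s) u"
proof -
  have "seg (\<lambda>i. y (i + s)) p n = seg y (p + s) n" for n by (simp add: seg_def ac_simps)
  moreover have "(\<forall>q. p < q \<and> q < p + int (length u) \<longrightarrow> \<not> cut_at y (q + s)) \<longleftrightarrow>
      (\<forall>q. p + s < q \<and> q < p + s + int (length u) \<longrightarrow> \<not> cut_at y q)"
    by (auto, metis add.commute add_less_cancel_left diff_add_cancel group_cancel.add2)
  ultimately show ?thesis unfolding occ_def cut_at_translate by (simp add: ac_simps)
qed

lemma occ_cover:
  assumes "y \<in> X" obtains p u where "occ y p u" "p \<le> k" "k < p + int (length u)"
proof -
  obtain p where p: "p \<le> k" "cut_at y p" "\<forall>r. p < r \<and> r \<le> k \<longrightarrow> \<not> cut_at y r" using prev_cut[OF assms, where p = k] .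
  obtain q where q: "k < q" "cut_at y q" "\<forall>r. k < r \<and> r < q \<longrightarrow> \<not> cut_at y r" using next_cut[OF assms, where p = k] .
  have "occ y p (seg y p (nat (q - p)))" by (rule occI) (use p q in \<open>auto, metis not_le\<close>)
  then show thesis using that[of p "seg y p (nat (q - p))"] p q by simp
qed

lemma occ_next:
  assumes "y \<in> X" "cut_at y p" obtains u where "occ y p u"
proof -
  obtain q where "p < q" "cut_at y q" "\<forall>r. p < r \<and> r < q \<longrightarrow> \<not> cut_at y r" using next_cut[OF assms(1), where p = p] .
  from that[OF occI[OF this(1) assms(2) this(2,3)]] show thesis by blast
qed

lemma occ_prev:
  assumes "y \<in> X" "cut_at y p" obtains u where "occ y (p - int (length u)) u"
proof -
  obtain q where q: "q \<le> p - 1" "cut_at y q" "\<forall>r. q < r \<and> r \<le> p - 1 \<longrightarrow> \<not> cut_at y r"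
    using prev_cut[OF assms(1), where p = "p - 1"] .
  have "occ y q (seg y q (nat (p - q)))" by (rule occI) (use q assms(2) in auto)
  then show thesis using that[of "seg y q (nat (p - q))"] q(1) by simp
qed

lemma occ_hd_last:
  assumes "occ y p u" shows "hd u = y p" "last u = y (p + int (length u) - 1)"
proof -
  have u: "u \<noteq> []" "seg y p (length u) = u" using assms by (auto simp: occ_def)
  have "u ! i = y (p + int i)" if "i < length u" for i using u(2) nth_seg[OF that] by metis
  then show "hd u = y p" "last u = y (p + int (length u) - 1)"
    using u(1) by (auto simp: hd_conv_nth last_conv_nth of_nat_diff Suc_leI algebra_simps)
qed

lemma occ_return_word:
  assumes "y \<in> X" "occ y p u" shows "u \<in> R"
proof -
  have o: "u \<noteq> []" "seg y p (length u) = u" "cut_at y p" "cut_at y (p + int (length u))"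
      "\<And>q. p < q \<Longrightarrow> q < p + int (length u) \<Longrightarrow> \<not> cut_at y q"
    using assms(2) by (auto simp: occ_def)
  have in_lang: "seg y q n \<in> space_lang \<sigma>" for q n
  proof -
    have "seg (\<lambda>i. y (i + q)) 0 n = seg y q n" by (simp add: seg_def ac_simps)
    then show ?thesis using X_translate[OF assms(1), of q] by (auto simp: space_lang_iff)
  qed
  obtain i where i: "i \<in> {1..m}" "y (p - 1) = w i (-1)" "y p = w i 0" using o(3) by (auto simp: cut_at_def Q_def)
  obtain j where j: "j \<in> {1..m}" "y (p + int (length u) - 1) = w j (-1)" "y (p + int (length u)) = w j 0"
    using o(4) by (auto simp: cut_at_def Q_def)
  have "seg y (p - 1) (1 + (length u + 1)) = w i (-1) # u @ [w j 0]"
    unfolding seg_add using o(2) i j by (simp add: seg_def)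
  then have "w i (-1) # u @ [w j 0] \<in> space_lang \<sigma>" using in_lang by metis
  moreover have "u \<in> space_lang \<sigma>" using in_lang o(2) by metis
  moreover have "\<not> sublist [w k (-1), w k 0] u" if "k \<in> {1..m}" for k
  proof
    assume "sublist [w k (-1), w k 0] u"
    then have "sublist [w k (-1), w k 0] (seg y p (length u))" using o(2) by simp
    then obtain q where q: "p \<le> q" "q + 2 \<le> p + int (length u)" "seg y q 2 = [w k (-1), w k 0]"
      by (rule sublist_seg_obtain) (auto simp: numeral_2_eq_2)
    then have "cut_at y (q + 1)" using that by (auto simp: cut_at_def Q_def seg_pair)
    then show False using o(5)[of "q + 1"] q by simp
  qed
  moreover have "hd u = w i 0" "last u = w j (-1)" using occ_hd_last[OF assms(2)] i j by auto
  ultimately show ?thesis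
    using o(1) i(1) j(1) unfolding return_words_def by blast
qed

lemma return_word_occ:
  assumes "u \<in> R" shows "\<exists>y\<in>X. occ y 0 u"
proof -
  obtain i j where ij: "u \<noteq> []" "i \<in> {1..m}" "j \<in> {1..m}" "w i (-1) # u @ [w j 0] \<in> space_lang \<sigma>"
      "hd u = w i 0" "last u = w j (-1)" "\<And>k. k \<in> {1..m} \<Longrightarrow> \<not> sublist [w k (-1), w k 0] u"
    using assms unfolding return_words_def by auto
  then obtain x where x: "x \<in> X" "seg x 0 (length (w i (-1) # u @ [w j 0])) = w i (-1) # u @ [w j 0]"
    by (auto simp: space_lang_iff)
  define y where "y = (\<lambda>p. x (p + 1))"
  have W: "seg x 0 (length ([w i (-1)] @ u @ [w j 0])) = [w i (-1)] @ u @ [w j 0]" using x(2) by simp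
  have "x 0 = w i (-1)" using arg_cong[OF W, of "\<lambda>l. l ! 0"] by simp
  moreover have "x (int (length u) + 1) = w j 0"
    using arg_cong[OF W, of "\<lambda>l. l ! Suc (length u)"] by (simp add: ac_simps)
  moreover have "seg x (0 + int (length [w i (-1)])) (length u) = u" by (rule seg_middle[OF W])
  ultimately have y: "y (-1) = w i (-1)" "seg y 0 (length u) = u" "y (int (length u)) = w j 0"
    by (auto simp: y_def seg_def ac_simps)
  have nth: "u ! k = y (int k)" if "k < length u" for k
    using y(2) nth_seg[OF that, of y 0] by simp
  have "y 0 = w i 0" using nth[of 0] ij(1,5) by (simp add: hd_conv_nth)
  then have "cut_at y 0" using y(1) ij(2) by (auto simp: cut_at_def Q_def)
  moreover have "y (int (length u) - 1) = w j (-1)"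
    using nth[of "length u - 1"] ij(1,6) by (simp add: last_conv_nth of_nat_diff Suc_leI)
  then have "cut_at y (int (length u))" using y(3) ij(3) by (auto simp: cut_at_def Q_def)
  moreover have "\<not> cut_at y q" if q: "0 < q" "q < int (length u)" for q
  proof
    assume "cut_at y q"
    then obtain k where k: "k \<in> {1..m}" "y (q - 1) = w k (-1)" "y q = w k 0" by (auto simp: cut_at_def Q_def)
    have "sublist (seg y (q - 1) 2) (seg y 0 (length u))" by (rule sublist_seg) (use q in auto)
    then show False using ij(7)[OF k(1)] k y(2) by (simp add: seg_pair)
  qed
  ultimately have "occ y 0 u" using ij(1) y(2) by (auto simp: occ_def)
  moreover have "y \<in> X" unfolding y_def by (rule X_translate[OF x(1)])
  ultimately show ?thesis by blast
qed

lemma cut_at_image: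
  assumes "parse \<sigma> y d z" "cut_at y k" shows "cut_at z (d k)"
proof -
  have Q: "Q (y (k - 1)) (y k)" using assms(2) by (simp add: cut_at_def)
  have "z (d k) = y k"
    using parse_nth[OF assms(1), of 0 k] Q_image(1)[OF Q] \<sigma>_ne by (simp add: hd_conv_nth)
  moreover have "z (d k - 1) = y (k - 1)"
  proof -
    let ?l = "length (\<sigma> (y (k - 1)))"
    have l: "?l > 0" using \<sigma>_ne by simp
    have "d k = d (k - 1) + int ?l" using parseD(2)[OF assms(1), of "k - 1"] by simp
    then have "d k - 1 = d (k - 1) + int (?l - 1)" using l by linarith
    then show ?thesis
      using parse_nth[OF assms(1), of "?l - 1" "k - 1"] Q_image(2)[OF Q] \<sigma>_ne by (simp add: last_conv_nth)
  qed
  ultimately show ?thesis using Q by (simp add: cut_at_def)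
qed

text \<open>Two adjacent pieces meet in a pair \<open>r\<^sub>k l\<^sub>k\<close>, and no such pair occurs within a piece; the two outer ends
  are cuts by assumption.\<close>

lemma occ_cut_word:
  assumes "V \<noteq> []" "seg z p (length V) = V" "cut_at z p" "cut_at z (p + int (length V))"
    and "i < length (cut_word Q V)"
  shows "occ z (p + int (length (concat (take i (cut_word Q V))))) (cut_word Q V ! i)"
proof -
  define cs where "cs = cut_word Q V"
  define s where "s = (\<lambda>i. length (concat (take i cs)))"
  have ne: "cs ! i \<noteq> []" if "i < length cs" for i
    using cut_word_nonempty that nth_mem unfolding cs_def by blast
  have split: "V = concat (take i cs) @ cs ! i @ concat (drop (Suc i) cs)" if "i < length cs" for i
  proof -
    have "V = concat cs" by (simp add: cs_def concat_cut_word)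
    also have "\<dots> = concat (take i cs @ cs ! i # drop (Suc i) cs)"
      by (simp only: id_take_nth_drop[OF that, symmetric])
    finally show ?thesis by simp
  qed
  have seg: "seg z (p + int (s i)) (length (cs ! i)) = cs ! i" if "i < length cs" for i
    unfolding s_def by (rule seg_middle[where t = "concat (drop (Suc i) cs)"])
      (use assms(2) split[OF that] in metis)
  have nth: "z (p + int (s i) + int k) = cs ! i ! k" if "i < length cs" "k < length (cs ! i)" for i k
    using seg[OF that(1)] nth_seg[OF that(2)] by metis
  have s_Suc: "s (Suc i) = s i + length (cs ! i)" if "i < length cs" for i
    using that by (simp add: s_def take_Suc_conv_app_nth)
  have left: "cut_at z (p + int (s i))" if "i < length cs" for i
  proof (cases i)
    case 0
    then show ?thesis using assms(3) by (simp add: s_def)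
  next
    case (Suc k)
    have k: "k < length cs" "Suc k < length cs" using that Suc by auto
    have "z (p + int (s i)) = hd (cs ! i)"
      using nth[OF that, of 0] ne[OF that] by (simp add: hd_conv_nth)
    moreover have "z (p + int (s i) - 1) = last (cs ! k)"
    proof -
      have l: "length (cs ! k) > 0" using ne[OF k(1)] by simp
      moreover have "s i = s k + length (cs ! k)" using s_Suc[OF k(1)] Suc by simp
      ultimately have e: "p + int (s i) - 1 = p + int (s k) + int (length (cs ! k) - 1)" by linarith
      show ?thesis
        unfolding e last_conv_nth[OF ne[OF k(1)]] by (rule nth[OF k(1)]) (use l in simp)
    qed
    ultimately show ?thesis
      using cut_word_cut_between[of k Q V] k Suc unfolding cut_at_def cs_def by simp
  qed
  have i: "i < length cs" using assms(5) by (simp add: cs_def)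
  have right: "cut_at z (p + int (s i) + int (length (cs ! i)))"
  proof (cases "Suc i < length cs")
    case True
    then show ?thesis using left[OF True] s_Suc[OF i] by (simp add: add.assoc)
  next
    case False
    then have "length V = s i + length (cs ! i)" using split[OF i] i
      by (metis append.right_neutral concat.simps(1) drop_all length_append not_less s_def)
    then show ?thesis using assms(4) by (simp add: add.assoc)
  qed
  have "\<not> cut_at z q" if q: "p + int (s i) < q" "q < p + int (s i) + int (length (cs ! i))" for q
  proof -
    define k where "k = nat (q - (p + int (s i)) - 1)"
    have k: "Suc k < length (cs ! i)" "q - 1 = p + int (s i) + int k" "q = p + int (s i) + int (Suc k)"
      using q by (auto simp: k_def)
    have "z (q - 1) = cs ! i ! k" "z q = cs ! i ! Suc k"
      unfolding k(2) unfolding k(3) by (rule nth[OF i]; use k(1) in simp)+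
    moreover have "\<not> Q (cs ! i ! k) (cs ! i ! Suc k)"
      by (rule cut_word_no_cut_inside[of _ _ V]) (use i k(1) cs_def in auto)
    ultimately show ?thesis by (simp add: cut_at_def)
  qed
  then show ?thesis
    using ne[OF i] seg[OF i] left[OF i] right unfolding occ_def s_def cs_def by blast
qed

end

section \<open>Towers over return words\<close>

context return_word_system
begin

abbreviation len :: "nat \<Rightarrow> 'a list \<Rightarrow> int" where
  "len n u \<equiv> int (length (ext (\<sigma>p n) u))"

text \<open>The point \<open>x\<close> contains a block \<open>\<sigma>\<^sup>n(u)\<close> that starts at coordinate \<open>- j\<close>. For \<open>0 \<le> j < len n u\<close> the block
  covers coordinate \<open>0\<close>, and \<open>x\<close> is on floor \<open>j\<close> of the tower of height \<open>len n u\<close> over the clopen set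
  given by \<open>u\<close>. Other values of \<open>j\<close> describe blocks further away; they allow one to pass to the next or
  the previous block before moving the origin.\<close>

definition in_tower :: "nat \<Rightarrow> 'a list \<Rightarrow> int \<Rightarrow> (int \<Rightarrow> 'a) \<Rightarrow> bool" where
  "in_tower n u j x \<longleftrightarrow> (\<exists>y\<in>X. \<exists>c. parse (\<sigma>p n) y c x \<and> c 0 = - j \<and> occ y 0 u)"

lemma in_towerI:
  assumes "y \<in> X" "parse (\<sigma>p n) y c x" "occ y p u" shows "in_tower n u (- c p) x"
proof -
  have "parse (\<sigma>p n) (\<lambda>i. y (i + p)) (\<lambda>i. c (i + p)) x" by (rule parse_reindex[OF assms(2)])
  moreover have "occ (\<lambda>i. y (i + p)) 0 u" using assms(3) by (simp add: occ_translate)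
  moreover have "(\<lambda>i. y (i + p)) \<in> X" by (rule X_translate[OF assms(1)])
  ultimately show ?thesis unfolding in_tower_def
    by (intro bexI[of _ "\<lambda>i. y (i + p)"] exI[of _ "\<lambda>i. c (i + p)"]) auto
qed

lemma occ_end:
  assumes "parse (\<sigma>p n) y c x" "occ y p u" shows "c (p + int (length u)) = c p + len n u"
  using parse_seg(1)[OF assms(1), of p "length u"] assms(2) by (simp add: occ_def)

lemma in_tower_return_word: "in_tower n u j x \<Longrightarrow> u \<in> R"
  unfolding in_tower_def using occ_return_word by blast

lemma in_tower_in_X: "in_tower n u j x \<Longrightarrow> x \<in> X"
  unfolding in_tower_def using X_image_power by blast

lemma return_word_nonempty: "u \<in> R \<Longrightarrow> u \<noteq> []"
  by (simp add: return_words_def)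

lemma len_pos: "u \<noteq> [] \<Longrightarrow> 0 < len n u"
  using ext_nonempty[of u "\<sigma>p n"] \<sigma>p_ne by (metis length_greater_0_conv of_nat_0_less_iff)

lemma in_tower_nonempty:
  assumes "u \<in> R" shows "\<exists>x. in_tower n u j x"
proof -
  obtain y where y: "y \<in> X" "occ y 0 u" using return_word_occ[OF assms] by blast
  obtain c x where c: "parse (\<sigma>p n) y c x" "c 0 = - j" by (rule parse_exists[of "\<sigma>p n" y 0 "- j", OF \<sigma>p_ne])
  show ?thesis using y c by (auto simp: in_tower_def)
qed

lemma in_tower_exists:
  assumes "x \<in> X" shows "\<exists>u j. in_tower n u j x \<and> 0 \<le> j \<and> j < len n u"
proof -
  obtain y c where y: "y \<in> X" "parse (\<sigma>p n) y c x" using X_desubstitute_power[OF assms] by blast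
  obtain k where k: "c k \<le> 0" "0 < c (k + 1)" using parse_locate[OF y(2)] .
  obtain p u where pu: "occ y p u" "p \<le> k" "k < p + int (length u)" using occ_cover[OF y(1)] .
  have "c p \<le> c k" "c (k + 1) \<le> c (p + int (length u))"
    using parse_less_iff(2)[OF y(2)] pu by auto
  then have "0 \<le> - c p" "- c p < len n u" using k occ_end[OF y(2) pu(1)] by auto
  with in_towerI[OF y pu(1)] show ?thesis by blast
qed

text \<open>By recognizability the two parsings of \<open>x\<close> into blocks \<open>\<sigma>\<^sup>n(a)\<close> agree up to the index, and so both
  return words are the stretch between the two consecutive cuts around the block that covers
  coordinate \<open>0\<close>.\<close>

lemma in_tower_unique:
  assumes "in_tower n u j x" "0 \<le> j" "j < len n u" "in_tower n u' j' x" "0 \<le> j'" "j' < len n u'"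
  shows "u = u'" "j = j'"
proof -
  obtain y c where y: "y \<in> X" "parse (\<sigma>p n) y c x" "c 0 = - j" "occ y 0 u"
    using assms(1) by (auto simp: in_tower_def)
  obtain y' c' where y': "y' \<in> X" "parse (\<sigma>p n) y' c' x" "c' 0 = - j'" "occ y' 0 u'"
    using assms(4) by (auto simp: in_tower_def)
  obtain s where s: "\<forall>k. y' k = y (k + s) \<and> c' k = c (k + s)"
    using recognizable_power[OF y(1) y'(1) y(2) y'(2)] by blast
  then have "y' = (\<lambda>i. y (i + s))" by auto
  then have o: "occ y s u'" using y'(4) occ_translate[of y s 0 u'] by simp
  have cs: "c s = - j'" using s y'(3) by (metis add_0)
  have "c s < c (0 + int (length u))" "c 0 < c (s + int (length u'))"
    using occ_end[OF y(2) y(4)] occ_end[OF y(2) o] y(3) cs assms by auto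
  then have less: "s < int (length u)" "0 < s + int (length u')"
    using parse_less_iff(1)[OF y(2)] by auto
  note o0 = y(4)[unfolded occ_def] and os = o[unfolded occ_def]
  have s0: "s = 0" using o0 os less by (metis add_0 linorder_neqE_linordered_idom)
  have "length u = length u'"
    using o0 os unfolding s0 by (metis add_0 length_greater_0_conv linorder_neqE_nat of_nat_0_less_iff of_nat_less_iff)
  then show "u = u'" using o0 os s0 by metis
  show "j = j'" using cs y(3) s0 by simp
qed

lemma concat_\<tau>: "concat (\<tau> u) = ext \<sigma> u"
  by (simp add: \<tau>_cut_word concat_cut_word)

text \<open>The position of the entry with index \<open>i\<close> of \<open>\<tau> U\<close> when the block of \<open>U\<close> at level \<open>n + 1\<close> is divided
  into blocks of level \<open>n\<close>.\<close>

definition start :: "nat \<Rightarrow> 'a list \<Rightarrow> nat \<Rightarrow> int" where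
  "start n U i = len n (concat (take i (\<tau> U)))"

text \<open>Cuts are mapped to cuts, so that \<open>\<sigma>(U)\<close> again stands between two cuts and is divided by the cuts
  inside it into the entries of \<open>\<tau> U\<close>.\<close>

lemma in_tower_down:
  assumes "in_tower (Suc n) U j x" "i < length (\<tau> U)"
  shows "in_tower n (\<tau> U ! i) (j - start n U i) x"
proof -
  obtain y c where y: "y \<in> X" "parse (\<sigma>p (Suc n)) y c x" "c 0 = - j" "occ y 0 U"
    using assms(1) by (auto simp: in_tower_def)
  have ne: "\<forall>k. \<forall>b\<in>set (\<sigma> (y k)). \<sigma>p n b \<noteq> []" using \<sigma>p_ne by blast
  obtain d z e where f: "parse \<sigma> y d z" "parse (\<sigma>p n) z e x" "c = e \<circ> d" "d 0 = 0"
    using parse_factor[OF y(2)[unfolded subst_power_Suc'] \<sigma>_ne ne, where i = 0 and p = 0] by metis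
  have zX: "z \<in> X" by (rule X_image[OF y(1) f(1)])
  have U: "seg y 0 (length U) = U" "cut_at y 0" "cut_at y (0 + int (length U))" "U \<noteq> []"
    using y(4) by (auto simp: occ_def)
  have ends: "d (0 + int (length U)) = d 0 + int (length (ext \<sigma> U))" "seg z (d 0) (length (ext \<sigma> U)) = ext \<sigma> U"
    using parse_seg[OF f(1), of 0 "length U"] U(1) by auto
  define p where "p = length (concat (take i (\<tau> U)))"
  have "occ z (0 + int (length (concat (take i (cut_word Q (ext \<sigma> U)))))) (cut_word Q (ext \<sigma> U) ! i)"
  proof (rule occ_cut_word)
    show "ext \<sigma> U \<noteq> []" using U(4) \<sigma>_ne by (rule ext_nonempty)
    show "cut_at z 0" using cut_at_image[OF f(1) U(2)] f(4) by simp
    show "cut_at z (0 + int (length (ext \<sigma> U)))" using cut_at_image[OF f(1) U(3)] f(4) ends(1) by simp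
  qed (use ends f(4) assms(2) \<tau>_cut_word in auto)
  then have o: "occ z (int p) (\<tau> U ! i)" by (simp add: p_def \<tau>_cut_word)
  have "seg z 0 p = concat (take i (\<tau> U))"
  proof -
    have "ext \<sigma> U = concat (take i (\<tau> U)) @ concat (drop i (\<tau> U))"
      by (metis append_take_drop_id concat_append concat_\<tau>)
    moreover have "seg z 0 p = take p (seg z 0 (length (ext \<sigma> U)))"
    proof (rule nth_equalityI)
      have "p \<le> length (ext \<sigma> U)" using \<open>ext \<sigma> U = _\<close> by (simp add: p_def)
      then show "length (seg z 0 p) = length (take p (seg z 0 (length (ext \<sigma> U))))"
        "\<And>i. i < length (seg z 0 p) \<Longrightarrow> seg z 0 p ! i = take p (seg z 0 (length (ext \<sigma> U))) ! i"
        by simp_all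
    qed
    ultimately show ?thesis using ends(2) f(4) by (simp add: p_def)
  qed
  then have "e (int p) = e 0 + start n U i"
    using parse_seg(1)[OF f(2), of 0 p] by (simp add: start_def)
  moreover have "e 0 = - j" using f(3,4) y(3) by simp
  ultimately have "- e (int p) = j - start n U i" by simp
  with in_towerI[OF zX f(2) o] show ?thesis by simp
qed

lemma in_tower_next:
  assumes "in_tower n u j x" shows "\<exists>u'. in_tower n u' (j - len n u) x"
proof -
  obtain y c where y: "y \<in> X" "parse (\<sigma>p n) y c x" "c 0 = - j" "occ y 0 u"
    using assms by (auto simp: in_tower_def)
  obtain u' where u': "occ y (0 + int (length u)) u'"
    using occ_next[OF y(1)] y(4) unfolding occ_def by metis
  from in_towerI[OF y(1,2) u'] occ_end[OF y(2,4)] y(3) show ?thesis by auto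
qed

lemma in_tower_prev:
  assumes "in_tower n u j x" shows "\<exists>u'. in_tower n u' (j + len n u') x"
proof -
  obtain y c where y: "y \<in> X" "parse (\<sigma>p n) y c x" "c 0 = - j" "occ y 0 u"
    using assms by (auto simp: in_tower_def)
  obtain u' where u': "occ y (0 - int (length u')) u'"
    using occ_prev[OF y(1)] y(4) unfolding occ_def by metis
  have "c 0 = c (0 - int (length u')) + len n u'" using occ_end[OF y(2) u'] by simp
  then have e: "- c (0 - int (length u')) = j + len n u'" using y(3) by linarith
  from in_towerI[OF y(1,2) u'] show ?thesis unfolding e by blast
qed

lemma in_tower_translate: "in_tower n u j x \<Longrightarrow> in_tower n u (j + s) (\<lambda>p. x (p + s))"
  unfolding in_tower_def using parse_translate[of "\<sigma>p n" _ _ x s] by force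

text \<open>Blocks between two cuts are recognized on a finite window, and images of closed sets are closed.\<close>

lemma in_tower_closed: "closedin full_shift {x. in_tower n u j x}"
proof -
  have "closedin full_shift {y. occ y 0 u}"
  proof (rule full_shift_closedI)
    fix x assume "\<And>N. \<exists>s\<in>{y. occ y 0 u}. agree N s x"
    then obtain s where s: "occ s 0 u" "agree (int (length u) + 1) s x" by blast
    have sx: "s p = x p" if "\<bar>p\<bar> \<le> int (length u) + 1" for p using s(2) that by (simp add: agree_def)
    have "seg s 0 (length u) = seg x 0 (length u)" using sx by (auto simp: seg_def)
    moreover have "cut_at s p = cut_at x p" if "0 \<le> p" "p \<le> int (length u)" for p
      using sx[of p] sx[of "p - 1"] that by (simp add: cut_at_def)
    ultimately show "x \<in> {y. occ y 0 u}" using s(1) by (auto simp: occ_def)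
  qed
  then have "closedin full_shift (X \<inter> {y. occ y 0 u})" using X_closed by blast
  then have "closedin full_shift {x. \<exists>y\<in>X \<inter> {y. occ y 0 u}. \<exists>c. parse (\<sigma>p n) y c x \<and> c 0 = - j}"
    by (rule closedin_image_full_shift[OF \<sigma>p_ne])
  moreover have "{x. \<exists>y\<in>X \<inter> {y. occ y 0 u}. \<exists>c. parse (\<sigma>p n) y c x \<and> c 0 = - j} = {x. in_tower n u j x}"
    by (auto simp: in_tower_def)
  ultimately show ?thesis by simp
qed

text \<open>The return word \<open>u\<close> starts with \<open>l\<^sub>i\<close> and ends with \<open>r\<^sub>j\<close>, and this determines the letters \<open>r\<^sub>i\<close> before
  and \<open>l\<^sub>j\<close> after it. The blocks of these two letters at level \<open>n\<close> extend the agreement by more than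
  \<open>N\<close> on both sides.\<close>

lemma in_tower_agree:
  "\<exists>n. \<forall>u j x x'. in_tower n u j x \<longrightarrow> in_tower n u j x' \<longrightarrow> 0 \<le> j \<longrightarrow> j < len n u \<longrightarrow> agree (int N) x x'"
proof -
  have "\<exists>n0. \<forall>n\<ge>n0. N < length (\<sigma>p n (w k p))" if "k \<in> {1..m}" for k p
    using growth[OF that w_in[OF that], of "Suc N" p] by (auto simp: Suc_le_eq)
  then obtain f where f: "\<And>k p n. k \<in> {1..m} \<Longrightarrow> f k p \<le> n \<Longrightarrow> N < length (\<sigma>p n (w k p))"
    by metis
  \<comment> \<open>a level at which the blocks of all \<open>r\<^sub>k\<close> and \<open>l\<^sub>k\<close> are longer than \<open>N\<close>\<close>
  define n where "n = (\<Sum>k\<in>{1..m}. f k (-1) + f k 0)"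
  have fn: "f k (-1) + f k 0 \<le> n" if "k \<in> {1..m}" for k
    unfolding n_def by (rule member_le_sum[OF that]) auto
  have Nlen: "N < length (\<sigma>p n a)" "N < length (\<sigma>p n b)" if "Q a b" for a b
    using that f fn by (force simp: Q_def)+
  show ?thesis
  proof (intro exI[of _ n] allI impI)
    fix u j x x' assume L: "in_tower n u j x" "in_tower n u j x'" "0 \<le> j" "j < len n u"
    obtain y c where y: "y \<in> X" "parse (\<sigma>p n) y c x" "c 0 = - j" "occ y 0 u"
      using L(1) by (auto simp: in_tower_def)
    obtain y' c' where y': "y' \<in> X" "parse (\<sigma>p n) y' c' x'" "c' 0 = - j" "occ y' 0 u"
      using L(2) by (auto simp: in_tower_def)
    have Qs: "Q (y (-1)) (y 0)" "Q (y' (-1)) (y' 0)"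
        "Q (y (int (length u) - 1)) (y (int (length u)))" "Q (y' (int (length u) - 1)) (y' (int (length u)))"
      using y(4) y'(4) by (auto simp: occ_def cut_at_def)
    have ends: "y (-1) = y' (-1)" "y (int (length u)) = y' (int (length u))"
      using Qs occ_hd_last[OF y(4)] occ_hd_last[OF y'(4)] Q_deterministic by auto
    have su: "seg y 0 (length u) = u" "seg y' 0 (length u) = u" using y(4) y'(4) by (auto simp: occ_def)
    define l r where "l = y (-1)" and "r = y (int (length u))"
    define W where "W = l # u @ [r]"
    have "seg y (-1) (1 + (length u + 1)) = W" "seg y' (-1) (1 + (length u + 1)) = W"
      unfolding seg_add using su ends by (auto simp: W_def seg_def l_def r_def)
    then have W: "seg y (-1) (length W) = W" "seg y' (-1) (length W) = W" by (auto simp: W_def)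
    have c: "c (-1) = - j - int (length (\<sigma>p n l))" "c' (-1) = c (-1)"
      using parseD(2)[OF y(2), of "-1"] parseD(2)[OF y'(2), of "-1"] y(3) y'(3) ends by (auto simp: l_def)
    have eq: "seg x (c (-1)) (length (ext (\<sigma>p n) W)) = seg x' (c (-1)) (length (ext (\<sigma>p n) W))"
      using parse_seg(2)[OF y(2), of "-1" "length W"] parse_seg(2)[OF y'(2), of "-1" "length W"] W c(2) by simp
    have N: "N < length (\<sigma>p n l)" "N < length (\<sigma>p n r)" using Qs Nlen by (auto simp: l_def r_def)
    show "agree (int N) x x'"
      unfolding agree_def
    proof (intro allI impI)
      fix p :: int assume p: "\<bar>p\<bar> \<le> int N"
      define i where "i = nat (p - c (-1))"
      have i: "p = c (-1) + int i" using p N(1) c(1) L(3) by (auto simp: i_def)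
      have "len n W = int (length (\<sigma>p n l)) + len n u + int (length (\<sigma>p n r))" by (simp add: W_def)
      then have "i < length (ext (\<sigma>p n) W)" using p N(2) c(1) L(4) i by linarith
      then show "x p = x' p" using arg_cong[OF eq, of "\<lambda>l. l ! i"] i by simp
    qed
  qed
qed

end

section \<open>Addresses\<close>

context return_word_system
begin

definition address :: "nat \<Rightarrow> (int \<Rightarrow> 'a) \<Rightarrow> 'a list \<times> int" where
  "address n x = (SOME (u, j). in_tower n u j x \<and> 0 \<le> j \<and> j < len n u)"

abbreviation U where "U n x \<equiv> fst (address n x)"
abbreviation J where "J n x \<equiv> snd (address n x)"

lemma address: "x \<in> X \<Longrightarrow> in_tower n (U n x) (J n x) x" "x \<in> X \<Longrightarrow> 0 \<le> J n x" "x \<in> X \<Longrightarrow> J n x < len n (U n x)"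
proof -
  assume x: "x \<in> X"
  have "case address n x of (u, j) \<Rightarrow> in_tower n u j x \<and> 0 \<le> j \<and> j < len n u"
    unfolding address_def
    by (rule someI_ex[of "\<lambda>(u, j). in_tower n u j x \<and> 0 \<le> j \<and> j < len n u"]) (use in_tower_exists[OF x, of n] in auto)
  then show "in_tower n (U n x) (J n x) x" "0 \<le> J n x" "J n x < len n (U n x)" by (auto simp: case_prod_beta)
qed

lemma address_eq:
  assumes "in_tower n u j x" "0 \<le> j" "j < len n u" shows "U n x = u" "J n x = j"
  using in_tower_unique[OF address[OF in_tower_in_X[OF assms(1)]] assms] by auto

lemma U_return_word: "x \<in> X \<Longrightarrow> U n x \<in> R"
  using address(1) in_tower_return_word by blast

lemma \<tau>_return_word:
  assumes "u \<in> R" "i < length (\<tau> u)" shows "\<tau> u ! i \<in> R"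
proof -
  obtain x where "in_tower (Suc 0) u 0 x" using in_tower_nonempty[OF assms(1)] by blast
  from in_tower_return_word[OF in_tower_down[OF this assms(2)]] show ?thesis .
qed

lemma start_0 [simp]: "start n u 0 = 0"
  by (simp add: start_def)

lemma start_Suc: "i < length (\<tau> u) \<Longrightarrow> start n u (Suc i) = start n u i + len n (\<tau> u ! i)"
  by (simp add: start_def take_Suc_conv_app_nth)

lemma start_length: "start n u (length (\<tau> u)) = len (Suc n) u"
  by (simp add: start_def concat_\<tau> ext_ext subst_power_Suc')

lemma start_mono: "i \<le> k \<Longrightarrow> k \<le> length (\<tau> u) \<Longrightarrow> start n u i \<le> start n u k"
proof (induction k rule: dec_induct)
  case (step k) then show ?case using start_Suc[of k u n] by simp
qed simp

lemma start_less:
  assumes "u \<in> R" "i < k" "k \<le> length (\<tau> u)" shows "start n u i < start n u k"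
proof -
  have "0 < len n (\<tau> u ! i)"
    using assms by (intro len_pos return_word_nonempty \<tau>_return_word) auto
  then have "start n u i < start n u (Suc i)" using assms by (simp add: start_Suc)
  also have "\<dots> \<le> start n u k" by (rule start_mono) (use assms in auto)
  finally show ?thesis .
qed

text \<open>The index of the edge that the path takes into the vertex \<open>u\<close> of level \<open>n + 1\<close> when the origin has
  position \<open>j\<close> in the block. Into the vertices of the first level there is one edge for each letter of \<open>u\<close>;
  at the later levels there is one edge for each entry of \<open>\<tau> u\<close>.\<close>

fun idx :: "nat \<Rightarrow> 'a list \<Rightarrow> int \<Rightarrow> nat" where
  "idx 0 u j = nat j"
| "idx (Suc n) u j = (LEAST i. j < start n u (Suc i))"

lemma idx_Suc_eq:
  assumes "i < length (\<tau> u)" "start n u i \<le> j" "j < start n u (Suc i)"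
  shows "idx (Suc n) u j = i"
  unfolding idx.simps
proof (rule Least_equality)
  fix k assume k: "j < start n u (Suc k)"
  show "i \<le> k"
  proof (rule ccontr)
    assume "\<not> i \<le> k"
    then have "start n u (Suc k) \<le> start n u i" using assms(1) by (intro start_mono) auto
    with k assms(2) show False by simp
  qed
qed (rule assms(3))

lemma idx_Suc_exists:
  assumes "0 \<le> j" "j < len (Suc n) u"
  shows "\<exists>i<length (\<tau> u). start n u i \<le> j \<and> j < start n u (Suc i)"
proof -
  have ex: "j < start n u (length (\<tau> u))" using assms(2) by (simp add: start_length)
  define k where "k = (LEAST k. j < start n u k)"
  have k: "j < start n u k" unfolding k_def by (rule LeastI[where P = "\<lambda>k. j < start n u k", OF ex])
  have kl: "k \<le> length (\<tau> u)" unfolding k_def by (rule Least_le[where P = "\<lambda>k. j < start n u k", OF ex])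
  obtain i where i: "k = Suc i" using k assms(1) by (cases k) auto
  have "\<not> j < start n u i" using not_less_Least[of i "\<lambda>k. j < start n u k"] i unfolding k_def by simp
  then show ?thesis using k kl i by (intro exI[of _ i]) auto
qed

abbreviation K where "K n x \<equiv> idx n (U n x) (J n x)"

text \<open>The number of edges into the vertex \<open>u\<close> of level \<open>n + 1\<close>.\<close>

primrec num_pieces :: "nat \<Rightarrow> 'a list \<Rightarrow> nat" where
  "num_pieces 0 u = length u"
| "num_pieces (Suc n) u = length (\<tau> u)"

lemma len_0 [simp]: "ext (\<sigma>p 0) u = u"
  by (induction u) auto

lemma K_Suc:
  assumes "x \<in> X"
  shows "K (Suc n) x < length (\<tau> (U (Suc n) x))"
    and "U n x = \<tau> (U (Suc n) x) ! K (Suc n) x"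
    and "J (Suc n) x = J n x + start n (U (Suc n) x) (K (Suc n) x)"
proof -
  note a = address[OF assms, of "Suc n"]
  obtain i where i: "i < length (\<tau> (U (Suc n) x))" "start n (U (Suc n) x) i \<le> J (Suc n) x"
      "J (Suc n) x < start n (U (Suc n) x) (Suc i)"
    using idx_Suc_exists[OF a(2,3)] by blast
  have k: "K (Suc n) x = i" by (rule idx_Suc_eq[OF i])
  have "U n x = \<tau> (U (Suc n) x) ! i" "J n x = J (Suc n) x - start n (U (Suc n) x) i"
    by (rule address_eq[OF in_tower_down[OF a(1) i(1)]]; use i start_Suc[OF i(1), of n] in simp)+
  then show "K (Suc n) x < length (\<tau> (U (Suc n) x))" "U n x = \<tau> (U (Suc n) x) ! K (Suc n) x"
    "J (Suc n) x = J n x + start n (U (Suc n) x) (K (Suc n) x)"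
    unfolding k using i(1) by simp_all
qed

lemma K_0: "x \<in> X \<Longrightarrow> int (K 0 x) = J 0 x"
  using address(2) by simp

lemma K_less: "x \<in> X \<Longrightarrow> K n x < num_pieces n (U n x)"
proof (cases n)
  case 0
  assume "x \<in> X"
  then show ?thesis using address(2,3)[of x 0] 0 by (simp add: nat_less_iff)
qed (use K_Suc(1) in auto)

declare idx.simps [simp del]

lemma start_Suc_K:
  assumes "x \<in> X"
  shows "start n (U (Suc n) x) (Suc (K (Suc n) x)) = start n (U (Suc n) x) (K (Suc n) x) + len n (U n x)"
  using start_Suc[OF K_Suc(1)[OF assms]] K_Suc(2)[OF assms] by metis

lemma J_last_if_max:
  assumes "x \<in> X" "\<forall>i\<le>n. Suc (K i x) = num_pieces i (U i x)"
  shows "J n x = len n (U n x) - 1"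
  using assms(2)
proof (induction n)
  case 0
  then have "int (Suc (K 0 x)) = int (length (U 0 x))" by simp
  then show ?case using K_0[OF assms(1)] by simp
next
  case (Suc n)
  then have "J n x = len n (U n x) - 1" by simp
  moreover have "start n (U (Suc n) x) (Suc (K (Suc n) x)) = len (Suc n) (U (Suc n) x)"
    using Suc(2) start_length by simp
  ultimately show ?case using K_Suc(3)[OF assms(1), of n] start_Suc_K[OF assms(1), of n]
    by simp
qed

lemma J_not_last:
  assumes "x \<in> X" "Suc (K k x) < num_pieces k (U k x)" "k \<le> n"
  shows "J n x + 1 < len n (U n x)"
  using assms(3)
proof (induction n rule: dec_induct)
  case base
  show ?case
  proof (cases k)
    case 0
    then have "int (Suc (K 0 x)) < int (length (U 0 x))" using assms(2) by simp
    then show ?thesis using K_0[OF assms(1)] 0 by simp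
  next
    case (Suc i)
    have "J k x < start i (U k x) (Suc (K k x))"
      using K_Suc(3)[OF assms(1), of i] start_Suc_K[OF assms(1), of i] address(3)[OF assms(1), of i] Suc
      by simp
    moreover have "start i (U k x) (Suc (K k x)) < start i (U k x) (length (\<tau> (U k x)))"
      using assms(2) Suc U_return_word[OF assms(1)] by (intro start_less) auto
    ultimately show ?thesis using start_length[of i "U k x"] Suc by simp
  qed
next
  case (step n)
  have "J (Suc n) x + 1 < start n (U (Suc n) x) (Suc (K (Suc n) x))"
    using K_Suc(3)[OF assms(1), of n] start_Suc_K[OF assms(1), of n] step by simp
  also have "\<dots> \<le> start n (U (Suc n) x) (length (\<tau> (U (Suc n) x)))"
    by (rule start_mono) (use K_Suc(1)[OF assms(1), of n] in auto)
  finally show ?case by (simp add: start_length)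
qed

lemma max_iff_J_last:
  assumes "x \<in> X"
  shows "(\<forall>n. Suc (K n x) = num_pieces n (U n x)) \<longleftrightarrow> (\<forall>n. J n x = len n (U n x) - 1)"
proof
  assume "\<forall>n. Suc (K n x) = num_pieces n (U n x)"
  then show "\<forall>n. J n x = len n (U n x) - 1" using J_last_if_max[OF assms] by blast
next
  assume *: "\<forall>n. J n x = len n (U n x) - 1"
  show "\<forall>n. Suc (K n x) = num_pieces n (U n x)"
  proof (rule allI, rule ccontr)
    fix n assume "Suc (K n x) \<noteq> num_pieces n (U n x)"
    then have "Suc (K n x) < num_pieces n (U n x)" using K_less[OF assms, of n] by linarith
    from J_not_last[OF assms this order_refl] * show False by simp
  qed
qed

text \<open>If the origin starts a block of level \<open>n\<close>, it also starts blocks of all lower levels.\<close>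

lemma K_zero_if_J_zero:
  assumes "x \<in> X" "J n x = 0" "i \<le> n" shows "K i x = 0 \<and> J i x = 0"
  using assms(2,3)
proof (induction n)
  case 0 then show ?case by (simp add: idx.simps)
next
  case (Suc n)
  have nonneg: "0 \<le> start n (U (Suc n) x) (K (Suc n) x)" by (simp add: start_def)
  then have J: "J n x = 0" and s: "start n (U (Suc n) x) (K (Suc n) x) = 0"
    using Suc(2) K_Suc(3)[OF assms(1), of n] address(2)[OF assms(1), of n] by linarith+
  have "K (Suc n) x = 0"
  proof (rule ccontr)
    assume "K (Suc n) x \<noteq> 0"
    then have "start n (U (Suc n) x) 0 < start n (U (Suc n) x) (K (Suc n) x)"
      using K_Suc(1)[OF assms(1), of n] U_return_word[OF assms(1)] by (intro start_less) auto
    with s show False by simp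
  qed
  then show ?case using Suc J by (cases "i = Suc n") auto
qed

lemma min_iff_J_zero:
  assumes "x \<in> X" shows "(\<forall>n. K n x = 0) \<longleftrightarrow> (\<forall>n. J n x = 0)"
proof
  assume K: "\<forall>n. K n x = 0"
  have "J n x = 0" for n
  proof (induction n)
    case 0 then show ?case using K_0[OF assms] K by (metis of_nat_0)
  next
    case (Suc n) then show ?case using K_Suc(3)[OF assms, of n] K by (metis add_0 start_0)
  qed
  then show "\<forall>n. J n x = 0" ..
qed (use K_zero_if_J_zero[OF assms] in blast)

lemma shift_eq: "shift x = (\<lambda>p. x (p + 1))"
  by (simp add: shift_def)

lemma shift_in_X: "x \<in> X \<Longrightarrow> shift x \<in> X"
  unfolding shift_eq by (rule X_translate)

text \<open>If the origin is the last coordinate of its block, the shift moves it to the start of the next one.\<close>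

lemma J_shift_max:
  assumes "x \<in> X" "J n x = len n (U n x) - 1" shows "J n (shift x) = 0"
proof -
  have "in_tower n (U n x) (J n x + 1) (shift x)"
    unfolding shift_eq by (rule in_tower_translate[OF address(1)[OF assms(1)]])
  then obtain u where u: "in_tower n u 0 (shift x)" using in_tower_next[of n "U n x"] assms(2) by fastforce
  show ?thesis
    by (rule address_eq(2)[OF u]) (use len_pos[OF return_word_nonempty[OF in_tower_return_word[OF u]]] in auto)
qed

text \<open>The converse step: the coordinate before the start of a block is the last one of the block before.\<close>

lemma J_unshift_min:
  assumes "shift x \<in> X" "x \<in> X" "J n (shift x) = 0" shows "J n x = len n (U n x) - 1"
proof -
  obtain u where "in_tower n u (0 + len n u) (shift x)"
    using in_tower_prev[of n "U n (shift x)" 0 "shift x"] address(1)[OF assms(1), of n] assms(3) by auto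
  from in_tower_translate[OF this, of "-1"] have u: "in_tower n u (len n u - 1) x" by (simp add: shift_eq)
  have "U n x = u" "J n x = len n u - 1"
    by (rule address_eq[OF u]; use len_pos[OF return_word_nonempty[OF in_tower_return_word[OF u]], of n] in simp)+
  then show ?thesis by simp
qed

text \<open>The shift moves the origin one step further in the blocks of levels \<open>k\<close> and above. At level \<open>k\<close> this
  is a passage to the next edge, because the blocks below end here; at the lower levels new blocks
  start.\<close>

lemma shift_not_max:
  assumes x: "x \<in> X" and k: "Suc (K k x) < num_pieces k (U k x)"
    and max: "\<forall>i<k. Suc (K i x) = num_pieces i (U i x)"
  shows "\<And>i. i \<ge> k \<Longrightarrow> U i (shift x) = U i x"
    and "\<And>i. i > k \<Longrightarrow> K i (shift x) = K i x"
    and "K k (shift x) = Suc (K k x)"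
    and "\<And>i. i < k \<Longrightarrow> K i (shift x) = 0"
proof -
  note y = shift_in_X[OF x]
  have UJ: "U i (shift x) = U i x" "J i (shift x) = J i x + 1" if "i \<ge> k" for i
  proof -
    have l: "in_tower i (U i x) (J i x + 1) (shift x)"
      unfolding shift_eq by (rule in_tower_translate[OF address(1)[OF x]])
    have b: "0 \<le> J i x + 1" "J i x + 1 < len i (U i x)"
      using address(2)[OF x, of i] J_not_last[OF x k that] by auto
    show "U i (shift x) = U i x" "J i (shift x) = J i x + 1" using address_eq[OF l b] .
  qed
  then show "\<And>i. i \<ge> k \<Longrightarrow> U i (shift x) = U i x" by blast
  show "K i (shift x) = K i x" if ik: "i > k" for i
  proof -
    obtain n where n: "i = Suc n" "n \<ge> k" using ik by (cases i) auto
    have "idx (Suc n) (U (Suc n) x) (J (Suc n) x + 1) = K (Suc n) x"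
      by (rule idx_Suc_eq[OF K_Suc(1)[OF x]])
         (use K_Suc(3)[OF x, of n] start_Suc_K[OF x, of n] J_not_last[OF x k n(2)] address(2)[OF x, of n]
           in auto)
    then show ?thesis using UJ[of i] ik n(1) by simp
  qed
  show Kk: "K k (shift x) = Suc (K k x)"
  proof (cases k)
    case 0
    then show ?thesis using UJ[of k] address(2)[OF x, of 0] by (simp add: idx.simps)
  next
    case (Suc n)
    have Jn: "J n x = len n (U n x) - 1" by (rule J_last_if_max[OF x]) (use max Suc in auto)
    have J: "J k x + 1 = start n (U k x) (Suc (K k x))"
      using K_Suc(3)[OF x, of n] start_Suc_K[OF x, of n] Jn Suc by simp
    have l: "Suc (K k x) < length (\<tau> (U k x))" using k Suc by simp
    have "start n (U k x) (Suc (K k x)) < start n (U k x) (Suc (Suc (K k x)))"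
      using l U_return_word[OF x] by (intro start_less) auto
    then have "idx (Suc n) (U k x) (J k x + 1) = Suc (K k x)"
      by (intro idx_Suc_eq[OF l]) (simp_all add: J)
    then show ?thesis using UJ[of k] Suc by simp
  qed
  show "K i (shift x) = 0" if ik: "i < k" for i
  proof -
    obtain n where n: "k = Suc n" "i \<le> n" using ik by (cases k) auto
    have Jn: "J n x = len n (U n x) - 1" by (rule J_last_if_max[OF x]) (use max n in auto)
    have J: "J k x + 1 = start n (U k x) (Suc (K k x))"
      using K_Suc(3)[OF x, of n] start_Suc_K[OF x, of n] Jn n(1) by simp
    have "J k (shift x) = J n (shift x) + start n (U k x) (Suc (K k x))"
      using K_Suc(3)[OF y, of n] UJ(1)[of k] Kk n(1) by simp
    then have "J n (shift x) = 0" using UJ(2)[of k] J by simp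
    then show ?thesis using K_zero_if_J_zero[OF y _ n(2)] by blast
  qed
qed

end

section \<open>Paths of the diagram\<close>

lemma sorted_list_of_finite_order:
  assumes "finite S" and refl: "\<And>x. x \<in> S \<Longrightarrow> (x, x) \<in> r"
    and total: "\<And>x y. x \<in> S \<Longrightarrow> y \<in> S \<Longrightarrow> (x, y) \<in> r \<or> (y, x) \<in> r"
    and trans: "trans r"
  shows "\<exists>es. distinct es \<and> set es = S \<and> sorted_wrt (\<lambda>e f. (e, f) \<in> r) es"
  using assms(1-3)
proof (induction "card S" arbitrary: S)
  case 0
  then show ?case by (intro exI[of _ "[]"]) auto
next
  case (Suc n)
  have "\<exists>e\<in>S. \<forall>x\<in>S. (e, x) \<in> r"
  proof -
    have "S \<noteq> {}" using Suc(2) by auto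
    with Suc(3) have "\<lbrakk>\<And>x. x \<in> S \<Longrightarrow> (x, x) \<in> r; \<And>x y. x \<in> S \<Longrightarrow> y \<in> S \<Longrightarrow> (x, y) \<in> r \<or> (y, x) \<in> r\<rbrakk>
        \<Longrightarrow> \<exists>e\<in>S. \<forall>x\<in>S. (e, x) \<in> r"
    proof (induction S rule: finite_ne_induct)
      case (insert a F)
      then obtain e where e: "e \<in> F" "\<forall>x\<in>F. (e, x) \<in> r" by auto
      have "(a, e) \<in> r \<or> (e, a) \<in> r" "(a, a) \<in> r" using insert.prems e(1) by auto
      then show ?case using e trans by (auto dest: transD)
    qed auto
    then show ?thesis using Suc.prems by blast
  qed
  then obtain e where e: "e \<in> S" "\<forall>x\<in>S. (e, x) \<in> r" by blast
  obtain es where es: "distinct es" "set es = S - {e}" "sorted_wrt (\<lambda>e f. (e, f) \<in> r) es"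
  proof -
    have "n = card (S - {e})" using Suc(2) e(1) by (metis card_Diff_singleton diff_Suc_1)
    from Suc(1)[OF this] Suc.prems show thesis using that by auto
  qed
  then show ?case using e by (intro exI[of _ "e # es"]) auto
qed

lemma sorted_list_unique:
  assumes "antisym r"
  shows "distinct es \<Longrightarrow> distinct fs \<Longrightarrow> set es = set fs \<Longrightarrow>
    sorted_wrt (\<lambda>e f. (e, f) \<in> r) es \<Longrightarrow> sorted_wrt (\<lambda>e f. (e, f) \<in> r) fs \<Longrightarrow> es = fs"
proof (induction es arbitrary: fs)
  case (Cons e es)
  then obtain f fs' where fs: "fs = f # fs'" by (cases fs) auto
  have "e = f"
  proof (rule ccontr)
    assume "e \<noteq> f"
    then have "f \<in> set es" "e \<in> set fs'" using Cons.prems(3) fs by auto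
    then have "(e, f) \<in> r" "(f, e) \<in> r" using Cons.prems(4,5) fs by auto
    with antisymD[OF assms] \<open>e \<noteq> f\<close> show False by blast
  qed
  moreover have "es = fs'" using Cons.prems fs \<open>e = f\<close> by (intro Cons.IH) auto
  ultimately show ?case using fs by simp
qed simp

lemma homeomorphic_map_shift:
  assumes "compact_space (subst_topology \<sigma>)" "Hausdorff_space (subst_topology \<sigma>)"
    and "\<And>x s. x \<in> subst_space \<sigma> \<Longrightarrow> (\<lambda>p. x (p + s)) \<in> subst_space \<sigma>"
  shows "homeomorphic_map (subst_topology \<sigma>) (subst_topology \<sigma>) shift"
proof (rule continuous_imp_homeomorphic_map[OF _ assms(1,2)])
  have top: "topspace (subst_topology \<sigma>) = subst_space \<sigma>" by (simp add: subst_topology_def)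
  have "continuous_map full_shift full_shift (shift :: (int \<Rightarrow> 'a) \<Rightarrow> _)"
  proof (rule continuous_map_full_shiftI)
    fix x :: "int \<Rightarrow> 'a" and p
    show "\<exists>N. \<forall>z. agree N x z \<longrightarrow> shift z p = shift x p"
      by (intro exI[of _ "\<bar>p + 1\<bar>"]) (auto simp: agree_def shift_def)
  qed
  then show "continuous_map (subst_topology \<sigma>) (subst_topology \<sigma>) shift"
    unfolding subst_topology_def using assms(3)[where s = 1]
    by (intro continuous_map_into_subtopology continuous_map_from_subtopology)
       (auto simp: shift_def)
  show "shift ` topspace (subst_topology \<sigma>) = topspace (subst_topology \<sigma>)"
  proof (safe; unfold top)
    fix x assume "x \<in> subst_space \<sigma>"
    then show "shift x \<in> subst_space \<sigma>" using assms(3)[of x 1] by (simp add: shift_def)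
    have "shift (\<lambda>p. x (p + (- 1))) = x" by (simp add: shift_def)
    then show "x \<in> shift ` subst_space \<sigma>" using assms(3)[OF \<open>x \<in> subst_space \<sigma>\<close>, of "- 1"] by (metis imageI)
  qed
  show "inj_on shift (topspace (subst_topology \<sigma>))"
  proof (rule inj_onI)
    fix x y :: "int \<Rightarrow> 'a" assume "shift x = shift y"
    then have "x (p - 1 + 1) = y (p - 1 + 1)" for p unfolding shift_def by metis
    then show "x = y" by auto
  qed
qed

text \<open>Two paths with different edges at some level lie in disjoint cylinders.\<close>

lemma Hausdorff_path_topology:
  "Hausdorff_space (path_topology B)" and topspace_path_topology: "topspace (path_topology B) = paths B"
proof -
  have cyl: "openin (path_topology B) (cylinder B n q)" if "q \<in> paths B" for n q
    unfolding path_topology_def by (rule topology_generated_by_Basis) (use that in blast)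
  have "q \<in> cylinder B 0 q" if "q \<in> paths B" for q using that by (auto simp: cylinder_def)
  then show top: "topspace (path_topology B) = paths B"
    unfolding path_topology_def topology_generated_by_topspace by (auto simp: cylinder_def)
  show "Hausdorff_space (path_topology B)"
    unfolding Hausdorff_space_def top
  proof (intro allI impI, elim conjE)
    fix q q' assume q: "q \<in> paths B" "q' \<in> paths B" "q \<noteq> q'"
    then obtain n where n: "q n \<noteq> q' n" by auto
    have "disjnt (cylinder B (Suc n) q) (cylinder B (Suc n) q')"
      using n by (auto simp: cylinder_def disjnt_iff)
    moreover have "q \<in> cylinder B (Suc n) q" "q' \<in> cylinder B (Suc n) q'" using q by (auto simp: cylinder_def)
    ultimately show "\<exists>V W. openin (path_topology B) V \<and> openin (path_topology B) W \<and> q \<in> V \<and> q' \<in> W \<and> disjnt V W"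
      using cyl q by blast
  qed
qed

locale return_word_diagram = return_word_system \<sigma> m P w
  for \<sigma> :: "'a::finite \<Rightarrow> 'a list" and m P w +
  fixes B :: "('v, 'e) bratteli" and L :: "nat \<Rightarrow> 'a list \<Rightarrow> 'v" and v0 :: 'v
  assumes ordered: "ordered_bratteli_diagram B"
    and stationary: "stationary_ordered B (return_words \<sigma> m w) L"
    and read: "\<forall>u\<in>return_words \<sigma> m w.
           substitution_read B (return_words \<sigma> m w) L u = derivative_subst \<sigma> m w u"
    and top_vertex: "verts B 0 = {v0}"
    and top_edges: "\<forall>u\<in>return_words \<sigma> m w. num_edges B v0 (L 1 u) = length u"
begin

lemma diagram: "bratteli_diagram B"
  using ordered by (simp add: ordered_bratteli_diagram_def)

lemma L_bij: "bij_betw (L (Suc n)) R (verts B (Suc n))"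
  using stationary by (simp add: stationary_ordered_def)

lemma finite_R: "finite R"
  using L_bij[of 0] diagram bij_betw_finite by (auto simp: bratteli_diagram_def)

lemma L_in: "u \<in> R \<Longrightarrow> L (Suc n) u \<in> verts B (Suc n)"
  using bij_betwE[OF L_bij[of n]] by blast

lemma L_inj: "u \<in> R \<Longrightarrow> u' \<in> R \<Longrightarrow> L (Suc n) u = L (Suc n) u' \<Longrightarrow> u = u'"
  using bij_betw_imp_inj_on[OF L_bij] by (auto dest: inj_onD)

lemma edges_into:
  assumes "v \<in> verts B (Suc n)"
  shows "{e \<in> all_edges B. rng B e = v} = {e \<in> edges B n. rng B e = v}"
proof -
  have "k = n" if "e \<in> edges B k" "rng B e = v" for e k
  proof -
    have "rng B ` edges B k = verts B (Suc k)" using diagram by (simp add: bratteli_diagram_def)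
    then have "v \<in> verts B (Suc k)" using that by blast
    moreover have "disjoint_family (verts B)" using diagram by (simp add: bratteli_diagram_def)
    ultimately have "Suc k = Suc n" using assms unfolding disjoint_family_on_def by blast
    then show ?thesis by simp
  qed
  then show ?thesis by (auto simp: all_edges_def)
qed

text \<open>Level \<open>n + 1\<close> carries the vertices \<open>L (Suc n) u\<close>, and \<open>edges B n\<close> are the edges that end there.\<close>

abbreviation into :: "nat \<Rightarrow> 'a list \<Rightarrow> 'e list" where
  "into n u \<equiv> in_edges B (L (Suc n) u)"

lemma edge_order:
  "trans (edge_le B)" "antisym (edge_le B)" "e \<in> all_edges B \<Longrightarrow> (e, e) \<in> edge_le B"
  "e \<in> all_edges B \<Longrightarrow> f \<in> all_edges B \<Longrightarrow> rng B e = rng B f \<Longrightarrow> (e, f) \<in> edge_le B \<or> (f, e) \<in> edge_le B"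
  using ordered unfolding ordered_bratteli_diagram_def partial_order_on_def preorder_on_def refl_on_def by blast+

lemma into:
  assumes "u \<in> R"
  shows "distinct (into n u)" "set (into n u) = {e \<in> edges B n. rng B e = L (Suc n) u}"
    "sorted_wrt (\<lambda>e f. (e, f) \<in> edge_le B) (into n u)"
proof -
  define S where "S = {e \<in> all_edges B. rng B e = L (Suc n) u}"
  have S: "S = {e \<in> edges B n. rng B e = L (Suc n) u}"
    unfolding S_def by (rule edges_into[OF L_in[OF assms]])
  have "finite S" using diagram unfolding S bratteli_diagram_def by simp
  then have "\<exists>es. distinct es \<and> set es = S \<and> sorted_wrt (\<lambda>e f. (e, f) \<in> edge_le B) es"
    by (rule sorted_list_of_finite_order) (use edge_order in \<open>auto simp: S_def\<close>)
  moreover have "es = fs" if "distinct es \<and> set es = S \<and> sorted_wrt (\<lambda>e f. (e, f) \<in> edge_le B) es"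
    "distinct fs \<and> set fs = S \<and> sorted_wrt (\<lambda>e f. (e, f) \<in> edge_le B) fs" for es fs
    by (rule sorted_list_unique[OF edge_order(2)]) (use that in auto)
  ultimately have ex1: "\<exists>!es. distinct es \<and> set es = S \<and> sorted_wrt (\<lambda>e f. (e, f) \<in> edge_le B) es"
    by (rule ex_ex1I)
  have "distinct (into n u) \<and> set (into n u) = S \<and> sorted_wrt (\<lambda>e f. (e, f) \<in> edge_le B) (into n u)"
    unfolding in_edges_def S_def[symmetric] by (rule theI'[OF ex1])
  then show "distinct (into n u)" "set (into n u) = {e \<in> edges B n. rng B e = L (Suc n) u}"
    "sorted_wrt (\<lambda>e f. (e, f) \<in> edge_le B) (into n u)" using S by auto
qed

lemma source_word_\<tau>:
  assumes "u \<in> R"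
  shows "map (\<lambda>e. inv_into R (L (Suc n)) (src B e)) (into (Suc n) u) = \<tau> u"
proof -
  have "source_word B R L (Suc n) u = source_word B R L 1 u"
  proof -
    have "\<forall>n\<ge>1. \<forall>c\<in>R. source_word B R L n c = source_word B R L 1 c"
      using stationary unfolding stationary_ordered_def by (elim conjE)
    from this[rule_format, of "Suc n" u] assms show ?thesis by simp
  qed
  also have "\<dots> = \<tau> u" using read assms by (simp add: substitution_read_def)
  finally show ?thesis by (simp add: source_word_def)
qed

lemma src_in: "e \<in> edges B n \<Longrightarrow> src B e \<in> verts B n"
proof -
  have "src B ` edges B n = verts B n" using diagram by (simp add: bratteli_diagram_def)
  then show "e \<in> edges B n \<Longrightarrow> src B e \<in> verts B n" by blast
qed

lemma length_into: assumes "u \<in> R" shows "length (into n u) = num_pieces n u"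
proof (cases n)
  case 0
  have "{e \<in> all_edges B. src B e = v0 \<and> rng B e = L 1 u} = set (into 0 u)"
    using into(2)[OF assms, of 0] edges_into[OF L_in[OF assms, of 0]] src_in[of _ 0] top_vertex by auto
  moreover have "card {e \<in> all_edges B. src B e = v0 \<and> rng B e = L 1 u} = length u"
    using top_edges assms unfolding num_edges_def by blast
  ultimately have "length u = card (set (into 0 u))" by simp
  then show ?thesis using distinct_card[OF into(1)[OF assms]] 0 by simp
next
  case (Suc k)
  then show ?thesis using arg_cong[OF source_word_\<tau>[OF assms, of k], of length] by simp
qed

lemma into_edge:
  assumes "u \<in> R" "i < num_pieces n u"
  shows "into n u ! i \<in> edges B n" "rng B (into n u ! i) = L (Suc n) u" "into n u ! i \<in> all_edges B"
proof -
  have "into n u ! i \<in> set (into n u)" using assms length_into by simp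
  then show "into n u ! i \<in> edges B n" "rng B (into n u ! i) = L (Suc n) u" using into(2)[OF assms(1)] by auto
  then show "into n u ! i \<in> all_edges B" by (auto simp: all_edges_def)
qed

lemma src_into:
  assumes "u \<in> R" "i < length (\<tau> u)"
  shows "src B (into (Suc n) u ! i) = L (Suc n) (\<tau> u ! i)"
proof -
  have i: "i < num_pieces (Suc n) u" using assms by simp
  have "\<tau> u ! i = inv_into R (L (Suc n)) (src B (into (Suc n) u ! i))"
    using source_word_\<tau>[OF assms(1), of n] i length_into[OF assms(1), of "Suc n"] nth_map by metis
  moreover have "src B (into (Suc n) u ! i) \<in> L (Suc n) ` R"
    using src_in[OF into_edge(1)[OF assms(1) i]] bij_betw_imp_surj_on[OF L_bij[of n]] by simp
  ultimately show ?thesis by (simp add: f_inv_into_f)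
qed

lemma into_le_iff:
  assumes "u \<in> R" "i < num_pieces n u" "k < num_pieces n u"
  shows "(into n u ! i, into n u ! k) \<in> edge_le B \<longleftrightarrow> i \<le> k"
proof -
  have le: "(into n u ! i, into n u ! k) \<in> edge_le B" if "i \<le> k" "k < num_pieces n u" for i k
  proof (cases "i = k")
    case True then show ?thesis using edge_order(3) into_edge(3)[OF assms(1) that(2)] by simp
  next
    case False
    then show ?thesis using sorted_wrt_nth_less[OF into(3)[OF assms(1)], of i k n] that length_into[OF assms(1)] by simp
  qed
  show ?thesis
  proof
    assume a: "(into n u ! i, into n u ! k) \<in> edge_le B"
    show "i \<le> k"
    proof (rule ccontr)
      assume "\<not> i \<le> k"
      then have "(into n u ! k, into n u ! i) \<in> edge_le B" using le assms by simp
      then have "into n u ! i = into n u ! k" using a antisymD[OF edge_order(2)] by blast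
      then show False
        using nth_eq_iff_index_eq[OF into(1)[OF assms(1)], of i n k] assms length_into[OF assms(1)] \<open>\<not> i \<le> k\<close> by simp
    qed
  qed (use le assms in auto)
qed

lemma into_obtain:
  assumes "u \<in> R" "f \<in> all_edges B" "rng B f = L (Suc n) u"
  obtains k where "k < num_pieces n u" "f = into n u ! k"
proof -
  have "f \<in> set (into n u)" using into(2)[OF assms(1), of n] edges_into[OF L_in[OF assms(1), of n]] assms(2,3) by auto
  then show thesis using that length_into[OF assms(1)] by (metis in_set_conv_nth)
qed

lemma max_edge_iff:
  assumes "u \<in> R" "i < num_pieces n u" shows "max_edge B (into n u ! i) \<longleftrightarrow> Suc i = num_pieces n u"
proof
  assume m: "max_edge B (into n u ! i)"
  show "Suc i = num_pieces n u"
  proof (rule ccontr)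
    assume "Suc i \<noteq> num_pieces n u"
    then have k: "Suc i < num_pieces n u" using assms(2) by simp
    have "(into n u ! i, into n u ! Suc i) \<in> edge_le B" using into_le_iff[OF assms k] by simp
    then have "into n u ! Suc i = into n u ! i"
      using m into_edge(2,3)[OF assms(1) k] into_edge(2)[OF assms] unfolding max_edge_def by simp
    then show False
      using nth_eq_iff_index_eq[OF into(1)[OF assms(1)], of "Suc i" n i] k length_into[OF assms(1)] by simp
  qed
next
  assume last: "Suc i = num_pieces n u"
  show "max_edge B (into n u ! i)"
    unfolding max_edge_def into_edge(2)[OF assms]
  proof (intro ballI impI, elim conjE)
    fix f assume f: "f \<in> all_edges B" "rng B f = L (Suc n) u" "(into n u ! i, f) \<in> edge_le B"
    obtain k where k: "k < num_pieces n u" "f = into n u ! k" using into_obtain[OF assms(1) f(1,2)] .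
    then show "f = into n u ! i" using into_le_iff[OF assms k(1)] f(3) last by (metis Suc_leI le_antisym less_Suc_eq_le)
  qed
qed

lemma min_edge_iff:
  assumes "u \<in> R" "i < num_pieces n u" shows "min_edge B (into n u ! i) \<longleftrightarrow> i = 0"
proof
  assume m: "min_edge B (into n u ! i)"
  have k: "0 < num_pieces n u" using assms(2) by simp
  have "(into n u ! 0, into n u ! i) \<in> edge_le B" using into_le_iff[OF assms(1) k assms(2)] by simp
  then have "into n u ! 0 = into n u ! i"
    using m into_edge(2,3)[OF assms(1) k] into_edge(2)[OF assms] unfolding min_edge_def by simp
  then show "i = 0"
    using nth_eq_iff_index_eq[OF into(1)[OF assms(1)], of 0 n i] k assms(2) length_into[OF assms(1)] by simp
next
  assume "i = 0"
  show "min_edge B (into n u ! i)"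
    unfolding min_edge_def into_edge(2)[OF assms]
  proof (intro ballI impI, elim conjE)
    fix f assume f: "f \<in> all_edges B" "rng B f = L (Suc n) u" "(f, into n u ! i) \<in> edge_le B"
    obtain k where k: "k < num_pieces n u" "f = into n u ! k" using into_obtain[OF assms(1) f(1,2)] .
    then show "f = into n u ! i" using into_le_iff[OF assms(1) k(1) assms(2)] f(3) \<open>i = 0\<close> by simp
  qed
qed

lemma successor_edge_Suc:
  assumes "u \<in> R" "Suc i < num_pieces n u" shows "successor_edge B (into n u ! i) (into n u ! Suc i)"
proof -
  have i: "i < num_pieces n u" using assms(2) by simp
  have "into n u ! Suc i \<noteq> into n u ! i"
    using nth_eq_iff_index_eq[OF into(1)[OF assms(1)], of "Suc i" n i] assms length_into[OF assms(1)] by simp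
  moreover have "g = into n u ! i \<or> g = into n u ! Suc i"
    if g: "g \<in> all_edges B" "rng B g = L (Suc n) u" "(into n u ! i, g) \<in> edge_le B" "(g, into n u ! Suc i) \<in> edge_le B" for g
  proof -
    obtain k where k: "k < num_pieces n u" "g = into n u ! k" using into_obtain[OF assms(1) g(1,2)] .
    then have "i \<le> k" "k \<le> Suc i"
      using into_le_iff[OF assms(1) i k(1)] into_le_iff[OF assms(1) k(1) assms(2)] g(3,4) by auto
    then show ?thesis using k(2) by (metis le_Suc_eq le_antisym)
  qed
  ultimately show ?thesis
    using into_edge[OF assms(1) i] into_edge[OF assms] into_le_iff[OF assms(1) i assms(2)]
    unfolding successor_edge_def by auto
qed

definition code_path :: "(int \<Rightarrow> 'a) \<Rightarrow> nat \<Rightarrow> 'e" where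
  "code_path x n = into n (U n x) ! K n x"

lemma path_in:
  assumes "x \<in> X" shows "code_path x \<in> paths B"
proof -
  have "code_path x n \<in> edges B n \<and> rng B (code_path x n) = src B (code_path x (Suc n))" for n
  proof -
    have "src B (code_path x (Suc n)) = L (Suc n) (U n x)"
      unfolding code_path_def K_Suc(2)[OF assms, of n] by (rule src_into[OF U_return_word[OF assms] K_Suc(1)[OF assms]])
    then show ?thesis
      using into_edge[OF U_return_word[OF assms] K_less[OF assms], of n] by (simp add: code_path_def)
  qed
  then show ?thesis by (simp add: paths_def)
qed

lemma path_coordinates:
  assumes "q \<in> paths B"
  obtains u k where "\<And>n. u n \<in> R" "\<And>n. k n < num_pieces n (u n)" "\<And>n. q n = into n (u n) ! k n"
    "\<And>n. u n = \<tau> (u (Suc n)) ! k (Suc n)"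
proof -
  have "\<exists>u k. u \<in> R \<and> k < num_pieces n u \<and> q n = into n u ! k" for n
  proof -
    have e: "q n \<in> edges B n" using assms by (simp add: paths_def)
    moreover have "rng B ` edges B n = verts B (Suc n)" using diagram by (simp add: bratteli_diagram_def)
    ultimately have "rng B (q n) \<in> verts B (Suc n)" by blast
    then obtain u where u: "u \<in> R" "rng B (q n) = L (Suc n) u"
      using bij_betw_imp_surj_on[OF L_bij[of n]] by blast
    obtain k where "k < num_pieces n u" "q n = into n u ! k"
      using into_obtain[OF u(1) _ u(2)] e by (auto simp: all_edges_def)
    with u show ?thesis by blast
  qed
  then obtain u k where uk: "\<And>n. u n \<in> R" "\<And>n. k n < num_pieces n (u n)" "\<And>n. q n = into n (u n) ! k n" by metis
  have "u n = \<tau> (u (Suc n)) ! k (Suc n)" for n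
  proof -
    have k: "k (Suc n) < length (\<tau> (u (Suc n)))" using uk(2)[of "Suc n"] by simp
    have "L (Suc n) (u n) = rng B (q n)" using into_edge(2)[OF uk(1,2)] uk(3) by simp
    also have "\<dots> = src B (q (Suc n))" using assms by (simp add: paths_def)
    also have "\<dots> = L (Suc n) (\<tau> (u (Suc n)) ! k (Suc n))"
      unfolding uk(3) by (rule src_into[OF uk(1) k])
    finally show ?thesis using L_inj[OF uk(1) \<tau>_return_word[OF uk(1) k]] by blast
  qed
  with uk that show thesis by blast
qed

text \<open>The edges give the addresses at all levels, and these determine all coordinates.\<close>

lemma path_inj:
  assumes "x \<in> X" "x' \<in> X" "code_path x = code_path x'" shows "x = x'"
proof -
  have UK: "U n x = U n x' \<and> K n x = K n x'" for n
  proof -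
    have eq: "into n (U n x) ! K n x = into n (U n x') ! K n x'" using assms(3) unfolding code_path_def by metis
    have "L (Suc n) (U n x) = L (Suc n) (U n x')"
      using into_edge(2)[OF U_return_word[OF assms(1)] K_less[OF assms(1)], of n]
        into_edge(2)[OF U_return_word[OF assms(2)] K_less[OF assms(2)], of n] eq by simp
    then have u: "U n x = U n x'" by (rule L_inj[OF U_return_word[OF assms(1)] U_return_word[OF assms(2)]])
    then have "K n x = K n x'"
      using eq nth_eq_iff_index_eq[OF into(1)[OF U_return_word[OF assms(1), of n], of n], of "K n x" "K n x'"]
        K_less[OF assms(1), of n] K_less[OF assms(2), of n] length_into[OF U_return_word[OF assms(1), of n], of n]
      by simp
    with u show ?thesis by simp
  qed
  have J: "J n x = J n x'" for n
  proof (induction n)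
    case 0 then show ?case using K_0[OF assms(1)] K_0[OF assms(2)] UK[of 0] by metis
  next
    case (Suc n)
    then show ?case using K_Suc(3)[OF assms(1), of n] K_Suc(3)[OF assms(2), of n] UK[of "Suc n"] by metis
  qed
  have "agree (int N) x x'" for N
  proof -
    obtain n where n: "\<And>u j x x'. in_tower n u j x \<Longrightarrow> in_tower n u j x' \<Longrightarrow> 0 \<le> j \<Longrightarrow> j < len n u \<Longrightarrow> agree (int N) x x'"
      using in_tower_agree[of N] by blast
    show ?thesis
      by (rule n[OF address(1)[OF assms(1)] _ address(2,3)[OF assms(1)]])
         (use address(1)[OF assms(2), of n] UK[of n] J[of n] in simp)
  qed
  then have "x p = x' p" for p unfolding agree_def by (metis nat_0_le abs_ge_zero order_refl)
  then show ?thesis by auto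
qed

text \<open>The initial segments of a path describe a decreasing sequence of nonempty closed sets of points,
  which have a point in common by compactness.\<close>

lemma path_surj:
  assumes "q \<in> paths B" shows "\<exists>x\<in>X. code_path x = q"
proof -
  obtain u k where uk: "\<And>n. u n \<in> R" "\<And>n. k n < num_pieces n (u n)" "\<And>n. q n = into n (u n) ! k n"
    "\<And>n. u n = \<tau> (u (Suc n)) ! k (Suc n)" using path_coordinates[OF assms] by metis
  have kl: "k (Suc n) < length (\<tau> (u (Suc n)))" for n using uk(2)[of "Suc n"] by simp
  \<comment> \<open>the position of the origin in the block of level \<open>n\<close>, summed up along the path\<close>
  define j where "j = (\<lambda>n. int (k 0) + (\<Sum>i<n. start i (u (Suc i)) (k (Suc i))))"
  have j_Suc: "j (Suc n) = j n + start n (u (Suc n)) (k (Suc n))" for n by (simp add: j_def)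
  have st: "start n (u (Suc n)) (Suc (k (Suc n))) = start n (u (Suc n)) (k (Suc n)) + len n (u n)" for n
    using start_Suc[OF kl[of n]] uk(4)[of n] by metis
  have jb: "0 \<le> j n \<and> j n < len n (u n)" for n
  proof (induction n)
    case 0 then show ?case using uk(2)[of 0] by (simp add: j_def)
  next
    case (Suc n)
    have "0 \<le> start n (u (Suc n)) (k (Suc n))" by (simp add: start_def)
    moreover have "start n (u (Suc n)) (Suc (k (Suc n))) \<le> start n (u (Suc n)) (length (\<tau> (u (Suc n))))"
      by (rule start_mono) (use kl[of n] in auto)
    ultimately show ?case using Suc j_Suc[of n] st[of n] start_length[of n "u (Suc n)"] by linarith
  qed
  define C where "C = (\<lambda>n. {x. in_tower n (u n) (j n) x})"
  have "(\<Inter>n. C n) \<noteq> {}"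
  proof (rule compact_space_imp_nest[OF compact_full_shift])
    show "closedin full_shift (C n)" for n unfolding C_def by (rule in_tower_closed)
    show "C n \<noteq> {}" for n unfolding C_def using in_tower_nonempty[OF uk(1)] by auto
    show "decseq C"
    proof (rule decseq_SucI, safe)
      fix n x assume "x \<in> C (Suc n)"
      then have "in_tower (Suc n) (u (Suc n)) (j (Suc n)) x" by (simp add: C_def)
      from in_tower_down[OF this kl] show "x \<in> C n" using uk(4)[of n] j_Suc[of n] by (simp add: C_def)
    qed
  qed
  then obtain x where x: "\<And>n. in_tower n (u n) (j n) x" by (auto simp: C_def)
  have UJ: "U n x = u n" "J n x = j n" for n using address_eq[OF x] jb by auto
  have "K n x = k n" for n
  proof (cases n)
    case 0 then show ?thesis by (simp add: UJ idx.simps) (simp add: j_def)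
  next
    case (Suc i)
    have "idx (Suc i) (u (Suc i)) (j (Suc i)) = k (Suc i)"
      by (rule idx_Suc_eq[OF kl]) (use j_Suc[of i] st[of i] jb[of i] in auto)
    then show ?thesis by (simp add: UJ Suc)
  qed
  then have "code_path x = q" using uk(3) UJ(1) by (auto simp: code_path_def)
  then show ?thesis using in_tower_in_X[OF x] by blast
qed

abbreviation "X_top \<equiv> subst_topology \<sigma>"

lemma topspace_X [simp]: "topspace (X_top) = X"
  by (simp add: subst_topology_def)

lemma compact_X: "compact_space (X_top)"
  unfolding subst_topology_def
  by (rule compact_space_subtopology, rule closedin_compact_space[OF compact_full_shift X_closed])

lemma Hausdorff_X: "Hausdorff_space (X_top)"
  unfolding subst_topology_def by (rule Hausdorff_space_subtopology[OF Hausdorff_full_shift])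

text \<open>The complement is the union of finitely many closed sets, one for each of the other addresses.\<close>

lemma openin_address: "openin (X_top) {x \<in> X. address n x = (u, j)}"
proof -
  define F where "F = (SIGMA u:R. {0..<len n u}) - {(u, j)}"
  have "finite F" unfolding F_def using finite_R by auto
  have "closedin (X_top) (X \<inter> {x. in_tower n u j x})" for u j
    unfolding subst_topology_def by (rule closedin_subtopology_Int_closed[OF in_tower_closed])
  then have "closedin (X_top) (\<Union>(u, j)\<in>F. X \<inter> {x. in_tower n u j x})"
    using \<open>finite F\<close> by (intro closedin_Union) auto
  then have "openin (X_top) (X - (\<Union>(u, j)\<in>F. X \<inter> {x. in_tower n u j x}))"
    by (simp add: closedin_def)
  moreover have "X - (\<Union>(u, j)\<in>F. X \<inter> {x. in_tower n u j x}) = {x \<in> X. address n x = (u, j)}"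
  proof safe
    fix x assume x: "x \<in> X" "x \<notin> (\<Union>(u, j)\<in>F. X \<inter> {x. in_tower n u j x})"
    have "address n x \<in> (SIGMA u:R. {0..<len n u})"
      using address(2,3)[OF x(1), of n] U_return_word[OF x(1), of n] by (metis SigmaI atLeastLessThan_iff prod.collapse)
    moreover have "address n x \<notin> F" using x address(1)[OF x(1), of n] by (auto simp: case_prod_beta)
    ultimately show "address n x = (u, j)" by (auto simp: F_def)
  next
    fix x u' j' assume "x \<in> X" "address n x = (u, j)" "(u', j') \<in> F" "in_tower n u' j' x"
    then show False using address_eq[of n u' j' x] by (auto simp: F_def)
  qed
  ultimately show ?thesis by simp
qed

lemma openin_path_edge: "openin (X_top) {x \<in> X. code_path x n = e}"
proof -
  have "{x \<in> X. code_path x n = e} = (\<Union>(u, j)\<in>{(u, j). into n u ! idx n u j = e}. {x \<in> X. address n x = (u, j)})"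
    by (auto simp: code_path_def)
  then show ?thesis using openin_address by (auto intro!: openin_Union)
qed

lemma continuous_path: "continuous_map (X_top) (path_topology B) code_path"
  unfolding path_topology_def
proof (rule continuous_on_generated_topo)
  fix V assume "V \<in> {cylinder B n q |n q. q \<in> paths B}"
  then obtain n q where V: "V = cylinder B n q" by blast
  have "openin (X_top) {x \<in> X. \<forall>i<n. code_path x i = q i}"
  proof (induction n)
    case 0 show ?case using openin_topspace[of "X_top"] by simp
  next
    case (Suc n)
    have "{x \<in> X. \<forall>i<Suc n. code_path x i = q i} = {x \<in> X. \<forall>i<n. code_path x i = q i} \<inter> {x \<in> X. code_path x n = q n}"
      by (auto simp: less_Suc_eq)
    then show ?case using Suc openin_path_edge by auto
  qed
  moreover have "code_path -` V \<inter> topspace (X_top) = {x \<in> X. \<forall>i<n. code_path x i = q i}"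
    using path_in by (auto simp: V cylinder_def)
  ultimately show "openin (X_top) (code_path -` V \<inter> topspace (X_top))" by simp
next
  show "code_path ` topspace (X_top) \<subseteq> \<Union> {cylinder B n q |n q. q \<in> paths B}"
  proof (rule image_subsetI)
    fix x assume "x \<in> topspace (X_top)"
    then have x: "code_path x \<in> paths B" using path_in by simp
    then have "code_path x \<in> cylinder B 0 (code_path x)" by (simp add: cylinder_def)
    with x show "code_path x \<in> \<Union> {cylinder B n q |n q. q \<in> paths B}" by blast
  qed
qed

lemma homeomorphic_path: "homeomorphic_map (X_top) (path_topology B) code_path"
proof (rule continuous_imp_homeomorphic_map[OF continuous_path compact_X Hausdorff_path_topology])
  show "code_path ` topspace (X_top) = topspace (path_topology B)"
    using path_in path_surj by (auto simp: topspace_path_topology)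
  show "inj_on code_path (topspace (X_top))" using path_inj by (auto intro: inj_onI)
qed

lemma max_edge_path: "x \<in> X \<Longrightarrow> max_edge B (code_path x n) \<longleftrightarrow> Suc (K n x) = num_pieces n (U n x)"
  unfolding code_path_def by (rule max_edge_iff[OF U_return_word K_less])

lemma min_edge_path: "x \<in> X \<Longrightarrow> min_edge B (code_path x n) \<longleftrightarrow> K n x = 0"
  unfolding code_path_def by (rule min_edge_iff[OF U_return_word K_less])

lemma max_path_iff: "x \<in> X \<Longrightarrow> code_path x \<in> max_paths B \<longleftrightarrow> (\<forall>n. J n x = len n (U n x) - 1)"
  using max_iff_J_last[of x] max_edge_path[of x] path_in[of x] by (simp add: max_paths_def)

lemma min_path_iff: "x \<in> X \<Longrightarrow> code_path x \<in> min_paths B \<longleftrightarrow> (\<forall>n. J n x = 0)"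
  using min_iff_J_zero[of x] min_edge_path[of x] path_in[of x] by (simp add: min_paths_def)

theorem vershik_conjugacy:
  "\<exists>T. vershik_homeomorphism B T \<and> homeomorphic_systems (path_topology B) T (X_top) shift"
proof -
  obtain h where h: "homeomorphic_maps (X_top) (path_topology B) code_path h"
    using homeomorphic_path by (auto simp: homeomorphic_map_maps)
  then have hh: "homeomorphic_map (path_topology B) (X_top) h"
    and hp: "\<And>x. x \<in> X \<Longrightarrow> h (code_path x) = x"
    by (auto simp: homeomorphic_maps_map topspace_path_topology)
  have hX: "h q \<in> X" if q: "q \<in> paths B" for q
  proof -
    obtain x where "x \<in> X" "code_path x = q" using path_surj[OF q] by blast
    then show ?thesis using hp[of x] by simp
  qed
  define T where "T = code_path \<circ> shift \<circ> h"
  have T: "T (code_path x) = code_path (shift x)" if "x \<in> X" for x using hp[OF that] by (simp add: T_def)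
  have sh: "homeomorphic_map (X_top) (X_top) shift"
    by (rule homeomorphic_map_shift[OF compact_X Hausdorff_X X_translate])
  have homeo: "homeomorphic_map (path_topology B) (path_topology B) T"
    unfolding T_def
    by (rule homeomorphic_map_compose[OF hh homeomorphic_map_compose[OF sh homeomorphic_path]])
  have "T ` max_paths B = min_paths B"
  proof (intro equalityI subsetI)
    fix q' assume "q' \<in> T ` max_paths B"
    then obtain q where q: "q \<in> max_paths B" "q' = T q" by blast
    then obtain x where x: "x \<in> X" "code_path x = q" using path_surj by (auto simp: max_paths_def)
    then have "\<forall>n. J n x = len n (U n x) - 1" using q(1) max_path_iff by blast
    then have "\<forall>n. J n (shift x) = 0" using J_shift_max[OF x(1)] by blast
    then show "q' \<in> min_paths B" using min_path_iff[OF shift_in_X[OF x(1)]] T[OF x(1)] x(2) q(2) by simp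
  next
    fix q assume q: "q \<in> min_paths B"
    then obtain y where y: "y \<in> X" "code_path y = q" using path_surj by (auto simp: min_paths_def)
    define x where "x = (\<lambda>p. y (p + (- 1)))"
    have x: "x \<in> X" "shift x = y" unfolding x_def by (rule X_translate[OF y(1)]) (simp add: shift_def)
    have "\<forall>n. J n y = 0" using q y min_path_iff by blast
    then have "\<forall>n. J n x = len n (U n x) - 1" using J_unshift_min[of x] x y(1) by simp
    then have "code_path x \<in> max_paths B" using max_path_iff[OF x(1)] by blast
    moreover have "T (code_path x) = q" using T[OF x(1)] x(2) y(2) by simp
    ultimately show "q \<in> T ` max_paths B" by blast
  qed
  moreover have "let k = (LEAST n. \<not> max_edge B (q n)) in
          (\<forall>i<k. min_edge B (T q i)) \<and> successor_edge B (q k) (T q k) \<and> (\<forall>i>k. T q i = q i)"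
    if q: "q \<in> paths B - max_paths B" for q
  proof -
    obtain x where x: "x \<in> X" "code_path x = q" using path_surj q by blast
    define k where "k = (LEAST n. \<not> max_edge B (q n))"
    have "\<exists>n. \<not> max_edge B (q n)" using q by (auto simp: max_paths_def)
    then have "\<not> max_edge B (q k)" unfolding k_def by (rule LeastI_ex)
    then have k: "Suc (K k x) < num_pieces k (U k x)"
      using max_edge_path[OF x(1), of k] x(2) K_less[OF x(1), of k] by (simp add: less_le_not_le Suc_le_eq)
    have "Suc (K i x) = num_pieces i (U i x)" if "i < k" for i
      using not_less_Least[of i "\<lambda>n. \<not> max_edge B (q n)"] that max_edge_path[OF x(1), of i] x(2)
      unfolding k_def by blast
    then have max: "\<forall>i<k. Suc (K i x) = num_pieces i (U i x)" by blast
    note s = shift_not_max[OF x(1) k max]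
    note sX = shift_in_X[OF x(1)]
    have Tq: "T q = code_path (shift x)" using T[OF x(1)] x(2) by simp
    have "min_edge B (T q i)" if "i < k" for i
      unfolding Tq using s(4)[OF that] min_edge_path[OF sX] by simp
    moreover have "successor_edge B (q k) (T q k)"
    proof -
      have "T q k = into k (U k x) ! Suc (K k x)"
        unfolding Tq code_path_def s(1)[OF order_refl] s(3)[unfolded s(1)[OF order_refl]] by (rule refl)
      moreover have "q k = into k (U k x) ! K k x" unfolding x(2)[symmetric] code_path_def by (rule refl)
      ultimately show ?thesis using successor_edge_Suc[OF U_return_word[OF x(1)] k] by simp
    qed
    moreover have "T q i = q i" if "i > k" for i
    proof -
      have "code_path (shift x) i = code_path x i"
        unfolding code_path_def s(1)[OF less_imp_le[OF that]]
          s(2)[OF that, unfolded s(1)[OF less_imp_le[OF that]]] by (rule refl)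
      then show ?thesis using Tq x(2) by simp
    qed
    ultimately show ?thesis unfolding Let_def k_def[symmetric] by blast
  qed
  ultimately have "vershik_homeomorphism B T"
    unfolding vershik_homeomorphism_def using homeo by blast
  moreover have "homeomorphic_systems (path_topology B) T (X_top) shift"
    unfolding homeomorphic_systems_def
  proof (intro exI conjI ballI)
    fix q assume "q \<in> topspace (path_topology B)"
    then have q: "q \<in> paths B" by (simp add: topspace_path_topology)
    show "h (T q) = shift (h q)" unfolding T_def o_def by (rule hp[OF shift_in_X[OF hX[OF q]]])
  qed (rule hh)
  ultimately show ?thesis by blast
qed

end

theorem theorem7p12:
  fixes \<sigma> :: "'a::finite \<Rightarrow> 'a list"
    and m :: nat
    and P :: "nat \<Rightarrow> 'a set"
    and w :: "nat \<Rightarrow> int \<Rightarrow> 'a"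
    and B :: "('v, 'e) bratteli"
    and L :: "nat \<Rightarrow> 'a list \<Rightarrow> 'v"
    and v0 :: 'v
  assumes "m_primitive \<sigma> m P"
    and "aperiodic \<sigma>"
    and "uncountable (subst_space \<sigma>)"
    and "fixed_points \<sigma> m P w"
    and "ordered_bratteli_diagram B"
    and "stationary_ordered B (return_words \<sigma> m w) L"
    and "\<forall>u\<in>return_words \<sigma> m w.
           substitution_read B (return_words \<sigma> m w) L u = derivative_subst \<sigma> m w u"
    and "verts B 0 = {v0}"
    and "\<forall>u\<in>return_words \<sigma> m w. num_edges B v0 (L 1 u) = length u"
  shows "\<exists>T. vershik_homeomorphism B T \<and>
           homeomorphic_systems (path_topology B) T (subst_topology \<sigma>) shift"
proof -
  interpret return_word_diagram \<sigma> m P w B L v0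
    by unfold_locales (use assms in auto)
  show ?thesis by (rule vershik_conjugacy)
qed

end
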